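(* Let $\mathbb{M}$ be a monster model of a complete $C$-minimal expansion of ACVF whose language contains a constant symbol $t$ with $v(t)>0$. Let $D\subseteq\mathrm{RV}^2$ be definable, and let $X$ be a fragment whose stabilizer $\mathrm{Stab}(X)=\{(u,w)\in\mathrm{RV}^2:(u,w)\cdot X=X\}$ is infinite. Let $D^X$ be the set of $(a,b)\in\Gamma^2$ such that $D\cap(\mathrm{RV}_a\times\mathrm{RV}_b)=(u,w)\cdot X$ for some $(u,w)\in\mathrm{RV}^2$. Then $D^X$ is a union of finitely many points and finitely many line segments, all of which have the same slope (pairwise).
   Context: ACVF is the theory of algebraically closed non-trivially valued fields; $C$-minimal means every definable subset of the home sort is a finite boolean combination of balls and points. "Definable" means with parameters. $\Gamma$ is the value group, $\mathfrak m$ the maximal ideal, $k$ the residue field (strongly minimal). $\mathrm{RV}=\mathbb{M}^\times/(1+\mathfrak m)$, multiplicative, with surjection $\mathrm{RV}\to\Gamma$ induced by $v$, kernel $k^\times$, fibers $\mathrm{RV}_\gamma$. Each $\mathrm{RV}_a\times\mathrm{RV}_b$ is in definable bijection with $(k^\times)^2$ by translation; $\dim$ is Morley rank via this bijection. A fragment is a non-empty definable $X\subseteq\mathrm{RV}_a\times\mathrm{RV}_b$ with $\dim(X)<2$. A line segment in $\Gamma^2$ is a vertical segment $\{a\}\times I$ ($I$ open interval) or the graph of a definable linear function $f:I\to\Gamma$ on an open interval $I$ (possibly unbounded), where linear means $f(a)+f(a+\epsilon_1+\epsilon_2)=f(a+\epsilon_1)+f(a+\epsilon_2)$ whenever all four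 points lie in $I$. Two line segments $A,B$ have the same slope if $A\cap(B+(x,y))$ is infinite for some $(x,y)\in\Gamma^2$. *)

theory Defs
  imports "HOL-Algebra.Coset" "HOL-Computational_Algebra.Polynomial"
begin

section \<open>First-order structures\<close>

datatype 'f fo_term = Var nat | App 'f "'f fo_term list"

datatype ('f, 'r) fo_form =
    Eq "'f fo_term" "'f fo_term"
  | Rel 'r "'f fo_term list"
  | Neg "('f, 'r) fo_form"
  | Conj "('f, 'r) fo_form" "('f, 'r) fo_form"
  | Exists nat "('f, 'r) fo_form"

text \<open>The universe of a structure is the whole type \<^typ>\<open>'a\<close>. Constant symbols are function
  symbols of arity 0. Interpretations are only ever used on lists of the right length.\<close>

record ('f, 'r, 'a) fo_struct =
  fun_arity :: "'f \<Rightarrow> nat"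
  rel_arity :: "'r \<Rightarrow> nat"
  fun_int :: "'f \<Rightarrow> 'a list \<Rightarrow> 'a"
  rel_int :: "'r \<Rightarrow> 'a list \<Rightarrow> bool"

primrec vars_term :: "'f fo_term \<Rightarrow> nat set" where
  "vars_term (Var i) = {i}"
| "vars_term (App f ts) = \<Union> (set (map vars_term ts))"

primrec free_vars :: "('f, 'r) fo_form \<Rightarrow> nat set" where
  "free_vars (Eq s t) = vars_term s \<union> vars_term t"
| "free_vars (Rel r ts) = \<Union> (set (map vars_term ts))"
| "free_vars (Neg \<phi>) = free_vars \<phi>"
| "free_vars (Conj \<phi> \<psi>) = free_vars \<phi> \<union> free_vars \<psi>"
| "free_vars (Exists i \<phi>) = free_vars \<phi> - {i}"

primrec wf_term :: "('f, 'r, 'a) fo_struct \<Rightarrow> 'f fo_term \<Rightarrow> bool" where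
  "wf_term M (Var i) \<longleftrightarrow> True"
| "wf_term M (App f ts) \<longleftrightarrow> length ts = fun_arity M f \<and> list_all (wf_term M) ts"

primrec wf_form :: "('f, 'r, 'a) fo_struct \<Rightarrow> ('f, 'r) fo_form \<Rightarrow> bool" where
  "wf_form M (Eq s t) \<longleftrightarrow> wf_term M s \<and> wf_term M t"
| "wf_form M (Rel r ts) \<longleftrightarrow> length ts = rel_arity M r \<and> list_all (wf_term M) ts"
| "wf_form M (Neg \<phi>) \<longleftrightarrow> wf_form M \<phi>"
| "wf_form M (Conj \<phi> \<psi>) \<longleftrightarrow> wf_form M \<phi> \<and> wf_form M \<psi>"
| "wf_form M (Exists i \<phi>) \<longleftrightarrow> wf_form M \<phi>"

primrec eval_term :: "('f, 'r, 'a) fo_struct \<Rightarrow> (nat \<Rightarrow> 'a) \<Rightarrow> 'f fo_term \<Rightarrow> 'a" where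
  "eval_term M e (Var i) = e i"
| "eval_term M e (App f ts) = fun_int M f (map (eval_term M e) ts)"

primrec sat :: "('f, 'r, 'a) fo_struct \<Rightarrow> (nat \<Rightarrow> 'a) \<Rightarrow> ('f, 'r) fo_form \<Rightarrow> bool" where
  "sat M e (Eq s t) \<longleftrightarrow> eval_term M e s = eval_term M e t"
| "sat M e (Rel r ts) \<longleftrightarrow> rel_int M r (map (eval_term M e) ts)"
| "sat M e (Neg \<phi>) \<longleftrightarrow> \<not> sat M e \<phi>"
| "sat M e (Conj \<phi> \<psi>) \<longleftrightarrow> sat M e \<phi> \<and> sat M e \<psi>"
| "sat M e (Exists i \<phi>) \<longleftrightarrow> (\<exists>x. sat M (e(i := x)) \<phi>)"

text \<open>Definability with parameters: variables below \<open>n\<close> are the coordinates, the remaining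
  ones carry the parameters.\<close>

definition definable :: "('f, 'r, 'a) fo_struct \<Rightarrow> nat \<Rightarrow> 'a list set \<Rightarrow> bool" where
  "definable M n S \<longleftrightarrow> (\<exists>\<phi> e. wf_form M \<phi> \<and>
     S = {xs. length xs = n \<and> sat M (\<lambda>i. if i < n then xs ! i else e i) \<phi>})"

section \<open>Monster models\<close>

text \<open>Cardinals are represented by cardinal orders as in
  \<^theory>\<open>HOL.BNF_Cardinal_Order_Relation\<close>. A formula over \<open>A\<close> in the variable 0 is a pair of a
  formula and an assignment of elements of \<open>A\<close> to its other free variables.\<close>

definition saturated :: "('f, 'r, 'a) fo_struct \<Rightarrow> 'a rel \<Rightarrow> bool" where
  "saturated M \<kappa> \<longleftrightarrow> (\<forall>A. (card_of A, \<kappa>) \<in> ordLess \<longrightarrow>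
     (\<forall>p. (\<forall>(\<phi>, e) \<in> p. wf_form M \<phi> \<and> (\<forall>i \<in> free_vars \<phi> - {0}. e i \<in> A)) \<and>
          (\<forall>q. finite q \<and> q \<subseteq> p \<longrightarrow> (\<exists>x. \<forall>(\<phi>, e) \<in> q. sat M (e(0 := x)) \<phi>))
        \<longrightarrow> (\<exists>x. \<forall>(\<phi>, e) \<in> p. sat M (e(0 := x)) \<phi>)))"

definition automorphism :: "('f, 'r, 'a) fo_struct \<Rightarrow> ('a \<Rightarrow> 'a) \<Rightarrow> bool" where
  "automorphism M \<sigma> \<longleftrightarrow> bij \<sigma> \<and>
     (\<forall>f xs. length xs = fun_arity M f \<longrightarrow> \<sigma> (fun_int M f xs) = fun_int M f (map \<sigma> xs)) \<and>
     (\<forall>r xs. length xs = rel_arity M r \<longrightarrow> rel_int M r (map \<sigma> xs) = rel_int M r xs)"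

definition elementary_on :: "('f, 'r, 'a) fo_struct \<Rightarrow> 'a set \<Rightarrow> ('a \<Rightarrow> 'a) \<Rightarrow> bool" where
  "elementary_on M A g \<longleftrightarrow> (\<forall>\<phi> e. wf_form M \<phi> \<and> (\<forall>i \<in> free_vars \<phi>. e i \<in> A) \<longrightarrow>
     sat M (\<lambda>i. g (e i)) \<phi> = sat M e \<phi>)"

definition strongly_homogeneous :: "('f, 'r, 'a) fo_struct \<Rightarrow> 'a rel \<Rightarrow> bool" where
  "strongly_homogeneous M \<kappa> \<longleftrightarrow>
     (\<forall>A g. (card_of A, \<kappa>) \<in> ordLess \<and> elementary_on M A g \<longrightarrow>
        (\<exists>\<sigma>. automorphism M \<sigma> \<and> (\<forall>x \<in> A. \<sigma> x = g x)))"

text \<open>The bound \<open>\<kappa>\<close> exceeds the cardinality of the language (the set of formulas, so in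
  particular \<open>\<aleph>\<^sub>0\<close>). Taking \<open>\<kappa>\<close> on the universe itself loses nothing, because a
  \<open>\<kappa>\<close>-saturated infinite structure has at least \<open>\<kappa>\<close> elements.\<close>

definition monster_model :: "('f, 'r, 'a) fo_struct \<Rightarrow> bool" where
  "monster_model M \<longleftrightarrow> (\<exists>\<kappa> :: 'a rel. Card_order \<kappa> \<and>
     (card_of {\<phi>. wf_form M \<phi>}, \<kappa>) \<in> ordLess \<and> saturated M \<kappa> \<and> strongly_homogeneous M \<kappa>)"

section \<open>Valued fields\<close>

text \<open>\<open>\<Gamma>\<close> is written additively and is the whole type \<^typ>\<open>'g\<close>. The value \<open>v 0 = \<infinity>\<close> is not
  represented: \<^term>\<open>v 0\<close> is unspecified and never used.\<close>

definition valuation :: "('a::field \<Rightarrow> 'g::linordered_ab_group_add) \<Rightarrow> bool" where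
  "valuation v \<longleftrightarrow>
     (\<forall>x y. x \<noteq> 0 \<and> y \<noteq> 0 \<longrightarrow> v (x * y) = v x + v y) \<and>
     (\<forall>x y. x \<noteq> 0 \<and> y \<noteq> 0 \<and> x + y \<noteq> 0 \<longrightarrow> min (v x) (v y) \<le> v (x + y)) \<and>
     v ` (- {0}) = UNIV"

definition nontrivial_valuation :: "('a::field \<Rightarrow> 'g::linordered_ab_group_add) \<Rightarrow> bool" where
  "nontrivial_valuation v \<longleftrightarrow> valuation v \<and> (\<exists>x. x \<noteq> 0 \<and> v x \<noteq> 0)"

definition open_ball :: "('a::field \<Rightarrow> 'g::linordered_ab_group_add) \<Rightarrow> 'a \<Rightarrow> 'g \<Rightarrow> 'a set" where
  "open_ball v c \<gamma> = {x. x = c \<or> \<gamma> < v (x - c)}"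

definition closed_ball :: "('a::field \<Rightarrow> 'g::linordered_ab_group_add) \<Rightarrow> 'a \<Rightarrow> 'g \<Rightarrow> 'a set" where
  "closed_ball v c \<gamma> = {x. x = c \<or> \<gamma> \<le> v (x - c)}"

inductive_set ball_combinations :: "('a::field \<Rightarrow> 'g::linordered_ab_group_add) \<Rightarrow> 'a set set"
  for v where
  point: "{c} \<in> ball_combinations v"
| open_ball: "open_ball v c \<gamma> \<in> ball_combinations v"
| closed_ball: "closed_ball v c \<gamma> \<in> ball_combinations v"
| compl: "A \<in> ball_combinations v \<Longrightarrow> - A \<in> ball_combinations v"
| union: "A \<in> ball_combinations v \<Longrightarrow> B \<in> ball_combinations v \<Longrightarrow> A \<union> B \<in> ball_combinations v"

text \<open>An expansion of the language of valued fields containing a constant \<open>t\<close>: the symbols of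
  the language of valued fields, the symbol for \<open>t\<close>, and arbitrary further symbols.\<close>

datatype 'f vf_fun = FZero | FOne | FAdd | FUminus | FMult | FT | FExtra 'f

datatype 'r vf_rel = RVal | RExtra 'r

text \<open>\<^const>\<open>RVal\<close> is interpreted as \<open>v x \<le> v y\<close>, with the convention \<open>v 0 = \<infinity>\<close>.\<close>

definition expands_valued_field ::
    "('f vf_fun, 'r vf_rel, 'a::field) fo_struct \<Rightarrow> ('a \<Rightarrow> 'g::linordered_ab_group_add) \<Rightarrow> bool" where
  "expands_valued_field M v \<longleftrightarrow>
     fun_arity M FZero = 0 \<and> fun_int M FZero [] = 0 \<and>
     fun_arity M FOne = 0 \<and> fun_int M FOne [] = 1 \<and>
     fun_arity M FAdd = 2 \<and> (\<forall>x y. fun_int M FAdd [x, y] = x + y) \<and>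
     fun_arity M FUminus = 1 \<and> (\<forall>x. fun_int M FUminus [x] = - x) \<and>
     fun_arity M FMult = 2 \<and> (\<forall>x y. fun_int M FMult [x, y] = x * y) \<and>
     fun_arity M FT = 0 \<and>
     rel_arity M RVal = 2 \<and>
     (\<forall>x y. rel_int M RVal [x, y] \<longleftrightarrow> y = 0 \<or> (x \<noteq> 0 \<and> v x \<le> v y))"

definition C_minimal ::
    "('f, 'r, 'a::field) fo_struct \<Rightarrow> ('a \<Rightarrow> 'g::linordered_ab_group_add) \<Rightarrow> bool" where
  "C_minimal M v \<longleftrightarrow>
     (\<forall>S. definable M 1 {[x] |x. x \<in> S} \<longrightarrow> S \<in> ball_combinations v)"

text \<open>That the field is algebraically closed is expressed by its type class.\<close>

definition C_minimal_ACVF_monster ::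
    "('f vf_fun, 'r vf_rel, 'a::alg_closed_field) fo_struct \<Rightarrow>
     ('a \<Rightarrow> 'g::linordered_ab_group_add) \<Rightarrow> bool" where
  "C_minimal_ACVF_monster M v \<longleftrightarrow>
     nontrivial_valuation v \<and> expands_valued_field M v \<and> C_minimal M v \<and> monster_model M \<and>
     fun_int M FT [] \<noteq> 0 \<and> 0 < v (fun_int M FT [])"

section \<open>The leading term group RV\<close>

definition mult_group :: "'a::field monoid" where
  "mult_group = \<lparr>carrier = - {0}, monoid.mult = (*), one = 1\<rparr>"

definition max_ideal :: "('a::field \<Rightarrow> 'g::linordered_ab_group_add) \<Rightarrow> 'a set" where
  "max_ideal v = {x. x = 0 \<or> 0 < v x}"

definition one_units :: "('a::field \<Rightarrow> 'g::linordered_ab_group_add) \<Rightarrow> 'a set" where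
  "one_units v = (\<lambda>x. 1 + x) ` max_ideal v"

definition RV :: "('a::field \<Rightarrow> 'g::linordered_ab_group_add) \<Rightarrow> 'a set monoid" where
  "RV v = mult_group Mod one_units v"

abbreviation RV2 :: "('a::field \<Rightarrow> 'g::linordered_ab_group_add) \<Rightarrow> ('a set \<times> 'a set) monoid" where
  "RV2 v \<equiv> RV v \<times>\<times> RV v"

definition rv :: "('a::field \<Rightarrow> 'g::linordered_ab_group_add) \<Rightarrow> 'a \<Rightarrow> 'a set" where
  "rv v x = one_units v #>\<^bsub>mult_group\<^esub> x"

text \<open>\<open>v\<close> is constant on the cosets of \<^term>\<open>one_units v\<close>; the fiber over 0 is the kernel
  of \<open>RV \<rightarrow> \<Gamma>\<close>, that is, the multiplicative group \<open>k\<^sup>\<times>\<close> of the residue field.\<close>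

definition RV_fiber :: "('a::field \<Rightarrow> 'g::linordered_ab_group_add) \<Rightarrow> 'g \<Rightarrow> 'a set set" where
  "RV_fiber v \<gamma> = {c \<in> carrier (RV v). v ` c = {\<gamma>}}"

text \<open>Definable sets of pairs in an imaginary sort, given as the image of \<open>M\<^sup>\<times>\<close> under a map
  \<open>\<pi>\<close>; it is used for \<open>\<pi> = rv v\<close> (subsets of \<open>RV\<^sup>2\<close>) and for \<open>\<pi> = v\<close> (subsets of \<open>\<Gamma>\<^sup>2\<close>).\<close>

definition definable_pairs ::
    "('f, 'r, 'a::field) fo_struct \<Rightarrow> ('a \<Rightarrow> 'b) \<Rightarrow> ('b \<times> 'b) set \<Rightarrow> bool" where
  "definable_pairs M \<pi> S \<longleftrightarrow> S \<subseteq> \<pi> ` (- {0}) \<times> \<pi> ` (- {0}) \<and>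
     definable M 2 {[x, y] |x y. x \<noteq> 0 \<and> y \<noteq> 0 \<and> (\<pi> x, \<pi> y) \<in> S}"

text \<open>\<open>morley_rank_ge Def n S\<close>: the Morley rank of \<open>S\<close> is at least \<open>n\<close>, where \<open>Def\<close> is the
  family of definable sets. Evaluating this in the given model is legitimate because it is
  only used in \<open>\<aleph>\<^sub>0\<close>-saturated structures.\<close>

primrec morley_rank_ge :: "('b set \<Rightarrow> bool) \<Rightarrow> nat \<Rightarrow> 'b set \<Rightarrow> bool" where
  "morley_rank_ge Def 0 S \<longleftrightarrow> S \<noteq> {}"
| "morley_rank_ge Def (Suc n) S \<longleftrightarrow>
     (\<exists>Y :: nat \<Rightarrow> 'b set. (\<forall>i. Def (Y i) \<and> Y i \<subseteq> S \<and> morley_rank_ge Def n (Y i)) \<and>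
        (\<forall>i j. i \<noteq> j \<longrightarrow> Y i \<inter> Y j = {}))"

text \<open>The dimension of a definable \<open>X \<subseteq> RV\<^sub>a \<times> RV\<^sub>b\<close> is the Morley rank of its translate
  inside \<open>(k\<^sup>\<times>)\<^sup>2\<close>.\<close>

definition fragment ::
    "('f, 'r, 'a::field) fo_struct \<Rightarrow> ('a \<Rightarrow> 'g::linordered_ab_group_add) \<Rightarrow>
     ('a set \<times> 'a set) set \<Rightarrow> bool" where
  "fragment M v X \<longleftrightarrow> X \<noteq> {} \<and> definable_pairs M (rv v) X \<and>
     (\<exists>a b. X \<subseteq> RV_fiber v a \<times> RV_fiber v b \<and>
        (\<exists>g \<in> RV_fiber v a \<times> RV_fiber v b.
           \<not> morley_rank_ge (definable_pairs M (rv v)) 2 (inv\<^bsub>RV2 v\<^esub> g <#\<^bsub>RV2 v\<^esub> X)))"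

definition Stab ::
    "('a::field \<Rightarrow> 'g::linordered_ab_group_add) \<Rightarrow> ('a set \<times> 'a set) set \<Rightarrow> ('a set \<times> 'a set) set" where
  "Stab v X = {g \<in> carrier (RV2 v). g <#\<^bsub>RV2 v\<^esub> X = X}"

definition translate_locus ::
    "('a::field \<Rightarrow> 'g::linordered_ab_group_add) \<Rightarrow> ('a set \<times> 'a set) set \<Rightarrow>
     ('a set \<times> 'a set) set \<Rightarrow> ('g \<times> 'g) set" where
  "translate_locus v D X = {(a, b). \<exists>g \<in> carrier (RV2 v).
     D \<inter> (RV_fiber v a \<times> RV_fiber v b) = g <#\<^bsub>RV2 v\<^esub> X}"

section \<open>Line segments in \<open>\<Gamma>\<^sup>2\<close>\<close>

text \<open>Open intervals are non-empty, with endpoints in \<open>\<Gamma> \<union> {-\<infinity>, \<infinity>}\<close>.\<close>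

definition open_interval :: "'g::linorder set \<Rightarrow> bool" where
  "open_interval I \<longleftrightarrow> I \<noteq> {} \<and>
     (I = UNIV \<or> (\<exists>c. I = {c<..}) \<or> (\<exists>d. I = {..<d}) \<or> (\<exists>c d. I = {c<..<d}))"

definition linear_on_interval :: "'g::ab_group_add set \<Rightarrow> ('g \<Rightarrow> 'g) \<Rightarrow> bool" where
  "linear_on_interval I f \<longleftrightarrow> (\<forall>a \<epsilon>1 \<epsilon>2.
     a \<in> I \<and> a + \<epsilon>1 \<in> I \<and> a + \<epsilon>2 \<in> I \<and> a + \<epsilon>1 + \<epsilon>2 \<in> I \<longrightarrow>
     f a + f (a + \<epsilon>1 + \<epsilon>2) = f (a + \<epsilon>1) + f (a + \<epsilon>2))"

definition line_segment ::
    "('f, 'r, 'a::field) fo_struct \<Rightarrow> ('a \<Rightarrow> 'g::linordered_ab_group_add) \<Rightarrow> ('g \<times> 'g) set \<Rightarrow> bool" where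
  "line_segment M v A \<longleftrightarrow> (\<exists>I. open_interval I \<and>
     ((\<exists>a. A = {a} \<times> I) \<or>
      (\<exists>f. linear_on_interval I f \<and> A = (\<lambda>x. (x, f x)) ` I \<and> definable_pairs M v A)))"

definition same_slope :: "('g::ab_group_add \<times> 'g) set \<Rightarrow> ('g \<times> 'g) set \<Rightarrow> bool" where
  "same_slope A B \<longleftrightarrow> (\<exists>x y. infinite (A \<inter> (\<lambda>(p, q). (p + x, q + y)) ` B))"

end

theory Submission
  imports Defs
begin

text \<open>C-minimality yields two facts about definable sets: they are unions of components of the
  complement of a finite set in \<open>\<Gamma>\<close>, and a definable subset of \<open>RV\<close> contains all or nothing of
  \<open>RV\<^sub>\<gamma>\<close> for all but finitely many \<open>\<gamma>\<close>. So a definable subset of \<open>RV\<close> has non-empty finite fibres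
  over finitely many \<open>\<gamma>\<close> only. Hence a definable \<open>h : U \<rightarrow> \<Gamma>\<close> is locally constant off a finite set
  as soon as non-empty finite subsets of \<open>RV\<close> over its values can be chosen definably.

  The stabilizer of \<open>X\<close> is an infinite definable subgroup of \<open>(k\<^sup>\<times>)\<^sup>2\<close>. If it does not contain
  \<open>1 \<times> k\<^sup>\<times>\<close>, it projects onto the first factor and the fibres of \<open>X\<close> over that factor are finite.
  The principle above then bounds the fibres of \<open>D\<^sup>X\<close>, which becomes a finite union of points and of
  graphs of definable functions. Applied to quotients of translates of \<open>X\<close>, it shows that
  \<open>g(x + e) - f(x)\<close> is locally constant off a finite set for any two of these functions. With \<open>f = g\<close>
  this makes them piecewise linear, and for arbitrary \<open>f, g\<close> it says that the slopes agree. If the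
  stabilizer contains \<open>1 \<times> k\<^sup>\<times>\<close>, then \<open>X = F \<times> RV\<^sub>b\<close> with \<open>F\<close> finite, and with the coordinates
  exchanged the functions themselves are locally constant, so that all segments are vertical.\<close>

section \<open>Definable predicates on environments\<close>

text \<open>C-minimality speaks about one definable subset of the field at a time, whereas the claim
  concerns families. Uniformity comes from saturation in the two places that need it: a common bound
  for the sizes of the fibres of \<open>D\<^sup>X\<close>, and a finite set of non-linear points
  that serves all steps e at once. No definable choice is available for a representative of a value
  or for the pair that translates X to a given point of the locus. All choices are therefore kept at
  once, and the stabilizer makes this harmless: \<open>RV\<^sup>2\<close> is commutative, so an
  element that stabilizes X stabilizes every translate of X. It thus acts by the same factor over
  two different points of the locus, and this factor cancels in quotients. This is why the quotients
  of fibres form finitely many classes although they range over all representatives.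
  \<open>\<Gamma>\<close> carries no multiplication, so a slope cannot be named; slopes are compared
  through increments and their germs. Passing from local to global uses definable connectedness of
  convex sets in place of completeness of \<open>\<Gamma>\<close>.\<close>

primrec ren_term :: "(nat \<Rightarrow> nat) \<Rightarrow> 'f fo_term \<Rightarrow> 'f fo_term" where
  "ren_term \<rho> (Var i) = Var (\<rho> i)"
| "ren_term \<rho> (App f ts) = App f (map (ren_term \<rho>) ts)"

primrec ren_form :: "(nat \<Rightarrow> nat) \<Rightarrow> ('f, 'r) fo_form \<Rightarrow> ('f, 'r) fo_form" where
  "ren_form \<rho> (Eq s t) = Eq (ren_term \<rho> s) (ren_term \<rho> t)"
| "ren_form \<rho> (Rel r ts) = Rel r (map (ren_term \<rho>) ts)"
| "ren_form \<rho> (Neg \<phi>) = Neg (ren_form \<rho> \<phi>)"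
| "ren_form \<rho> (Conj \<phi> \<psi>) = Conj (ren_form \<rho> \<phi>) (ren_form \<rho> \<psi>)"
| "ren_form \<rho> (Exists i \<phi>) = Exists (\<rho> i) (ren_form \<rho> \<phi>)"

lemma wf_ren_term [simp]: "wf_term M (ren_term \<rho> t) = wf_term M t"
  by (induction t) (auto simp: list_all_iff)

lemma wf_ren_form [simp]: "wf_form M (ren_form \<rho> \<phi>) = wf_form M \<phi>"
  by (induction \<phi>) (auto simp: list_all_iff)

lemma eval_ren_term [simp]: "eval_term M e (ren_term \<rho> t) = eval_term M (\<lambda>i. e (\<rho> i)) t"
proof (induction t)
  case (App f ts)
  then have "map (eval_term M e) (map (ren_term \<rho>) ts) = map (eval_term M (\<lambda>i. e (\<rho> i))) ts"
    by simp
  then show ?case by (simp only: ren_term.simps eval_term.simps)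
qed simp

text \<open>Bound variables are renamed along with free ones. Injectivity prevents capture: an
  update at \<open>\<rho> i\<close> changes no other renamed variable.\<close>

lemma sat_ren_form:
  assumes "inj \<rho>"
  shows "sat M e (ren_form \<rho> \<phi>) = sat M (\<lambda>i. e (\<rho> i)) \<phi>"
proof (induction \<phi> arbitrary: e)
  case (Rel r ts)
  have "map (eval_term M e) (map (ren_term \<rho>) ts) = map (eval_term M (\<lambda>i. e (\<rho> i))) ts"
    by simp
  then show ?case by (simp only: ren_form.simps sat.simps)
next
  case (Exists i \<phi>)
  have "(\<lambda>j. (e(\<rho> i := x)) (\<rho> j)) = (\<lambda>i. e (\<rho> i))(i := x)" for x
    using assms by (auto simp: fun_eq_iff inj_eq)
  then show ?case using Exists by (simp only: ren_form.simps sat.simps)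
qed auto

text \<open>Variables with even index carry the environment, those with odd index the parameters.\<close>

definition interleave :: "(nat \<Rightarrow> 'a) \<Rightarrow> (nat \<Rightarrow> 'a) \<Rightarrow> nat \<Rightarrow> 'a" where
  "interleave E c i = (if even i then E (i div 2) else c (i div 2))"

text \<open>Definability with parameters, phrased for predicates on environments instead of sets of
  lists, so that formulas written in HOL are handled by closure rules. As with de Bruijn indices,
  \<open>E 0\<close> is the innermost bound variable.\<close>

definition pdef :: "('f, 'r, 'a) fo_struct \<Rightarrow> ((nat \<Rightarrow> 'a) \<Rightarrow> bool) \<Rightarrow> bool" where
  "pdef M P \<longleftrightarrow> (\<exists>\<phi> c. wf_form M \<phi> \<and> (\<forall>E. P E \<longleftrightarrow> sat M (interleave E c) \<phi>))"

lemma pdefI: "wf_form M \<phi> \<Longrightarrow> (\<And>E. P E \<longleftrightarrow> sat M (interleave E c) \<phi>) \<Longrightarrow> pdef M P"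
  by (auto simp: pdef_def)

lemma pdef_not:
  assumes "pdef M P" shows "pdef M (\<lambda>E. \<not> P E)"
proof -
  obtain \<phi> c where "wf_form M \<phi>" "\<And>E. P E \<longleftrightarrow> sat M (interleave E c) \<phi>"
    using assms by (auto simp: pdef_def)
  then show ?thesis by (intro pdefI[of _ "Neg \<phi>" _ c]) auto
qed

lemma pdef_conj:
  assumes "pdef M P" "pdef M Q" shows "pdef M (\<lambda>E. P E \<and> Q E)"
proof -
  obtain \<phi> c where 1: "wf_form M \<phi>" "\<And>E. P E \<longleftrightarrow> sat M (interleave E c) \<phi>"
    using assms by (auto simp: pdef_def)
  obtain \<psi> d where 2: "wf_form M \<psi>" "\<And>E. Q E \<longleftrightarrow> sat M (interleave E d) \<psi>"
    using assms by (auto simp: pdef_def)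
  \<comment> \<open>The two parameter sequences are merged into one: parameter k of c moves to
    variable 4k + 1 and parameter k of d to variable 4k + 3.\<close>
  define \<rho> where "\<rho> i = (if even i then i else 4 * (i div 2) + 1)" for i :: nat
  define \<sigma> where "\<sigma> i = (if even i then i else 4 * (i div 2) + 3)" for i :: nat
  have inj: "inj \<rho>" "inj \<sigma>"
    by (rule injI, simp add: \<rho>_def \<sigma>_def split: if_splits, presburger+)+
  have "(\<lambda>i. interleave E (interleave c d) (\<rho> i)) = interleave E c"
    "(\<lambda>i. interleave E (interleave c d) (\<sigma> i)) = interleave E d" for E
  proof -
    have "interleave E (interleave c d) (\<rho> i) = interleave E c i \<and>
        interleave E (interleave c d) (\<sigma> i) = interleave E d i" for i
    proof -
      consider k where "i = 2 * k" | k where "i = 2 * k + 1" by (metis evenE oddE)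
      moreover have "(4 * k + 3) div 2 = 2 * k + 1" "(4 * k + 1) div 2 = 2 * k" for k :: nat
        by presburger+
      ultimately show ?thesis by cases (simp_all add: interleave_def \<rho>_def \<sigma>_def)
    qed
    then show "(\<lambda>i. interleave E (interleave c d) (\<rho> i)) = interleave E c"
      "(\<lambda>i. interleave E (interleave c d) (\<sigma> i)) = interleave E d" by auto
  qed
  then show ?thesis using 1 2 inj
    by (intro pdefI[of _ "Conj (ren_form \<rho> \<phi>) (ren_form \<sigma> \<psi>)" _ "interleave c d"])
      (auto simp: sat_ren_form)
qed

lemma pdef_shift:
  assumes "pdef M P" "inj \<sigma>" shows "pdef M (\<lambda>E. P (\<lambda>i. E (\<sigma> i)))"
proof -
  obtain \<phi> c where 1: "wf_form M \<phi>" "\<And>E. P E \<longleftrightarrow> sat M (interleave E c) \<phi>"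
    using assms by (auto simp: pdef_def)
  define \<rho> where "\<rho> i = (if even i then 2 * \<sigma> (i div 2) else i)" for i :: nat
  have inj: "inj \<rho>"
    unfolding inj_def \<rho>_def using assms(2) by (auto simp: inj_eq elim!: evenE split: if_splits)
  have "(\<lambda>i. interleave E c (\<rho> i)) = interleave (\<lambda>i. E (\<sigma> i)) c" for E
    by (auto simp: fun_eq_iff interleave_def \<rho>_def)
  then show ?thesis using 1 inj
    by (intro pdefI[of _ "ren_form \<rho> \<phi>" _ c]) (auto simp: sat_ren_form)
qed

lemma pdef_ex:
  assumes "pdef M (\<lambda>E. Q (\<lambda>i. E (Suc i)) (E 0))" shows "pdef M (\<lambda>E. \<exists>x. Q E x)"
proof -
  obtain \<phi> c where 1: "wf_form M \<phi>"
    "\<And>E. Q (\<lambda>i. E (Suc i)) (E 0) \<longleftrightarrow> sat M (interleave E c) \<phi>"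
    using assms by (auto simp: pdef_def)
  \<comment> \<open>Moving all parameters up by one frees variable 1, which becomes the bound
    variable in place of environment entry 0; the other entries move down by one.\<close>
  define \<rho> where "\<rho> i = (if i = 0 then 1 else if even i then i - 2 else i + 2)" for i :: nat
  have inj: "inj \<rho>"
    unfolding inj_def \<rho>_def by (simp split: if_split) presburger
  define c' where "c' = (\<lambda>i. c (i - 1))"
  have *: "(\<lambda>i. ((interleave E c')(1 := x)) (\<rho> i)) = interleave (case_nat x E) c" for E x
  proof
    fix i :: nat
    consider "i = 0" | k where "i = 2 * Suc k" | k where "i = 2 * k + 1"
      by (metis evenE oddE not0_implies_Suc mult_0_right)
    then show "((interleave E c')(1 := x)) (\<rho> i) = interleave (case_nat x E) c i"
      by cases (auto simp: interleave_def \<rho>_def c'_def)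
  qed
  have "(\<exists>x. Q E x) \<longleftrightarrow> sat M (interleave E c') (Exists 1 (ren_form \<rho> \<phi>))" for E
  proof -
    have "Q E x \<longleftrightarrow> sat M ((interleave E c')(1 := x)) (ren_form \<rho> \<phi>)" for x
      using 1(2)[of "case_nat x E"] by (simp only: sat_ren_form[OF inj] * nat.case)
    then show ?thesis by simp
  qed
  then show ?thesis using 1 by (intro pdefI[of _ "Exists 1 (ren_form \<rho> \<phi>)"]) auto
qed

lemma pdef_const: "pdef M (\<lambda>E. b)"
proof -
  have *: "pdef M (\<lambda>E. E 0 = E 0)"
    by (rule pdefI[of _ "Eq (Var 0) (Var 0)"]) (auto simp: interleave_def)
  show ?thesis using * pdef_not[OF *] by (cases b) auto
qed

lemma pdef_disj:
  assumes "pdef M P" "pdef M Q" shows "pdef M (\<lambda>E. P E \<or> Q E)"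
  using pdef_not[OF pdef_conj[OF assms[THEN pdef_not]]] by simp

lemma pdef_imp:
  assumes "pdef M P" "pdef M Q" shows "pdef M (\<lambda>E. P E \<longrightarrow> Q E)"
  unfolding imp_conv_disj by (rule pdef_disj[OF pdef_not[OF assms(1)] assms(2)])

lemma pdef_iff:
  assumes "pdef M P" "pdef M Q" shows "pdef M (\<lambda>E. P E \<longleftrightarrow> Q E)"
  unfolding iff_conv_conj_imp by (intro pdef_conj pdef_imp assms)

lemma pdef_all:
  assumes "pdef M (\<lambda>E. Q (\<lambda>i. E (Suc i)) (E 0))" shows "pdef M (\<lambda>E. \<forall>x. Q E x)"
  using pdef_not[OF pdef_ex[OF pdef_not[OF assms]]] by simp

lemma pdef_eq_var: "pdef M (\<lambda>E. E i = E j)"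
  by (rule pdefI[of _ "Eq (Var (2 * i)) (Var (2 * j))"]) (auto simp: interleave_def)

lemma pdef_eq_param: "pdef M (\<lambda>E. E i = a)"
  by (rule pdefI[of _ "Eq (Var (2 * i)) (Var 1)" _ "\<lambda>_. a"]) (auto simp: interleave_def)

text \<open>Functions with definable graph take the place of terms of the language, so that division
  is covered too. Variable 0 holds the value of the function.\<close>

definition tdef :: "('f, 'r, 'a) fo_struct \<Rightarrow> ((nat \<Rightarrow> 'a) \<Rightarrow> 'a) \<Rightarrow> bool" where
  "tdef M t \<longleftrightarrow> pdef M (\<lambda>E. E 0 = t (\<lambda>i. E (Suc i)))"

lemma tdef_var: "tdef M (\<lambda>E. E n)"
  unfolding tdef_def by (rule pdef_eq_var)

lemma tdef_const: "tdef M (\<lambda>E. a)"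
  unfolding tdef_def by (rule pdef_eq_param)

lemma pdef_subst:
  assumes "tdef M t" "pdef M (\<lambda>E. Q (\<lambda>i. E (Suc i)) (E 0))"
  shows "pdef M (\<lambda>E. Q E (t E))"
proof -
  have "pdef M (\<lambda>E. \<exists>x. x = t E \<and> Q E x)"
    using assms unfolding tdef_def by (intro pdef_ex pdef_conj)
  then show ?thesis by simp
qed

lemma tdef_shift: "tdef M t \<Longrightarrow> tdef M (\<lambda>E. t (\<lambda>i. E (Suc i)))"
  unfolding tdef_def
  by (drule pdef_shift[where \<sigma> = "\<lambda>i. case i of 0 \<Rightarrow> 0 | Suc j \<Rightarrow> Suc (Suc j)"])
    (auto simp: inj_def split: nat.splits)

text \<open>The innermost variable is the last argument of the relation.\<close>

lemma pdef_rel2: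
  assumes "pdef M (\<lambda>E. R (E 1) (E 0))" "tdef M s" "tdef M t"
  shows "pdef M (\<lambda>E. R (s E) (t E))"
proof (rule pdef_subst[OF assms(2)])
  have "pdef M (\<lambda>E. R (E (Suc 0)) (E 0))" using assms(1) by simp
  then show "pdef M (\<lambda>E. R (E 0) (t (\<lambda>i. E (Suc i))))"
    by (intro pdef_subst[OF tdef_shift[OF assms(3)], where Q = "\<lambda>E y. R (E 0) y"])
qed

lemma pdef_swap:
  assumes "pdef M (\<lambda>E. R (E 0) (E 1))" shows "pdef M (\<lambda>E. R (E 1) (E 0))"
  using pdef_shift[OF assms, of "\<lambda>i. if i = 0 then 1 else if i = 1 then 0 else i"]
  by (auto simp: inj_def split: if_splits)

lemma pdef_eq: "tdef M s \<Longrightarrow> tdef M t \<Longrightarrow> pdef M (\<lambda>E. s E = t E)"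
  by (rule pdef_rel2[where R = "(=)", OF pdef_eq_var])

lemma tdef_fun1:
  assumes "pdef M (\<lambda>E. E 1 = g (E 0))" "tdef M s"
  shows "tdef M (\<lambda>E. g (s E))"
  unfolding tdef_def
  using pdef_rel2[of M "\<lambda>x y. x = g y", OF assms(1) tdef_var tdef_shift[OF assms(2)]] by simp

lemma tdef_fun2:
  assumes "pdef M (\<lambda>E. E 2 = g (E 1) (E 0))" "tdef M s" "tdef M t"
  shows "tdef M (\<lambda>E. g (s E) (t E))"
proof -
  have "pdef M (\<lambda>E. E 1 = g (E 0) (t (\<lambda>i. E (Suc (Suc i)))))"
    using pdef_subst[OF tdef_shift[OF tdef_shift[OF assms(3)]], of "\<lambda>E y. E 1 = g (E 0) y"] assms(1)
    by (simp add: numeral_2_eq_2)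
  then have "pdef M (\<lambda>E. E 0 = g (s (\<lambda>i. E (Suc i))) (t (\<lambda>i. E (Suc i))))"
    using pdef_subst[OF tdef_shift[OF assms(2)], of "\<lambda>E y. E 0 = g y (t (\<lambda>i. E (Suc i)))"]
    by simp
  then show ?thesis by (simp add: tdef_def)
qed

section \<open>Passage between \<open>definable\<close> and \<open>pdef\<close>, and saturation for
  countable families\<close>

lemma pdef_definable:
  assumes "definable M n S"
  shows "pdef M (\<lambda>E. map E [0..<n] \<in> S)"
proof -
  obtain \<phi> e where \<phi>: "wf_form M \<phi>"
    and S: "S = {xs. length xs = n \<and> sat M (\<lambda>i. if i < n then xs ! i else e i) \<phi>}"
    using assms by (auto simp: definable_def)
  define \<rho> where "\<rho> i = (if i < n then 2 * i else 2 * i + 1)" for i :: nat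
  have inj: "inj \<rho>" unfolding inj_def \<rho>_def by (simp split: if_split)
  have "(\<lambda>i. interleave E e (\<rho> i)) = (\<lambda>i. if i < n then map E [0..<n] ! i else e i)" for E
    by (auto simp: fun_eq_iff interleave_def \<rho>_def)
  then show ?thesis using \<phi> inj
    by (intro pdefI[of _ "ren_form \<rho> \<phi>" _ e]) (auto simp: sat_ren_form S)
qed

text \<open>Environment entries from n on are frozen at \<open>undefined\<close> and thereby join
  the parameters, all of which are stored from variable n on.\<close>

lemma definable_pdef:
  assumes "pdef M P"
  shows "definable M n {xs. length xs = n \<and> P (\<lambda>i. if i < n then xs ! i else undefined)}"
proof -
  obtain \<phi> c where 1: "wf_form M \<phi>" "\<And>E. P E \<longleftrightarrow> sat M (interleave E c) \<phi>"
    using assms by (auto simp: pdef_def)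
  define \<rho> where "\<rho> i = (if even i \<and> i div 2 < n then i div 2 else n + i)" for i :: nat
  define e where "e i = interleave (\<lambda>_. undefined) c (i - n)" for i
  have inj: "inj \<rho>" unfolding inj_def \<rho>_def by (auto elim!: evenE split: if_splits)
  have "(\<lambda>i. if \<rho> i < n then xs ! \<rho> i else e (\<rho> i)) =
      interleave (\<lambda>i. if i < n then xs ! i else undefined) c" for xs
    by (auto simp: fun_eq_iff interleave_def \<rho>_def e_def)
  then show ?thesis using 1 inj unfolding definable_def
    by (intro exI[of _ "ren_form \<rho> \<phi>"] exI[of _ e]) (auto simp: sat_ren_form)
qed

text \<open>Countably many formulas involve only countably many parameters, and
  \<open>\<kappa>\<close> exceeds the number of formulas, hence is uncountable.\<close>

lemma countable_saturation:
  fixes Q :: "nat \<Rightarrow> 'a \<Rightarrow> bool"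
  assumes mon: "monster_model M" and Q: "\<And>n. pdef M (\<lambda>E. Q n (E 0))"
    and fip: "\<And>n. \<exists>x. \<forall>m<n. Q m x"
  shows "\<exists>x. \<forall>n. Q n x"
proof -
  obtain \<kappa> :: "'a rel" where \<kappa>: "Card_order \<kappa>" "(card_of {\<phi>. wf_form M \<phi>}, \<kappa>) \<in> ordLess"
    "saturated M \<kappa>"
    using mon by (auto simp: monster_model_def)
  obtain \<phi> c where \<phi>: "\<And>n. wf_form M (\<phi> n)" "\<And>n E. Q n (E 0) \<longleftrightarrow> sat M (interleave E (c n)) (\<phi> n)"
    using Q unfolding pdef_def by metis
  define e where "e n = interleave (\<lambda>_. undefined) (c n)" for n
  have e: "sat M ((e n)(0 := x)) (\<phi> n) \<longleftrightarrow> Q n x" for n x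
  proof -
    have "(e n)(0 := x) = interleave ((\<lambda>_. undefined)(0 := x)) (c n)"
      by (auto simp: fun_eq_iff e_def interleave_def elim!: evenE)
    then show ?thesis using \<phi>(2)[of n "(\<lambda>_. undefined)(0 := x)"] by simp
  qed
  define A where "A = (\<Union>n. range (e n))"
  \<comment> \<open>These trivial equations show that there are infinitely many formulas, whatever
    the language.\<close>
  have "inj (\<lambda>i. Eq (Var i) (Var i))" by (simp add: inj_def)
  then have "infinite (range (\<lambda>i. Eq (Var i) (Var i) :: ('b, 'c) fo_form))"
    using range_inj_infinite by blast
  moreover have "range (\<lambda>i. Eq (Var i) (Var i)) \<subseteq> {\<phi>. wf_form M \<phi>}" by auto
  ultimately have "infinite {\<phi>. wf_form M \<phi>}" using infinite_super by blast
  then have leq: "ordLeq3 natLeq (card_of {\<phi>. wf_form M \<phi>})"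
    using infinite_iff_natLeq_ordLeq by blast
  have "ordLeq3 (card_of A) natLeq"
  proof -
    have "A = (\<lambda>(n, i). e n i) ` UNIV" by (auto simp: A_def image_iff)
    then have "ordLeq3 (card_of A) (card_of (UNIV :: (nat \<times> nat) set))"
      by (metis card_of_image)
    moreover have "ordIso2 (card_of (UNIV :: (nat \<times> nat) set)) (card_of (UNIV :: nat set))"
      using card_of_Times_same_infinite[of "UNIV :: nat set"] by simp
    ultimately show ?thesis by (rule ordLeq_ordIso_trans[OF _ ordIso_transitive[OF _ card_of_nat]])
  qed
  then have A: "(card_of A, \<kappa>) \<in> ordLess"
    by (rule ordLeq_ordLess_trans[OF ordLeq_transitive[OF _ leq] \<kappa>(2)])
  define p where "p = range (\<lambda>n. (\<phi> n, e n))"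
  have "\<forall>(\<psi>, d) \<in> p. wf_form M \<psi> \<and> (\<forall>i \<in> free_vars \<psi> - {0}. d i \<in> A)"
    using \<phi>(1) by (auto simp: p_def A_def)
  moreover have "\<exists>x. \<forall>(\<psi>, d) \<in> q. sat M (d(0 := x)) \<psi>" if q: "finite q" "q \<subseteq> p" for q
  proof -
    obtain N where N: "finite N" "q = (\<lambda>n. (\<phi> n, e n)) ` N"
      using finite_subset_image[OF q[unfolded p_def]] by auto
    obtain n where "\<forall>m\<in>N. m < n" using N(1) by (metis finite_nat_set_iff_bounded)
    then show ?thesis using fip[of n] N by (auto simp: e)
  qed
  ultimately have "\<exists>x. \<forall>(\<psi>, d) \<in> p. sat M (d(0 := x)) \<psi>"
    using spec[OF mp[OF spec[OF \<kappa>(3)[unfolded saturated_def], of A] A], of p] by simp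
  then show ?thesis by (auto simp: p_def e)
qed

section \<open>Definability in the valued field and in the value group\<close>

locale acvf =
  fixes M :: "('f vf_fun, 'r vf_rel, 'a::alg_closed_field) fo_struct"
    and v :: "'a \<Rightarrow> 'g::linordered_ab_group_add"
  assumes acvf: "C_minimal_ACVF_monster M v"
begin

lemma v_mult: "x \<noteq> 0 \<Longrightarrow> y \<noteq> 0 \<Longrightarrow> v (x * y) = v x + v y"
  and v_add: "x \<noteq> 0 \<Longrightarrow> y \<noteq> 0 \<Longrightarrow> x + y \<noteq> 0 \<Longrightarrow> min (v x) (v y) \<le> v (x + y)"
  and v_range: "v ` (- {0}) = UNIV"
  using acvf by (auto simp: C_minimal_ACVF_monster_def nontrivial_valuation_def valuation_def)

lemma v_surj: obtains x where "x \<noteq> 0" "v x = \<gamma>"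
proof -
  have "\<gamma> \<in> v ` (- {0})" using v_range by simp
  then show ?thesis using that by auto
qed

lemma v_one [simp]: "v 1 = 0"
  using v_mult[of 1 1] by simp

lemma v_minus [simp]: "v (- x) = v x"
proof (cases "x = 0")
  case False
  have "v (- 1) + v (- 1) = 0" using v_mult[of "- 1" "- 1"] by simp
  then have "v (- 1) = 0" by (simp add: double_zero)
  then show ?thesis using v_mult[of "- 1" x] False by simp
qed simp

lemma v_divide: "x \<noteq> 0 \<Longrightarrow> y \<noteq> 0 \<Longrightarrow> v (x / y) = v x - v y"
  using v_mult[of "x / y" y] by (simp add: algebra_simps)

lemma v_diff_commute: "v (x - y) = v (y - x)"
  using v_minus[of "x - y"] by simp

lemma v_add_eq:
  assumes "x \<noteq> 0" "y \<noteq> 0" "v x < v y" shows "x + y \<noteq> 0" "v (x + y) = v x"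
proof -
  show *: "x + y \<noteq> 0"
  proof
    assume "x + y = 0"
    then have "x = - y" by (simp add: eq_neg_iff_add_eq_0)
    then show False using assms(3) by simp
  qed
  have "v x \<le> v (x + y)" using v_add[OF assms(1,2) *] assms(3) by simp
  moreover have "min (v (x + y)) (v y) \<le> v x"
    using v_add[of "x + y" "- y"] assms * by simp
  ultimately show "v (x + y) = v x" using assms(3) by (auto simp: min_def split: if_splits)
qed

lemma fun_int_simps:
  "fun_arity M FAdd = 2" "fun_int M FAdd [x, y] = x + y"
  "fun_arity M FUminus = 1" "fun_int M FUminus [x] = - x"
  "fun_arity M FMult = 2" "fun_int M FMult [x, y] = x * y"
  "rel_arity M RVal = 2"
  "rel_int M RVal [x, y] \<longleftrightarrow> y = 0 \<or> (x \<noteq> 0 \<and> v x \<le> v y)"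
  using acvf by (auto simp: C_minimal_ACVF_monster_def expands_valued_field_def)

lemma tdef_add: "tdef M s \<Longrightarrow> tdef M t \<Longrightarrow> tdef M (\<lambda>E. s E + t E)"
proof (rule tdef_fun2[where g = "(+)"])
  show "pdef M (\<lambda>E. E 2 = E 1 + E 0)"
    by (rule pdefI[of _ "Eq (Var 4) (App FAdd [Var 2, Var 0])"])
      (auto simp: interleave_def fun_int_simps)
qed

lemma tdef_mult: "tdef M s \<Longrightarrow> tdef M t \<Longrightarrow> tdef M (\<lambda>E. s E * t E)"
proof (rule tdef_fun2[where g = "(*)"])
  show "pdef M (\<lambda>E. E 2 = E 1 * E 0)"
    by (rule pdefI[of _ "Eq (Var 4) (App FMult [Var 2, Var 0])"])
      (auto simp: interleave_def fun_int_simps)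
qed

lemma tdef_uminus: "tdef M s \<Longrightarrow> tdef M (\<lambda>E. - s E)"
proof (rule tdef_fun1[where g = uminus])
  show "pdef M (\<lambda>E. E 1 = - E 0)"
    by (rule pdefI[of _ "Eq (Var 2) (App FUminus [Var 0])"])
      (auto simp: interleave_def fun_int_simps)
qed

lemma tdef_diff: "tdef M s \<Longrightarrow> tdef M t \<Longrightarrow> tdef M (\<lambda>E. s E - t E)"
  using tdef_add[OF _ tdef_uminus] by simp

lemma tdef_divide: "tdef M s \<Longrightarrow> tdef M t \<Longrightarrow> tdef M (\<lambda>E. s E / t E)"
proof (rule tdef_fun2[where g = "(/)"])
  \<comment> \<open>The first disjunct records the HOL convention that division by 0 gives
    0.\<close>
  have "pdef M (\<lambda>E. (E 0 = 0 \<and> E 2 = 0) \<or> (E 0 \<noteq> 0 \<and> E 2 * E 0 = E 1))"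
    by (intro pdef_disj pdef_conj pdef_not pdef_eq tdef_mult tdef_var tdef_const)
  also have "(\<lambda>E. (E 0 = 0 \<and> E 2 = 0) \<or> (E 0 \<noteq> 0 \<and> E 2 * E 0 = E 1)) = (\<lambda>E::nat \<Rightarrow> 'a. E 2 = E 1 / E 0)"
  proof
    fix E :: "nat \<Rightarrow> 'a"
    show "((E 0 = 0 \<and> E 2 = 0) \<or> (E 0 \<noteq> 0 \<and> E 2 * E 0 = E 1)) = (E 2 = E 1 / E 0)"
      by (cases "E 0 = 0") (simp_all add: nonzero_eq_divide_eq)
  qed
  finally show "pdef M (\<lambda>E. E 2 = E 1 / E 0)" .
qed

text \<open>\<^term>\<open>v 0\<close> is unspecified but equals the value of some non-zero element, so \<open>v\<close> is definable
  as a total map.\<close>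

lemma pdef_v_le:
  assumes "tdef M s" "tdef M t" shows "pdef M (\<lambda>E. v (s E) \<le> v (t E))"
proof -
  obtain z where z: "z \<noteq> 0" "v z = v 0" using v_surj by blast
  define nz where "nz x = (if x = 0 then z else x)" for x
  have nz: "nz x \<noteq> 0" "v (nz x) = v x" for x using z by (auto simp: nz_def)
  have "pdef M (\<lambda>E. (E 0 = 0 \<and> E 1 = z) \<or> (E 0 \<noteq> 0 \<and> E 1 = E 0))"
    by (intro pdef_disj pdef_conj pdef_not pdef_eq tdef_var tdef_const)
  also have "(\<lambda>E. (E 0 = 0 \<and> E 1 = z) \<or> (E 0 \<noteq> 0 \<and> E 1 = E 0)) = (\<lambda>E. E 1 = nz (E 0))"
    by (auto simp: fun_eq_iff nz_def)
  finally have tnz: "tdef M t \<Longrightarrow> tdef M (\<lambda>E. nz (t E))" for t by (rule tdef_fun1)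
  have "pdef M (\<lambda>E. E 0 = 0 \<or> (E 1 \<noteq> 0 \<and> v (E 1) \<le> v (E 0)))"
    by (rule pdefI[of _ "Rel RVal [Var 2, Var 0]"]) (auto simp: interleave_def fun_int_simps)
  from pdef_rel2[of M "\<lambda>x y. y = 0 \<or> (x \<noteq> 0 \<and> v x \<le> v y)", OF this tnz tnz, OF assms]
  show ?thesis by (simp add: nz)
qed

text \<open>\<open>\<Gamma>\<close> is not a sort of the structure, so a value is represented by all
  field elements that have it.\<close>

definition gdef :: "((nat \<Rightarrow> 'a) \<Rightarrow> 'g) \<Rightarrow> bool" where
  "gdef \<tau> \<longleftrightarrow> pdef M (\<lambda>E. v (E 0) = \<tau> (\<lambda>i. E (Suc i)))"

lemma pdef_v_eq:
  assumes "tdef M s" "tdef M t" shows "pdef M (\<lambda>E. v (s E) = v (t E))"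
  unfolding order_eq_iff by (intro pdef_conj pdef_v_le assms)

lemma gdef_v: "tdef M t \<Longrightarrow> gdef (\<lambda>E. v (t E))"
  unfolding gdef_def by (intro pdef_v_eq tdef_var tdef_shift)

lemma gdef_const: "gdef (\<lambda>E. \<gamma>)"
proof -
  obtain c where "v c = \<gamma>" using v_surj by blast
  then show ?thesis using gdef_v[OF tdef_const, of c] by simp
qed

lemma pdef_ex_val:
  assumes "pdef M (\<lambda>E. Q (\<lambda>i. E (Suc i)) (v (E 0)))" shows "pdef M (\<lambda>E. \<exists>\<gamma>. Q E \<gamma>)"
proof -
  have "(\<exists>\<gamma>. Q E \<gamma>) \<longleftrightarrow> (\<exists>x. Q E (v x))" for E by (metis v_surj)
  then show ?thesis using pdef_ex[of M "\<lambda>E x. Q E (v x)"] assms by simp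
qed

lemma pdef_all_val:
  assumes "pdef M (\<lambda>E. Q (\<lambda>i. E (Suc i)) (v (E 0)))" shows "pdef M (\<lambda>E. \<forall>\<gamma>. Q E \<gamma>)"
  using pdef_not[OF pdef_ex_val[OF pdef_not[OF assms]]] by simp

lemma pdef_subst_val:
  assumes "gdef \<tau>" "pdef M (\<lambda>E. Q (\<lambda>i. E (Suc i)) (v (E 0)))"
  shows "pdef M (\<lambda>E. Q E (\<tau> E))"
proof -
  have "pdef M (\<lambda>E. \<exists>\<gamma>. \<gamma> = \<tau> E \<and> Q E \<gamma>)"
    using assms unfolding gdef_def by (intro pdef_ex_val pdef_conj)
  then show ?thesis by simp
qed

lemma gdef_shift: "gdef \<tau> \<Longrightarrow> gdef (\<lambda>E. \<tau> (\<lambda>i. E (Suc i)))"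
  unfolding gdef_def
  by (drule pdef_shift[where \<sigma> = "\<lambda>i. case i of 0 \<Rightarrow> 0 | Suc j \<Rightarrow> Suc (Suc j)"])
    (auto simp: inj_def split: nat.splits)

lemma pdef_val_rel1:
  assumes "pdef M (\<lambda>E. T (v (E 0)))" "gdef \<tau>" shows "pdef M (\<lambda>E. T (\<tau> E))"
  by (rule pdef_subst_val[OF assms(2), of "\<lambda>_. T"]) (rule assms(1))

lemma pdef_val_rel2:
  assumes "pdef M (\<lambda>E. R (v (E 1)) (v (E 0)))" "gdef \<sigma>" "gdef \<tau>"
  shows "pdef M (\<lambda>E. R (\<sigma> E) (\<tau> E))"
proof (rule pdef_subst_val[OF assms(2)])
  have "pdef M (\<lambda>E. R (v (E (Suc 0))) (v (E 0)))" using assms(1) by simp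
  then show "pdef M (\<lambda>E. R (v (E 0)) (\<tau> (\<lambda>i. E (Suc i))))"
    by (intro pdef_subst_val[OF gdef_shift[OF assms(3)], where Q = "\<lambda>E y. R (v (E 0)) y"])
qed

lemma pdef_mixed_rel:
  assumes "pdef M (\<lambda>E. R (v (E 1)) (E 0))" "gdef \<sigma>" "tdef M t"
  shows "pdef M (\<lambda>E. R (\<sigma> E) (t E))"
proof (rule pdef_subst_val[OF assms(2)])
  have "pdef M (\<lambda>E. R (v (E (Suc 0))) (E 0))" using assms(1) by simp
  then show "pdef M (\<lambda>E. R (v (E 0)) (t (\<lambda>i. E (Suc i))))"
    by (intro pdef_subst[OF tdef_shift[OF assms(3)], where Q = "\<lambda>E y. R (v (E 0)) y"])
qed

lemma pdef_val_le: "gdef \<sigma> \<Longrightarrow> gdef \<tau> \<Longrightarrow> pdef M (\<lambda>E. \<sigma> E \<le> \<tau> E)"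
  by (rule pdef_val_rel2[where R = "(\<le>)"]) (intro pdef_v_le tdef_var)

lemma pdef_val_eq: "gdef \<sigma> \<Longrightarrow> gdef \<tau> \<Longrightarrow> pdef M (\<lambda>E. \<sigma> E = \<tau> E)"
  by (rule pdef_val_rel2[where R = "(=)"]) (intro pdef_v_eq tdef_var)

lemma pdef_val_less: "gdef \<sigma> \<Longrightarrow> gdef \<tau> \<Longrightarrow> pdef M (\<lambda>E. \<sigma> E < \<tau> E)"
  unfolding less_le by (intro pdef_conj pdef_not pdef_val_le pdef_val_eq)

lemma gdef_fun1:
  assumes "pdef M (\<lambda>E. v (E 1) = f (v (E 0)))" "gdef \<sigma>" shows "gdef (\<lambda>E. f (\<sigma> E))"
  unfolding gdef_def
  using pdef_val_rel2[of "\<lambda>x y. x = f y", OF assms(1) gdef_v[OF tdef_var] gdef_shift[OF assms(2)]]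
  by simp

lemma gdef_minus: assumes "gdef \<sigma>" shows "gdef (\<lambda>E. - \<sigma> E)"
proof (rule gdef_fun1[where f = uminus, OF _ assms])
  have "pdef M (\<lambda>E. \<exists>x. x \<noteq> 0 \<and> v x = v (E 0) \<and> v (E 1) = v (1 / x))"
    by (intro pdef_ex pdef_conj pdef_not pdef_eq pdef_v_eq tdef_var tdef_const tdef_divide)
  moreover have "(\<exists>x. x \<noteq> 0 \<and> v x = \<alpha> \<and> \<beta> = v (1 / x)) \<longleftrightarrow> \<beta> = - \<alpha>" for \<alpha> \<beta>
  proof -
    obtain x where "x \<noteq> 0" "v x = \<alpha>" by (rule v_surj)
    then have "x \<noteq> 0 \<and> v x = \<alpha> \<and> v (1 / x) = - \<alpha>" by (simp add: v_divide)
    then show ?thesis by (auto simp: v_divide)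
  qed
  ultimately show "pdef M (\<lambda>E. v (E 1) = - v (E 0))" by simp
qed

lemma gdef_add:
  assumes "gdef \<sigma>" "gdef \<tau>" shows "gdef (\<lambda>E. \<sigma> E + \<tau> E)"
proof -
  have "pdef M (\<lambda>E. \<exists>x y. x \<noteq> 0 \<and> y \<noteq> 0 \<and> v x = \<sigma> (\<lambda>i. E (Suc i)) \<and> v y = \<tau> (\<lambda>i. E (Suc i)) \<and>
      v (E 0) = v (x * y))"
    by (intro pdef_ex pdef_conj pdef_not pdef_eq pdef_v_eq pdef_val_eq gdef_v gdef_shift assms
        tdef_var tdef_const tdef_mult)
  moreover have "(\<exists>x y. x \<noteq> 0 \<and> y \<noteq> 0 \<and> v x = \<alpha> \<and> v y = \<beta> \<and> \<gamma> = v (x * y)) \<longleftrightarrow> \<gamma> = \<alpha> + \<beta>"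
    for \<alpha> \<beta> \<gamma>
  proof -
    obtain x y where "x \<noteq> 0" "v x = \<alpha>" "y \<noteq> 0" "v y = \<beta>" using v_surj by metis
    then have "\<gamma> = \<alpha> + \<beta> \<Longrightarrow> x \<noteq> 0 \<and> y \<noteq> 0 \<and> v x = \<alpha> \<and> v y = \<beta> \<and> \<gamma> = v (x * y)"
      by (simp add: v_mult)
    then show ?thesis by (metis v_mult)
  qed
  ultimately show ?thesis by (simp add: gdef_def)
qed

lemma gdef_diff: "gdef \<sigma> \<Longrightarrow> gdef \<tau> \<Longrightarrow> gdef (\<lambda>E. \<sigma> E - \<tau> E)"
  using gdef_add[OF _ gdef_minus] by simp

lemmas def_intros = pdef_conj pdef_disj pdef_imp pdef_iff pdef_not pdef_const
  pdef_ex pdef_all pdef_ex_val pdef_all_val pdef_eq pdef_val_eq pdef_val_le pdef_val_less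
  tdef_var tdef_const tdef_add tdef_mult tdef_diff tdef_uminus tdef_divide
  gdef_v gdef_const gdef_add gdef_diff gdef_minus

section \<open>Definable subsets and functions of the value group\<close>

definition vdef1 :: "'g set \<Rightarrow> bool" where
  "vdef1 T \<longleftrightarrow> pdef M (\<lambda>E. v (E 0) \<in> T)"

definition vdef2 :: "('g \<times> 'g) set \<Rightarrow> bool" where
  "vdef2 W \<longleftrightarrow> pdef M (\<lambda>E. (v (E 1), v (E 0)) \<in> W)"

definition vfun :: "('g \<Rightarrow> 'g) \<Rightarrow> bool" where
  "vfun f \<longleftrightarrow> pdef M (\<lambda>E. v (E 1) = f (v (E 0)))"

lemma pdef_mem1: "vdef1 T \<Longrightarrow> gdef \<tau> \<Longrightarrow> pdef M (\<lambda>E. \<tau> E \<in> T)"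
  unfolding vdef1_def by (rule pdef_val_rel1[where T = "\<lambda>x. x \<in> T"])

lemma pdef_mem2: "vdef2 W \<Longrightarrow> gdef \<sigma> \<Longrightarrow> gdef \<tau> \<Longrightarrow> pdef M (\<lambda>E. (\<sigma> E, \<tau> E) \<in> W)"
  unfolding vdef2_def by (rule pdef_val_rel2[where R = "\<lambda>x y. (x, y) \<in> W"])

lemma gdef_app: "vfun f \<Longrightarrow> gdef \<tau> \<Longrightarrow> gdef (\<lambda>E. f (\<tau> E))"
  unfolding vfun_def by (rule gdef_fun1)

lemma vdef1I: "pdef M (\<lambda>E. P (v (E 0))) \<Longrightarrow> vdef1 {x. P x}"
  by (simp add: vdef1_def)

lemma definable_pairs_iff_vdef2: "definable_pairs M v W \<longleftrightarrow> vdef2 W"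
proof
  let ?S = "{[x, y] |x y. x \<noteq> 0 \<and> y \<noteq> 0 \<and> (v x, v y) \<in> W}"
  assume "definable_pairs M v W"
  then have "pdef M (\<lambda>E. map E [0..<2] \<in> ?S)"
    by (intro pdef_definable) (simp add: definable_pairs_def)
  then have "pdef M (\<lambda>E. E 0 \<noteq> 0 \<and> E 1 \<noteq> 0 \<and> (v (E 0), v (E 1)) \<in> W)"
    by (simp add: upt_conv_Cons numeral_2_eq_2)
  from pdef_rel2[of M "\<lambda>x y. x \<noteq> 0 \<and> y \<noteq> 0 \<and> (v x, v y) \<in> W", OF pdef_swap[OF this]]
  have R: "tdef M s \<Longrightarrow> tdef M t \<Longrightarrow> pdef M (\<lambda>E. s E \<noteq> 0 \<and> t E \<noteq> 0 \<and> (v (s E), v (t E)) \<in> W)" for s t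
    by simp
  \<comment> \<open>\<open>E 0\<close> and \<open>E 1\<close> may be 0, where the definable set of
    pairs says nothing; non-zero elements of the same values replace them.\<close>
  have "pdef M (\<lambda>E. \<exists>x y. v x = v (E 1) \<and> v y = v (E 0) \<and> x \<noteq> 0 \<and> y \<noteq> 0 \<and> (v x, v y) \<in> W)"
    by (intro R def_intros)
  moreover have "(\<exists>x y. v x = \<alpha> \<and> v y = \<beta> \<and> x \<noteq> 0 \<and> y \<noteq> 0 \<and> (v x, v y) \<in> W) \<longleftrightarrow> (\<alpha>, \<beta>) \<in> W" for \<alpha> \<beta>
    by (metis v_surj)
  ultimately show "vdef2 W" by (simp add: vdef2_def)
next
  assume W: "vdef2 W"
  have "pdef M (\<lambda>E. E 0 \<noteq> 0 \<and> E 1 \<noteq> 0 \<and> (v (E 0), v (E 1)) \<in> W)"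
    by (intro def_intros pdef_mem2[OF W])
  then have "definable M 2 {xs. length xs = 2 \<and> xs ! 0 \<noteq> 0 \<and> xs ! 1 \<noteq> 0 \<and> (v (xs ! 0), v (xs ! 1)) \<in> W}"
    using definable_pdef[of M "\<lambda>E. E 0 \<noteq> 0 \<and> E 1 \<noteq> 0 \<and> (v (E 0), v (E 1)) \<in> W" 2] by simp
  also have "{xs. length xs = 2 \<and> xs ! 0 \<noteq> 0 \<and> xs ! 1 \<noteq> 0 \<and> (v (xs ! 0), v (xs ! 1)) \<in> W} =
      {[x, y] |x y. x \<noteq> 0 \<and> y \<noteq> 0 \<and> (v x, v y) \<in> W}"
    by (auto simp: length_Suc_conv numeral_2_eq_2)
  finally show "definable_pairs M v W"
    by (simp add: definable_pairs_def v_range)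
qed

end

section \<open>Consequences of C-minimality\<close>

context acvf
begin

text \<open>For y = (1 + m) x the condition on m becomes \<open>v x < v (y - x)\<close>. Classes of
  RV are thus balls, which is how C-minimality reaches RV.\<close>

lemma rv_eq_open_ball:
  assumes "x \<noteq> 0" shows "rv v x = open_ball v x (v x)"
proof (intro equalityI subsetI)
  fix y assume "y \<in> rv v x"
  then obtain m where m: "m = 0 \<or> 0 < v m" "y = (1 + m) * x"
    by (auto simp: rv_def r_coset_def one_units_def max_ideal_def mult_group_def)
  then show "y \<in> open_ball v x (v x)"
    using assms by (cases "m = 0") (auto simp: open_ball_def algebra_simps v_mult)
next
  fix y assume "y \<in> open_ball v x (v x)"
  then have "y = x \<or> (y \<noteq> x \<and> v x < v (y - x))" by (auto simp: open_ball_def)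
  then have "(y - x) / x = 0 \<or> 0 < v ((y - x) / x)" using assms by (auto simp: v_divide)
  moreover have "y = (1 + (y - x) / x) * x" using assms by (simp add: field_simps)
  ultimately show "y \<in> rv v x"
    by (auto simp: rv_def r_coset_def one_units_def max_ideal_def mult_group_def)
qed

lemma rv_self: "x \<noteq> 0 \<Longrightarrow> x \<in> rv v x"
  by (simp add: rv_eq_open_ball open_ball_def)

lemma rv_mult_image: "rv v (c * x) = (*) c ` rv v x"
  by (auto simp: rv_def r_coset_def mult_group_def image_iff mult.left_commute)

lemma open_ball_valD:
  assumes "x \<noteq> 0" "y \<in> open_ball v x (v x)" shows "y \<noteq> 0" "v y = v x"
proof -
  have "y = x \<or> (y - x \<noteq> 0 \<and> v x < v (y - x))" using assms by (auto simp: open_ball_def)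
  then have "y \<noteq> 0 \<and> v y = v x"
    using v_add_eq[of x "y - x"] assms(1) by auto
  then show "y \<noteq> 0" "v y = v x" by auto
qed

text \<open>Every point of an ultrametric ball is a centre of it.\<close>

lemma rv_eqI:
  assumes "x \<noteq> 0" "y \<in> open_ball v x (v x)" shows "rv v y = rv v x"
proof -
  have sub: "open_ball v a (v a) \<subseteq> open_ball v b (v b)"
    if ab: "b \<noteq> 0" "a \<in> open_ball v b (v b)" for a b
  proof
    fix z assume z: "z \<in> open_ball v a (v a)"
    note va = open_ball_valD[OF ab]
    show "z \<in> open_ball v b (v b)"
    proof (cases "z = a \<or> a = b \<or> z = b")
      case False
      then have "v b < v (z - a)" "v b < v (a - b)" "z - a \<noteq> 0" "a - b \<noteq> 0" "z - b \<noteq> 0"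
        using z ab va by (auto simp: open_ball_def)
      moreover have "min (v (z - a)) (v (a - b)) \<le> v ((z - a) + (a - b))"
        using calculation by (intro v_add) auto
      ultimately show ?thesis by (auto simp: open_ball_def min_def split: if_splits)
    qed (use z ab va in \<open>auto simp: open_ball_def\<close>)
  qed
  note y = open_ball_valD[OF assms]
  have "x \<in> open_ball v y (v y)"
    using assms y v_diff_commute[of x y] by (auto simp: open_ball_def)
  then show ?thesis using sub[OF assms] sub[of y x] y assms by (auto simp: rv_eq_open_ball)
qed

lemma rv_eq_iff:
  assumes "x \<noteq> 0" "y \<noteq> 0" shows "rv v x = rv v y \<longleftrightarrow> x = y \<or> v x < v (x - y)"
proof
  assume "rv v x = rv v y"
  then have "y \<in> open_ball v x (v x)" using rv_self[OF assms(2)] rv_eq_open_ball[OF assms(1)] by simp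
  then show "x = y \<or> v x < v (x - y)" by (auto simp: open_ball_def v_diff_commute)
next
  assume "x = y \<or> v x < v (x - y)"
  then have "y \<in> open_ball v x (v x)" by (auto simp: open_ball_def v_diff_commute)
  then show "rv v x = rv v y" using rv_eqI[OF assms(1)] by simp
qed

lemma rv_eq_imp:
  assumes "x \<noteq> 0" "y \<noteq> 0" "rv v x = rv v y" shows "v x = v y"
  using open_ball_valD[OF assms(1), of y] assms rv_self[of y] by (simp add: rv_eq_open_ball)

lemma rv_mult_cong:
  assumes "rv v x = rv v x'" "rv v y = rv v y'" shows "rv v (x * y) = rv v (x' * y')"
  using assms by (metis rv_mult_image mult.commute)

lemma rv_divide_cong:
  assumes "x \<noteq> 0" "x' \<noteq> 0" "y \<noteq> 0" "y' \<noteq> 0" "rv v x = rv v x'" "rv v y = rv v y'"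
  shows "rv v (x / y) = rv v (x' / y')"
proof -
  have "rv v (x * (1 / (y * y')) * y') = rv v (x' * (1 / (y * y')) * y)"
    using assms by (intro rv_mult_cong) auto
  then show ?thesis using assms by simp
qed

lemma rv_mult_cancel: "c \<noteq> 0 \<Longrightarrow> rv v (c * x) = rv v (c * y) \<longleftrightarrow> rv v x = rv v y"
  by (simp add: rv_mult_image inj_image_eq_iff inj_def)

lemma pdef_rv_eq:
  "tdef M s \<Longrightarrow> tdef M t \<Longrightarrow> pdef M (\<lambda>E. s E \<noteq> 0 \<and> t E \<noteq> 0 \<and> rv v (s E) = rv v (t E))"
proof -
  assume *: "tdef M s" "tdef M t"
  have "pdef M (\<lambda>E. s E \<noteq> 0 \<and> t E \<noteq> 0 \<and> (s E = t E \<or> v (s E) < v (s E - t E)))"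
    by (intro def_intros *)
  moreover have "(x \<noteq> 0 \<and> y \<noteq> 0 \<and> (x = y \<or> v x < v (x - y))) =
      (x \<noteq> 0 \<and> y \<noteq> 0 \<and> rv v x = rv v y)" for x y
    using rv_eq_iff by auto
  ultimately show ?thesis by simp
qed

section \<open>Infinitude of the fibres of RV\<close>

lemma v_prod: "finite A \<Longrightarrow> (\<And>a. a \<in> A \<Longrightarrow> f a \<noteq> 0) \<Longrightarrow> v (\<Prod>a\<in>A. f a) = (\<Sum>a\<in>A. v (f a))"
  by (induction A rule: finite_induct) (auto simp: v_mult)

text \<open>If the classes in \<open>k\<^sup>\<times>\<close> were finite in number, with representatives \<open>A\<close>, the polynomial
  \<open>X \<Prod>(X - a) + 1\<close> would have no root.\<close>

lemma infinite_units: "infinite (rv v ` {x. x \<noteq> 0 \<and> v x = 0})"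
proof
  let ?U = "{x. x \<noteq> 0 \<and> v x = 0}"
  assume "finite (rv v ` ?U)"
  then obtain A where A: "A \<subseteq> ?U" "finite A" "rv v ` ?U = rv v ` A"
    by (meson finite_subset_image order_refl)
  define p where "p = [:0, 1:] * (\<Prod>a\<in>A. [:- a, 1:])"
  have "degree p = Suc (\<Sum>a\<in>A. 1)"
    unfolding p_def by (subst degree_mult_eq) (auto simp: degree_prod_eq_sum_degree A)
  then have "degree (p + 1) > 0" by (subst degree_add_eq_left) auto
  then obtain z where "poly (p + 1) z = 0" using alg_closed_imp_poly_has_root by blast
  then have z: "z * (\<Prod>a\<in>A. z - a) = - 1"
    by (simp add: p_def poly_prod eq_neg_iff_add_eq_0)
  then have nz: "z \<noteq> 0" "(\<Prod>a\<in>A. z - a) \<noteq> 0" by auto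
  then have nza: "z - a \<noteq> 0" if "a \<in> A" for a using that A(2) by auto
  have "v z + (\<Sum>a\<in>A. v (z - a)) = v (- 1)"
    using v_mult[OF nz] v_prod[OF A(2), of "\<lambda>a. z - a"] nza z by simp
  \<comment> \<open>The factors multiply to -1, so their values add up to 0. For negative or
    positive \<open>v z\<close> the sum has the sign of \<open>v z\<close>; for
    \<open>v z = 0\<close> the class of z occurs in A and makes one summand positive.\<close>
  then have sum: "v z + (\<Sum>a\<in>A. v (z - a)) = 0" by simp
  have vA: "a \<noteq> 0" "v a = 0" if "a \<in> A" for a using that A(1) by auto
  consider "v z < 0" | "v z = 0" | "0 < v z" by fastforce
  then show False
  proof cases
    case 1
    then have "v (z - a) = v z" if "a \<in> A" for a
      using v_add_eq(2)[of z "- a"] nz vA[OF that] by simp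
    then have "(\<Sum>a\<in>A. v (z - a)) \<le> 0" using 1 by (intro sum_nonpos) auto
    then show False using sum 1 by (metis add_neg_nonpos less_irrefl)
  next
    case 3
    then have "v (z - a) = 0" if "a \<in> A" for a
      using v_add_eq(2)[of "- a" z] nz vA[OF that] by (simp add: v_diff_commute)
    then show False using sum 3 by simp
  next
    case 2
    then have "rv v z \<in> rv v ` ?U" using nz by simp
    then obtain a where a: "a \<in> A" "rv v z = rv v a" unfolding A(3) by auto
    then have "0 < v (z - a)" using rv_eq_iff[of z a] nz nza vA 2 by auto
    moreover have "0 \<le> v (z - b)" if "b \<in> A" for b
      using v_add[of z "- b"] nz nza vA[OF that] that 2 by simp
    ultimately have "0 < (\<Sum>a\<in>A. v (z - a))" using A(2) a(1) by (intro sum_pos2[of A a]) auto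
    then show False using sum 2 by simp
  qed
qed

lemma infinite_fiber: "infinite (rv v ` {x. x \<noteq> 0 \<and> v x = \<gamma>})"
proof
  assume fin: "finite (rv v ` {x. x \<noteq> 0 \<and> v x = \<gamma>})"
  obtain c where c: "c \<noteq> 0" "v c = \<gamma>" by (rule v_surj)
  have "image ((*) c) ` rv v ` {x. x \<noteq> 0 \<and> v x = 0} \<subseteq> rv v ` {x. x \<noteq> 0 \<and> v x = \<gamma>}"
  proof (clarsimp simp: rv_mult_image[symmetric])
    fix x assume "x \<noteq> 0" "v x = 0"
    then show "rv v (c * x) \<in> rv v ` {x. x \<noteq> 0 \<and> v x = \<gamma>}"
      using c by (intro imageI) (simp add: v_mult)
  qed
  then have "finite (image ((*) c) ` rv v ` {x. x \<noteq> 0 \<and> v x = 0})"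
    using fin by (rule finite_subset)
  moreover have "inj_on (image ((*) c)) (rv v ` {x. x \<noteq> 0 \<and> v x = 0})"
    using c by (intro inj_onI) (simp add: inj_image_eq_iff inj_def)
  ultimately show False using finite_imageD infinite_units by blast
qed

text \<open>On \<open>K\<^sup>\<times>\<close>, a ball around a point of larger valuation than its radius is a ball around 0, and any
  other ball lies in a single class of \<open>RV\<close>.\<close>

lemma ball_cases:
  assumes "S = {c} \<or> S = open_ball v c \<gamma> \<or> S = closed_ball v c \<gamma>"
  obtains (small) d where "d \<noteq> 0" "\<And>x. x \<noteq> 0 \<Longrightarrow> x \<in> S \<Longrightarrow> rv v x = rv v d"
  | (greater) "\<And>x. x \<noteq> 0 \<Longrightarrow> x \<in> S \<longleftrightarrow> \<gamma> < v x"
  | (geq) "\<And>x. x \<noteq> 0 \<Longrightarrow> x \<in> S \<longleftrightarrow> \<gamma> \<le> v x"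
proof -
  have diff: "v (x - c) = v x" "x \<noteq> c" if "x \<noteq> 0" "c \<noteq> 0" "v x < v c" for x
    using v_add_eq(2)[of x "- c"] that by auto
  have min: "min (v x) (v c) \<le> v (x - c)" if "x \<noteq> 0" "c \<noteq> 0" "x \<noteq> c" for x
    using v_add[of x "- c"] that by simp
  have small': "rv v x = rv v c" if "x \<noteq> 0" "c \<noteq> 0" "x = c \<or> v c < v (x - c)" for x
    using rv_eq_iff[of c x] that by (auto simp: v_diff_commute)
  consider "c = 0" "S = {c}" | "c \<noteq> 0" "S = {c}" | "c = 0" "S = open_ball v c \<gamma>"
    | "c = 0" "S = closed_ball v c \<gamma>" | "c \<noteq> 0" "S = open_ball v c \<gamma>" "\<gamma> < v c"
    | "c \<noteq> 0" "S = open_ball v c \<gamma>" "v c \<le> \<gamma>" | "c \<noteq> 0" "S = closed_ball v c \<gamma>" "\<gamma> \<le> v c"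
    | "c \<noteq> 0" "S = closed_ball v c \<gamma>" "v c < \<gamma>"
    using assms by (meson not_le)
  then show ?thesis
  proof cases
    case 5
    have "x \<in> S \<longleftrightarrow> \<gamma> < v x" if "x \<noteq> 0" for x
      using 5 diff[OF that] min[OF that] that
      by (cases "v x < v c") (auto simp: open_ball_def min_def split: if_splits)
    then show ?thesis by (rule greater)
  next
    case 7
    have "x \<in> S \<longleftrightarrow> \<gamma> \<le> v x" if "x \<noteq> 0" for x
      using 7 diff[OF that] min[OF that] that
      by (cases "v x < v c") (auto simp: closed_ball_def min_def split: if_splits)
    then show ?thesis by (rule geq)
  next
    case 1
    then show ?thesis by (intro small[of 1]) auto
  next
    case 2
    then show ?thesis by (intro small[of c]) auto
  next
    case 3
    then show ?thesis by (intro greater) (auto simp: open_ball_def)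
  next
    case 4
    then show ?thesis by (intro geq) (auto simp: closed_ball_def)
  next
    case 6
    then have "rv v x = rv v c" if "x \<noteq> 0" "x \<in> S" for x
      using that by (intro small') (auto simp: open_ball_def)
    with 6(1) show ?thesis by (rule small)
  next
    case 8
    then have "rv v x = rv v c" if "x \<noteq> 0" "x \<in> S" for x
      using that by (intro small') (auto simp: closed_ball_def)
    with 8(1) show ?thesis by (rule small)
  qed
qed

text \<open>For finite \<open>F\<close>: \<open>x\<close> and \<open>y\<close> lie in the same component of the complement of \<open>F\<close>.\<close>

definition same_cell :: "'g set \<Rightarrow> 'g \<Rightarrow> 'g \<Rightarrow> bool" where
  "same_cell F x y \<longleftrightarrow> x \<notin> F \<and> y \<notin> F \<and> (\<forall>f\<in>F. f < x \<longleftrightarrow> f < y)"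

text \<open>By \<open>ball_cases\<close> a ball is cut out by a threshold in \<open>\<Gamma>\<close>
  or lies over a single value. This one value is its exceptional set, and exceptional sets add up
  under unions.\<close>

lemma ball_combination_cells:
  assumes "B \<in> ball_combinations v"
  shows "\<exists>F. finite F \<and> (\<forall>x y. x \<noteq> 0 \<and> y \<noteq> 0 \<and> same_cell F (v x) (v y) \<longrightarrow> (x \<in> B \<longleftrightarrow> y \<in> B))"
proof -
  have base: "\<exists>F. finite F \<and> (\<forall>x y. x \<noteq> 0 \<and> y \<noteq> 0 \<and> same_cell F (v x) (v y) \<longrightarrow> (x \<in> S \<longleftrightarrow> y \<in> S))"
    if S: "S = {c} \<or> S = open_ball v c \<gamma> \<or> S = closed_ball v c \<gamma>" for S c \<gamma>
    using S
  proof (cases rule: ball_cases)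
    case (small d)
    then have "v x = v d" if "x \<noteq> 0" "x \<in> S" for x using rv_eq_imp that by blast
    then show ?thesis by (intro exI[of _ "{v d}"]) (auto simp: same_cell_def)
  next
    case greater
    then show ?thesis by (intro exI[of _ "{\<gamma>}"]) (auto simp: same_cell_def)
  next
    case geq
    then show ?thesis by (intro exI[of _ "{\<gamma>}"]) (auto simp: same_cell_def le_less)
  qed
  show ?thesis
    using assms
  proof (induction B rule: ball_combinations.induct)
    case (point c)
    show ?case by (rule base[of _ c]) simp
  next
    case (open_ball c \<delta>)
    show ?case by (rule base) blast
  next
    case (closed_ball c \<delta>)
    show ?case by (rule base) blast
  next
    case (union A B)
    then obtain F G where "finite F" "finite G"
      "\<forall>x y. x \<noteq> 0 \<and> y \<noteq> 0 \<and> same_cell F (v x) (v y) \<longrightarrow> (x \<in> A \<longleftrightarrow> y \<in> A)"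
      "\<forall>x y. x \<noteq> 0 \<and> y \<noteq> 0 \<and> same_cell G (v x) (v y) \<longrightarrow> (x \<in> B \<longleftrightarrow> y \<in> B)"
      by blast
    moreover have "same_cell F x y \<and> same_cell G x y" if "same_cell (F \<union> G) x y" for x y
      using that by (auto simp: same_cell_def)
    ultimately show ?case by (intro exI[of _ "F \<union> G"]) blast
  next
    case (compl A)
    then show ?case by simp
  qed
qed

text \<open>Strong minimality of the fibre over \<open>\<gamma>\<close>: s tells whether B contains
  almost all of it or almost nothing. A class that B meets only in part belongs to F, so the claim
  can be made for elements instead of classes.\<close>

lemma ball_combination_fiber:
  assumes "B \<in> ball_combinations v"
  shows "\<exists>F s. finite F \<and> (\<forall>x. x \<noteq> 0 \<and> v x = \<gamma> \<and> rv v x \<notin> F \<longrightarrow> (x \<in> B \<longleftrightarrow> s))"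
proof -
  have base: "\<exists>F s. finite F \<and> (\<forall>x. x \<noteq> 0 \<and> v x = \<gamma> \<and> rv v x \<notin> F \<longrightarrow> (x \<in> S \<longleftrightarrow> s))"
    if S: "S = {c} \<or> S = open_ball v c \<delta> \<or> S = closed_ball v c \<delta>" for S c \<delta>
    using S
  proof (cases rule: ball_cases)
    case (small d)
    then show ?thesis by (intro exI[of _ "{rv v d}"] exI[of _ False]) auto
  next
    case greater
    then show ?thesis by (intro exI[of _ "{}"] exI[of _ "\<delta> < \<gamma>"]) auto
  next
    case geq
    then show ?thesis by (intro exI[of _ "{}"] exI[of _ "\<delta> \<le> \<gamma>"]) auto
  qed
  show ?thesis
    using assms
  proof (induction B rule: ball_combinations.induct)
    case (point c)
    show ?case by (rule base[of _ c]) simp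
  next
    case (open_ball c \<delta>)
    show ?case by (rule base) blast
  next
    case (closed_ball c \<delta>)
    show ?case by (rule base) blast
  next
    case (compl A)
    then obtain F s where "finite F" "\<forall>x. x \<noteq> 0 \<and> v x = \<gamma> \<and> rv v x \<notin> F \<longrightarrow> (x \<in> A \<longleftrightarrow> s)"
      by blast
    then show ?case by (intro exI[of _ F] exI[of _ "\<not> s"]) auto
  next
    case (union A B)
    then obtain F s G s' where "finite F" "\<forall>x. x \<noteq> 0 \<and> v x = \<gamma> \<and> rv v x \<notin> F \<longrightarrow> (x \<in> A \<longleftrightarrow> s)"
      "finite G" "\<forall>x. x \<noteq> 0 \<and> v x = \<gamma> \<and> rv v x \<notin> G \<longrightarrow> (x \<in> B \<longleftrightarrow> s')"
      by blast
    then show ?case by (intro exI[of _ "F \<union> G"] exI[of _ "s \<or> s'"]) auto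
  qed
qed

lemma pdef_ball_combination:
  assumes "pdef M (\<lambda>E. P (E 0))" shows "{x. P x} \<in> ball_combinations v"
proof -
  have "definable M 1 {xs. length xs = 1 \<and> P (xs ! 0)}"
    using definable_pdef[OF assms, of 1] by simp
  also have "{xs. length xs = 1 \<and> P (xs ! 0)} = {[x] |x. x \<in> {x. P x}}"
    by (auto simp: length_Suc_conv)
  finally show ?thesis
    using acvf unfolding C_minimal_ACVF_monster_def C_minimal_def by blast
qed

end

section \<open>O-minimality of the value group\<close>

context acvf
begin

lemma exists_pos: "\<exists>\<gamma>::'g. 0 < \<gamma>"
  using acvf by (auto simp: C_minimal_ACVF_monster_def)

lemma exists_half: "\<exists>\<delta>::'g. \<delta> + \<delta> = \<gamma>"
proof -
  obtain x where x: "x \<noteq> 0" "v x = \<gamma>" by (rule v_surj)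
  obtain y where y: "y ^ 2 = x" using nth_root_exists[of 2 x] by auto
  then have "y \<noteq> 0" using x by auto
  then show ?thesis using v_mult[of y y] x y by (auto simp: power2_eq_square)
qed

lemma val_dense:
  fixes \<alpha> \<beta> :: 'g
  assumes "\<alpha> < \<beta>" shows "\<exists>\<gamma>. \<alpha> < \<gamma> \<and> \<gamma> < \<beta>"
proof -
  obtain \<delta> where \<delta>: "\<delta> + \<delta> = \<beta> - \<alpha>" using exists_half by blast
  then have "0 < \<delta> + \<delta>" using assms by simp
  then have "0 < \<delta>" by (metis add_nonpos_nonpos not_le)
  moreover have "\<alpha> + \<delta> < \<beta>" using \<delta> \<open>0 < \<delta>\<close> by (metis add_less_cancel_left diff_add_cancel less_add_same_cancel1 add.commute add.assoc)
  ultimately show ?thesis by (intro exI[of _ "\<alpha> + \<delta>"]) simp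
qed

lemma exists_greater: "\<exists>\<gamma>::'g. \<alpha> < \<gamma>" and exists_less: "\<exists>\<gamma>::'g. \<gamma> < \<alpha>"
proof -
  obtain \<epsilon> :: 'g where "0 < \<epsilon>" using exists_pos by blast
  then have "\<alpha> < \<alpha> + \<epsilon>" "\<alpha> - \<epsilon> < \<alpha>" by auto
  then show "\<exists>\<gamma>. \<alpha> < \<gamma>" "\<exists>\<gamma>. \<gamma> < \<alpha>" by blast+
qed

lemma finite_pos_bound:
  assumes "finite (A :: 'g set)" "\<And>a. a \<in> A \<Longrightarrow> 0 < a"
  shows "\<exists>\<delta>>0. \<forall>a\<in>A. \<delta> < a"
proof (cases "A = {}")
  case False
  then have "0 < Min A" using assms by simp
  then obtain \<delta> where "0 < \<delta>" "\<delta> < Min A" using val_dense by blast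
  then show ?thesis using assms(1) by (intro exI[of _ \<delta>]) (auto dest: Min_le[OF assms(1)])
qed (use exists_pos in auto)

lemma infinite_greaterThanLessThan: "\<alpha> < \<beta> \<Longrightarrow> infinite {\<alpha><..<\<beta> :: 'g}"
proof
  assume *: "\<alpha> < \<beta>" "finite {\<alpha><..<\<beta>}"
  then have "{\<alpha><..<\<beta>} \<noteq> {}" using val_dense by fastforce
  then have "Max {\<alpha><..<\<beta>} \<in> {\<alpha><..<\<beta>}" using *(2) Max_in by blast
  moreover then obtain \<gamma> where "Max {\<alpha><..<\<beta>} < \<gamma>" "\<gamma> < \<beta>" using val_dense by fastforce
  moreover then have "\<gamma> \<in> {\<alpha><..<\<beta>}" using calculation by auto
  ultimately show False using Max_ge[OF *(2)] by fastforce
qed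

text \<open>O-minimality in the form delivered by \<open>ball_combination_cells\<close>, without
  naming endpoints; \<open>tame_decomposition\<close> recovers points and open intervals.\<close>

definition tame :: "'g set \<Rightarrow> bool" where
  "tame T \<longleftrightarrow> (\<exists>F. finite F \<and> (\<forall>x y. same_cell F x y \<longrightarrow> (x \<in> T \<longleftrightarrow> y \<in> T)))"

lemma vdef1_tame:
  assumes "vdef1 T" shows "tame T"
proof -
  have "{x. v x \<in> T} \<in> ball_combinations v"
    using assms unfolding vdef1_def by (rule pdef_ball_combination)
  from ball_combination_cells[OF this] obtain F where F: "finite F"
    "\<And>x y. x \<noteq> 0 \<Longrightarrow> y \<noteq> 0 \<Longrightarrow> same_cell F (v x) (v y) \<Longrightarrow> v x \<in> T \<longleftrightarrow> v y \<in> T"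
    by auto
  have "\<alpha> \<in> T \<longleftrightarrow> \<beta> \<in> T" if cell: "same_cell F \<alpha> \<beta>" for \<alpha> \<beta>
  proof -
    obtain x y where "x \<noteq> 0" "v x = \<alpha>" "y \<noteq> 0" "v y = \<beta>" using v_surj by metis
    then show ?thesis using F(2)[of x y] cell by simp
  qed
  then show ?thesis using F(1) by (auto simp: tame_def)
qed

lemma same_cell_between:
  assumes "same_cell F x y" "x \<le> z" "z \<le> y" shows "same_cell F x z"
proof -
  have F: "x \<notin> F" "y \<notin> F" "\<And>f. f \<in> F \<Longrightarrow> f < x \<longleftrightarrow> f < y"
    using assms(1) by (auto simp: same_cell_def)
  have "z \<notin> F" using F(2) F(3)[of z] assms(2,3) by (auto simp: order_le_less)
  moreover have "f < x \<longleftrightarrow> f < z" if "f \<in> F" for f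
    using F(3)[OF that] assms(2,3) by auto
  ultimately show ?thesis using F(1) by (simp add: same_cell_def)
qed

lemma finite_gap_right:
  assumes "finite (F :: 'g set)" obtains q where "x < q" "\<And>f. f \<in> F \<Longrightarrow> x < f \<Longrightarrow> q \<le> f"
proof (cases "{f \<in> F. x < f} = {}")
  case True
  then show ?thesis using exists_greater[of x] that by auto
next
  case False
  then show ?thesis
    using that[of "Min {f \<in> F. x < f}"] assms by simp
qed

lemma finite_gap_left:
  assumes "finite (F :: 'g set)" obtains p where "p < x" "\<And>f. f \<in> F \<Longrightarrow> f < x \<Longrightarrow> f \<le> p"
proof (cases "{f \<in> F. f < x} = {}")
  case True
  then show ?thesis using exists_less[of x] that by auto
next
  case False
  then show ?thesis
    using that[of "Max {f \<in> F. f < x}"] assms by simp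
qed

text \<open>Neighbourhoods are order intervals around a point, as \<^typ>\<open>'g\<close> carries neither a topology nor an
  absolute value.\<close>

definition locally_at :: "'g \<Rightarrow> ('g \<Rightarrow> bool) \<Rightarrow> bool" where
  "locally_at x P \<longleftrightarrow> (\<exists>p q. p < x \<and> x < q \<and> (\<forall>y. p < y \<and> y < q \<longrightarrow> P y))"

lemma locally_atI: "p < x \<Longrightarrow> x < q \<Longrightarrow> (\<And>y. p < y \<Longrightarrow> y < q \<Longrightarrow> P y) \<Longrightarrow> locally_at x P"
  by (auto simp: locally_at_def)

lemma locally_at_mono: "locally_at x P \<Longrightarrow> (\<And>y. P y \<Longrightarrow> Q y) \<Longrightarrow> locally_at x Q"
  unfolding locally_at_def by blast

lemma pdef_locally_at:
  assumes "gdef \<sigma>" "pdef M (\<lambda>E. P (\<lambda>i. E (Suc i)) (v (E 0)))"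
  shows "pdef M (\<lambda>E. locally_at (\<sigma> E) (P E))"
proof -
  have "pdef M (\<lambda>E. P (\<lambda>i. E (Suc (Suc (Suc i)))) (v (E 0)))"
    using pdef_shift[OF assms(2), of "\<lambda>i. case i of 0 \<Rightarrow> 0 | Suc j \<Rightarrow> Suc (Suc (Suc j))"]
    by (auto simp: inj_def split: nat.splits)
  then show ?thesis
    unfolding locally_at_def by (intro def_intros gdef_shift assms(1))
qed

lemma same_cell_nearby:
  assumes "finite F" "x \<notin> F"
  shows "locally_at x (same_cell F x)"
proof -
  obtain p q where p: "p < x" "\<And>f. f \<in> F \<Longrightarrow> f < x \<Longrightarrow> f \<le> p"
    and q: "x < q" "\<And>f. f \<in> F \<Longrightarrow> x < f \<Longrightarrow> q \<le> f"
    using finite_gap_left[OF assms(1)] finite_gap_right[OF assms(1)] by metis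
  have "same_cell F x y" if y: "p < y" "y < q" for y
  proof -
    have "f \<noteq> y \<and> (f < x \<longleftrightarrow> f < y)" if f: "f \<in> F" for f
    proof (cases "f < x")
      case True
      then show ?thesis using p(2)[OF f] y by auto
    next
      case False
      then have "x < f" using f assms(2) by (metis neqE)
      then show ?thesis using q(2)[OF f] y by auto
    qed
    then show ?thesis using assms(2) unfolding same_cell_def by blast
  qed
  then show ?thesis using p(1) q(1) by (intro locally_atI)
qed

text \<open>Off F, a cell is determined by the points of F below it, so there are finitely many
  cells. An infinite T has two points in one of them, and everything between these stays in that
  cell.\<close>

lemma tame_infinite_interval:
  assumes "tame T" "infinite T" shows "\<exists>c d. c < d \<and> {c<..<d} \<subseteq> T"
proof -
  obtain F where F: "finite F" "\<And>x y. same_cell F x y \<Longrightarrow> x \<in> T \<longleftrightarrow> y \<in> T"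
    using assms(1) by (auto simp: tame_def)
  have "infinite (T - F)" using assms(2) F(1) by simp
  moreover have "(\<lambda>x. {f \<in> F. f < x}) ` (T - F) \<subseteq> Pow F" by auto
  then have "finite ((\<lambda>x. {f \<in> F. f < x}) ` (T - F))" by (rule finite_subset) (simp add: F(1))
  ultimately have "\<not> inj_on (\<lambda>x. {f \<in> F. f < x}) (T - F)" by (metis finite_imageD)
  then obtain x y where xy: "x \<in> T - F" "y \<in> T - F" "x < y" "{f \<in> F. f < x} = {f \<in> F. f < y}"
    unfolding inj_on_def by (metis neqE)
  then have "same_cell F x y" by (auto simp: same_cell_def)
  then have "same_cell F x z" if "z \<in> {x<..<y}" for z
    using same_cell_between[of F x y z] that by auto
  then have "{x<..<y} \<subseteq> T" using F(2) xy by blast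
  then show ?thesis using xy by blast
qed

lemma tame_right_germ:
  assumes "tame T" shows "\<exists>q>a. {a<..<q} \<subseteq> T \<or> {a<..<q} \<inter> T = {}"
proof -
  obtain F where F: "finite F" "\<And>x y. same_cell F x y \<Longrightarrow> x \<in> T \<longleftrightarrow> y \<in> T"
    using assms(1) by (auto simp: tame_def)
  obtain q where q: "a < q" "\<And>f. f \<in> F \<Longrightarrow> a < f \<Longrightarrow> q \<le> f"
    using finite_gap_right[OF F(1)] by blast
  have "same_cell F x y" if "x \<in> {a<..<q}" "y \<in> {a<..<q}" for x y
    using q that unfolding same_cell_def by fastforce
  then have "x \<in> T \<longleftrightarrow> y \<in> T" if "x \<in> {a<..<q}" "y \<in> {a<..<q}" for x y
    using F(2) that by blast
  then have "{a<..<q} \<subseteq> T \<or> {a<..<q} \<inter> T = {}" by blast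
  then show ?thesis using q(1) by blast
qed

lemma tame_boundary_finite:
  assumes "tame T"
  shows "finite {x \<in> T. \<not> locally_at x (\<lambda>y. y \<in> T)}"
proof -
  obtain F where F: "finite F" "\<And>x y. same_cell F x y \<Longrightarrow> x \<in> T \<longleftrightarrow> y \<in> T"
    using assms(1) by (auto simp: tame_def)
  have "locally_at x (\<lambda>y. y \<in> T)" if "x \<in> T" "x \<notin> F" for x
    using same_cell_nearby[OF F(1) that(2)] by (rule locally_at_mono) (use F(2) that(1) in blast)
  then have "{x \<in> T. \<not> locally_at x (\<lambda>y. y \<in> T)} \<subseteq> F" by blast
  then show ?thesis using F(1) by (rule finite_subset)
qed

definition ord_convex :: "'g set \<Rightarrow> bool" where
  "ord_convex J \<longleftrightarrow> (\<forall>x\<in>J. \<forall>y\<in>J. \<forall>z. x \<le> z \<and> z \<le> y \<longrightarrow> z \<in> J)"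

text \<open>Definable connectedness of convex sets. \<open>\<Gamma>\<close> need not be complete,
  but a tame set changes only at points of its finite set F, so a maximum over finitely many
  candidates replaces the supremum.\<close>

lemma tame_clopen:
  assumes T: "tame T" and J: "ord_convex J"
    and loc: "\<And>x. x \<in> J \<Longrightarrow> locally_at x (\<lambda>y. y \<in> J \<longrightarrow> (y \<in> T \<longleftrightarrow> x \<in> T))"
    and xy: "x \<in> J" "y \<in> J"
  shows "x \<in> T \<longleftrightarrow> y \<in> T"
proof -
  have main: "y \<in> T" if T: "tame T" and x: "x \<in> J" "x \<in> T" and y: "y \<in> J" "x \<le> y"
    and loc: "\<And>x. x \<in> J \<Longrightarrow> locally_at x (\<lambda>y. y \<in> J \<longrightarrow> (y \<in> T \<longleftrightarrow> x \<in> T))"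
    for T x y
  proof (rule ccontr)
    assume yT: "y \<notin> T"
    obtain F where F: "finite F" "\<And>x y. same_cell F x y \<Longrightarrow> x \<in> T \<longleftrightarrow> y \<in> T"
      using T by (auto simp: tame_def)
    \<comment> \<open>c is the last candidate up to y that lies in T, and d is the next one. Local
      constancy at c and the absence of F in between put the whole gap (c, d) into T; local
      constancy at d then puts d into T.\<close>
    define A where "A = {c \<in> insert x F. x \<le> c \<and> c \<le> y \<and> c \<in> T}"
    have A: "finite A" "x \<in> A" using F(1) x y by (auto simp: A_def)
    define c where "c = Max A"
    have c: "c \<in> A" using A unfolding c_def by (intro Max_in) auto
    then have c': "x \<le> c" "c \<le> y" "c \<in> T" by (auto simp: A_def)
    then have "c < y" using yT by (metis order_le_less)
    define B where "B = {d \<in> insert y F. c < d \<and> d \<le> y}"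
    have B: "finite B" "y \<in> B" using F(1) \<open>c < y\<close> by (auto simp: B_def)
    define d where "d = Min B"
    have d: "d \<in> B" using B unfolding d_def by (intro Min_in) auto
    then have d': "c < d" "d \<le> y" by (auto simp: B_def)
    have J': "z \<in> J" if z:  "x \<le> z" "z \<le> y" for z
      using J x y z unfolding ord_convex_def by blast
    have cell: "same_cell F z w" if "z \<in> {c<..<d}" "w \<in> {c<..<d}" for z w
    proof -
      have "f \<le> c \<or> d \<le> f" if "f \<in> F" for f
      proof (rule ccontr)
        assume *: "\<not> (f \<le> c \<or> d \<le> f)"
        then have "f \<in> B" using that d' by (auto simp: B_def)
        then show False using Min_le[OF B(1)] * by (auto simp: d_def)
      qed
      then show ?thesis using that unfolding same_cell_def by fastforce
    qed
    have "c \<in> J" "d \<in> J" using c' d' by (intro J'; order)+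
    obtain p q where q: "p < c" "c < q" "\<And>z. p < z \<Longrightarrow> z < q \<Longrightarrow> z \<in> J \<longrightarrow> (z \<in> T \<longleftrightarrow> c \<in> T)"
      using loc[OF \<open>c \<in> J\<close>] unfolding locally_at_def by blast
    obtain z where z: "c < z" "z < min d q" using val_dense[of c "min d q"] d' q(2) by auto
    moreover have "z \<in> J" using z c' d' by (intro J') auto
    moreover have "p < z" using z(1) q(1) by order
    ultimately have "z \<in> T" using q(3)[of z] c' by auto
    then have cd: "w \<in> T" if "w \<in> {c<..<d}" for w using F(2)[OF cell[of z w]] that z by auto
    obtain p' q' where p': "p' < d" "d < q'" "\<And>z. p' < z \<Longrightarrow> z < q' \<Longrightarrow> z \<in> J \<longrightarrow> (z \<in> T \<longleftrightarrow> d \<in> T)"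
      using loc[OF \<open>d \<in> J\<close>] unfolding locally_at_def by blast
    obtain w where w: "max c p' < w" "w < d" using val_dense[of "max c p'" d] d' p'(1) by auto
    moreover have "w \<in> J" using w c' d' by (intro J') auto
    moreover have "w < q'" using w(2) p'(2) by order
    ultimately have "d \<in> T" using p'(3)[of w] cd[of w] by auto
    then have "d \<noteq> y" using yT by auto
    then have "d \<in> A" using d d' c' \<open>d \<in> T\<close> by (auto simp: A_def B_def)
    then show False using Max_ge[OF A(1) \<open>d \<in> A\<close>] d'(1) by (simp add: c_def)
  qed
  have T': "tame (- T)" using T by (auto simp: tame_def)
  have loc': "locally_at x (\<lambda>y. y \<in> J \<longrightarrow> (y \<in> - T \<longleftrightarrow> x \<in> - T))" if "x \<in> J" for x
    using loc[OF that] by auto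
  show ?thesis
    using main[OF T _ _ _ _ loc, of x y] main[OF T _ _ _ _ loc, of y x]
      main[OF T' _ _ _ _ loc', of x y] main[OF T' _ _ _ _ loc', of y x] xy linear[of x y] by blast
qed

lemma open_interval_convex: "open_interval I \<Longrightarrow> ord_convex (I :: 'g set)"
  by (auto simp: open_interval_def ord_convex_def)

lemma open_interval_nbhd:
  assumes "open_interval (I :: 'g set)" "x \<in> I"
  shows "locally_at x (\<lambda>y. y \<in> I)"
proof -
  obtain p q where pq: "p < x" "x < q" using exists_less exists_greater by blast
  consider "I = UNIV" | c where "I = {c<..}" | d where "I = {..<d}" | c d where "I = {c<..<d}"
    using assms(1) by (auto simp: open_interval_def)
  then show ?thesis
  proof cases
    case 1
    then show ?thesis using pq by (intro locally_atI) auto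
  next
    case 2
    then show ?thesis using assms(2) pq by (intro locally_atI[of c x q]) auto
  next
    case 3
    then show ?thesis using assms(2) pq by (intro locally_atI[of p x d]) auto
  next
    case 4
    then show ?thesis using assms(2) pq by (intro locally_atI[of c x d]) auto
  qed
qed

lemma open_interval_diff_point:
  assumes "open_interval (I :: 'g set)"
  shows "\<exists>\<J>. finite \<J> \<and> (\<forall>J\<in>\<J>. open_interval J) \<and> I - {a} = \<Union>\<J>"
proof (cases "a \<in> I")
  case True
  have *: "open_interval (I \<inter> {..<a}) \<or> I \<inter> {..<a} = {}" "open_interval (I \<inter> {a<..}) \<or> I \<inter> {a<..} = {}"
  proof -
    have "((\<exists>d. I \<inter> {..<a} = {..<d}) \<or> (\<exists>c d. I \<inter> {..<a} = {c<..<d})) \<and>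
      ((\<exists>c. I \<inter> {a<..} = {c<..}) \<or> (\<exists>c d. I \<inter> {a<..} = {c<..<d}))"
    proof -
      consider "I = UNIV" | c where "I = {c<..}" | d where "I = {..<d}" | c d where "I = {c<..<d}"
        using assms(1) by (auto simp: open_interval_def)
      then show ?thesis
      proof cases
        case 1
        then have "I \<inter> {..<a} = {..<a}" "I \<inter> {a<..} = {a<..}" by auto
        then show ?thesis by blast
      next
        case 2
        then have "I \<inter> {..<a} = {c<..<a}" "I \<inter> {a<..} = {max c a<..}" by auto
        then show ?thesis by blast
      next
        case 3
        then have "I \<inter> {..<a} = {..<min a d}" "I \<inter> {a<..} = {a<..<d}" by auto
        then show ?thesis by blast
      next
        case 4
        then have "I \<inter> {..<a} = {c<..<min a d}" "I \<inter> {a<..} = {max c a<..<d}" by auto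
        then show ?thesis by blast
      qed
    qed
    then show "open_interval (I \<inter> {..<a}) \<or> I \<inter> {..<a} = {}" "open_interval (I \<inter> {a<..}) \<or> I \<inter> {a<..} = {}"
      unfolding open_interval_def by blast+
  qed
  define L R where LR: "L = I \<inter> {..<a}" "R = I \<inter> {a<..}"
  have "I - {a} = L \<union> R" by (auto simp: LR)
  also have "\<dots> = \<Union>({L, R} - {{}})" by blast
  finally show ?thesis using *[folded LR] by (intro exI[of _ "{L, R} - {{}}"]) blast
next
  case False
  then show ?thesis using assms by (intro exI[of _ "{I}"]) auto
qed

lemma open_interval_diff_finite:
  assumes "finite F" "open_interval (I :: 'g set)"
  shows "\<exists>\<J>. finite \<J> \<and> (\<forall>J\<in>\<J>. open_interval J) \<and> I - F = \<Union>\<J>"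
  using assms
proof (induction F rule: finite_induct)
  case empty
  then show ?case by (intro exI[of _ "{I}"]) auto
next
  case (insert a F)
  then obtain \<J> where \<J>: "finite \<J>" "\<forall>J\<in>\<J>. open_interval J" "I - F = \<Union>\<J>" by blast
  have "\<forall>J\<in>\<J>. \<exists>\<K>. finite \<K> \<and> (\<forall>K\<in>\<K>. open_interval K) \<and> J - {a} = \<Union>\<K>"
    using open_interval_diff_point \<J>(2) by simp
  from bchoice[OF this] obtain \<K>
    where \<K>: "\<forall>J\<in>\<J>. finite (\<K> J) \<and> (\<forall>K\<in>\<K> J. open_interval K) \<and> J - {a} = \<Union>(\<K> J)"
    by (rule exE)
  have "I - insert a F = (\<Union>J\<in>\<J>. J - {a})" using \<J>(3) by blast
  also have "\<dots> = \<Union>(\<Union>J\<in>\<J>. \<K> J)" using \<K> by auto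
  finally show ?case using \<K> \<J>(1) by (intro exI[of _ "\<Union>J\<in>\<J>. \<K> J"]) auto
qed

lemma tame_decomposition:
  assumes "tame T"
  shows "\<exists>P \<J>. finite P \<and> finite \<J> \<and> (\<forall>J\<in>\<J>. open_interval J) \<and> T = P \<union> \<Union>\<J>"
proof -
  obtain F where F: "finite F" "\<And>x y. same_cell F x y \<Longrightarrow> x \<in> T \<longleftrightarrow> y \<in> T"
    using assms(1) by (auto simp: tame_def)
  have "open_interval (UNIV :: 'g set)" by (simp add: open_interval_def)
  from open_interval_diff_finite[OF F(1) this]
  obtain \<J> where \<J>: "finite \<J>" "\<forall>J\<in>\<J>. open_interval J" "UNIV - F = \<Union>\<J>" by blast
  have "J \<subseteq> T" if J: "J \<in> \<J>" "J \<inter> T \<noteq> {}" for J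
  proof -
    have cell: "same_cell F x y" if xy: "x \<in> J" "y \<in> J" "x \<le> y" for x y
    proof -
      have "f < x" if "f < y" "f \<in> F" for f
      proof (rule ccontr)
        assume "\<not> f < x"
        then have "x \<le> f" "f \<le> y" using \<open>f < y\<close> by auto
        then have "f \<in> J" using open_interval_convex[of J] \<J>(2) J(1) xy
          unfolding ord_convex_def by blast
        then show False using \<J>(3) J(1) \<open>f \<in> F\<close> by blast
      qed
      moreover have "x \<notin> F" "y \<notin> F" using xy \<J>(3) J(1) by auto
      moreover have "f < y" if "f < x" for f using that xy(3) by simp
      ultimately show ?thesis unfolding same_cell_def by blast
    qed
    then have "x \<in> T \<longleftrightarrow> y \<in> T" if "x \<in> J" "y \<in> J" for x y
      using F(2)[OF cell[of x y]] F(2)[OF cell[of y x]] that linear[of x y] by blast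
    then show ?thesis using J(2) by blast
  qed
  moreover have "x \<in> \<Union>\<J>" if "x \<in> T" "x \<notin> F" for x using that \<J>(3) by auto
  ultimately have eq: "T = (T \<inter> F) \<union> \<Union>{J \<in> \<J>. J \<subseteq> T}" by fast
  show ?thesis
  proof (intro exI conjI)
    show "T = (T \<inter> F) \<union> \<Union>{J \<in> \<J>. J \<subseteq> T}" by (fact eq)
  qed (use F(1) \<J>(1,2) in auto)
qed

end

section \<open>Local constancy and piecewise linearity\<close>

text \<open>The shape of the final decomposition, with Q left open so that pieces can be refined
  successively.\<close>

definition pieces :: "('c set \<Rightarrow> bool) \<Rightarrow> 'c set \<Rightarrow> bool" where
  "pieces Q W \<longleftrightarrow> (\<exists>P \<G>. finite P \<and> finite \<G> \<and> (\<forall>G\<in>\<G>. Q G) \<and> W = P \<union> \<Union>\<G>)"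

lemma pieces_finite: "finite W \<Longrightarrow> pieces Q W"
  unfolding pieces_def by (intro exI[of _ W] exI[of _ "{}"]) simp

lemma pieces_single: "Q W \<Longrightarrow> pieces Q W"
  unfolding pieces_def by (intro exI[of _ "{}"] exI[of _ "{W}"]) simp

lemma pieces_Un:
  assumes "pieces Q V" "pieces Q W" shows "pieces Q (V \<union> W)"
proof -
  obtain P \<G> P' \<G>' where "finite P" "finite \<G>" "\<forall>G\<in>\<G>. Q G" "V = P \<union> \<Union>\<G>"
    "finite P'" "finite \<G>'" "\<forall>G\<in>\<G>'. Q G" "W = P' \<union> \<Union>\<G>'"
    using assms unfolding pieces_def by blast
  then show ?thesis unfolding pieces_def
    by (intro exI[of _ "P \<union> P'"] exI[of _ "\<G> \<union> \<G>'"]) auto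
qed

lemma pieces_UN:
  assumes "finite A" "\<And>a. a \<in> A \<Longrightarrow> pieces Q (W a)" shows "pieces Q (\<Union>a\<in>A. W a)"
  using assms
proof (induction A rule: finite_induct)
  case (insert a A)
  then have "pieces Q (W a \<union> (\<Union>a\<in>A. W a))" by (intro pieces_Un) simp_all
  then show ?case by simp
qed (simp add: pieces_finite)

lemma pieces_refine:
  assumes "pieces Q W" "\<And>G. Q G \<Longrightarrow> G \<subseteq> W \<Longrightarrow> pieces R G" shows "pieces R W"
proof -
  obtain P \<G> where *: "finite P" "finite \<G>" "\<forall>G\<in>\<G>. Q G" "W = P \<union> \<Union>\<G>"
    using assms(1) unfolding pieces_def by blast
  then have "pieces R (\<Union>G\<in>\<G>. G)" using assms(2) by (intro pieces_UN) auto
  then show ?thesis using * by (auto intro: pieces_Un pieces_finite)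
qed

lemma pieces_mono: "pieces Q W \<Longrightarrow> (\<And>G. Q G \<Longrightarrow> G \<subseteq> W \<Longrightarrow> R G) \<Longrightarrow> pieces R W"
  by (erule pieces_refine) (simp add: pieces_single)

lemma pieces_image:
  assumes "pieces Q W" shows "pieces (\<lambda>H. \<exists>G. Q G \<and> G \<subseteq> W \<and> H = k ` G) (k ` W)"
proof -
  obtain P \<G> where *: "finite P" "finite \<G>" "\<forall>G\<in>\<G>. Q G" "W = P \<union> \<Union>\<G>"
    using assms(1) unfolding pieces_def by blast
  then have "k ` W = k ` P \<union> \<Union>((`) k ` \<G>)" by auto
  then show ?thesis using * unfolding pieces_def
    by (intro exI[of _ "k ` P"] exI[of _ "(`) k ` \<G>"]) blast
qed

context acvf
begin

lemma monster: "monster_model M"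
  using acvf by (simp add: C_minimal_ACVF_monster_def)

abbreviation graph :: "('g \<Rightarrow> 'g) \<Rightarrow> 'g set \<Rightarrow> ('g \<times> 'g) set" where
  "graph f I \<equiv> (\<lambda>x. (x, f x)) ` I"

lemma vdef1_open_interval: "open_interval I \<Longrightarrow> vdef1 I"
proof -
  assume "open_interval I"
  then consider "I = UNIV" | c where "I = {c<..}" | d where "I = {..<d}" | c d where "I = {c<..<d}"
    by (auto simp: open_interval_def)
  then show ?thesis
    unfolding vdef1_def by cases (simp_all, (intro def_intros)+)
qed

lemma vdef2_graph:
  assumes "vdef1 I" "vfun f" shows "vdef2 (graph f I)"
proof -
  have "pdef M (\<lambda>E. v (E 1) \<in> I \<and> v (E 0) = f (v (E 1)))"
    by (intro def_intros pdef_mem1[OF assms(1)] gdef_app[OF assms(2)])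
  moreover have "(x, y) \<in> graph f I \<longleftrightarrow> x \<in> I \<and> y = f x" for x y by auto
  ultimately show ?thesis by (simp add: vdef2_def)
qed

text \<open>Over an infinite definable set of values, a definable subset of \<open>RV\<close> cannot have non-empty
  finite fibres.\<close>

lemma finite_not_locally_constant:
  assumes U: "vdef1 U" and h: "vfun h" and Z: "pdef M (\<lambda>E. Z (v (E 1)) (E 0))"
    and Zne: "\<And>x. x \<in> U \<Longrightarrow> \<exists>w. Z x w"
    and Zv: "\<And>x w. x \<in> U \<Longrightarrow> Z x w \<Longrightarrow> w \<noteq> 0 \<and> v w = h x"
    and Zf: "\<And>x. x \<in> U \<Longrightarrow> finite (rv v ` {w. Z x w})"
  shows "finite {x \<in> U. \<not> locally_at x (\<lambda>y. y \<in> U \<and> h y = h x)}" (is "finite ?J")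
proof -
  \<comment> \<open>On a single level set of h, the points where h fails to be locally constant are
    boundary points, of which a tame set has finitely many.\<close>
  have fib: "finite {x \<in> ?J. h x = \<gamma>}" for \<gamma>
  proof -
    have "vdef1 {x. x \<in> U \<and> h x = \<gamma>}"
      by (rule vdef1I) (intro def_intros pdef_mem1[OF U] gdef_app[OF h])
    from tame_boundary_finite[OF vdef1_tame[OF this]]
    show ?thesis by (rule rev_finite_subset) auto
  qed
  \<comment> \<open>All witnesses over bad points are collected in one subset of the field, to which
    C-minimality applies.\<close>
  define B where "B = {w. \<exists>x. x \<in> U \<and> \<not> locally_at x (\<lambda>y. y \<in> U \<and> h y = h x) \<and> Z x w}"
  have "B \<in> ball_combinations v"
    unfolding B_def
    by (intro pdef_ball_combination def_intros pdef_mem1[OF U] pdef_locally_at gdef_app[OF h]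
        pdef_mixed_rel[of Z, OF Z])
  from ball_combination_cells[OF this] obtain F where F: "finite F"
    "\<And>x y. x \<noteq> 0 \<Longrightarrow> y \<noteq> 0 \<Longrightarrow> same_cell F (v x) (v y) \<Longrightarrow> x \<in> B \<longleftrightarrow> y \<in> B"
    by auto
  \<comment> \<open>Otherwise B contains every element of value \<open>h x\<close>. But finitely
    many bad points have this value under h, and each contributes finitely many classes.\<close>
  have "h x \<in> F" if x: "x \<in> ?J" for x
  proof (rule ccontr)
    assume hx: "h x \<notin> F"
    obtain w where w: "Z x w" using Zne x by blast
    then have wB: "w \<in> B" "w \<noteq> 0" "v w = h x" using x Zv unfolding B_def by auto
    let ?K = "{x' \<in> ?J. h x' = h x}"
    have sub: "rv v ` {z. z \<noteq> 0 \<and> v z = h x} \<subseteq> (\<Union>x'\<in>?K. rv v ` {w. Z x' w})"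
    proof (intro subsetI, elim imageE CollectE conjE)
      fix \<rho> z assume z: "\<rho> = rv v z" "z \<noteq> 0" "v z = h x"
      then have "same_cell F (v w) (v z)" using wB hx by (simp add: same_cell_def)
      then have "z \<in> B" using F(2) wB z by blast
      then obtain x' where x': "x' \<in> ?J" "Z x' z" unfolding B_def by auto
      then have "h x' = h x" using Zv z(3) by auto
      then show "\<rho> \<in> (\<Union>x'\<in>?K. rv v ` {w. Z x' w})" using x' z(1) by blast
    qed
    have "finite (\<Union>x'\<in>?K. rv v ` {w. Z x' w})" using fib Zf by (intro finite_UN_I) auto
    then show False using infinite_fiber[of "h x"] finite_subset[OF sub] by simp
  qed
  then have "?J = (\<Union>\<gamma>\<in>F. {x \<in> ?J. h x = \<gamma>})" by blast
  moreover have "finite (\<Union>\<gamma>\<in>F. {x \<in> ?J. h x = \<gamma>})" by (intro finite_UN_I F(1) fib)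
  ultimately show ?thesis by argo
qed

subsection \<open>Decomposition of relations with finite fibres\<close>

text \<open>The default 0 makes the function total, as \<open>vfun\<close> asks; over an empty fibre
  \<open>peel\<close> has nothing to remove.\<close>

definition min_fun :: "('g \<times> 'g) set \<Rightarrow> 'g \<Rightarrow> 'g" where
  "min_fun W a = (if W `` {a} = {} then 0 else Min (W `` {a}))"

definition peel :: "('g \<times> 'g) set \<Rightarrow> ('g \<times> 'g) set" where
  "peel W = W - graph (min_fun W) UNIV"

lemma vdef1_Domain: assumes "vdef2 W" shows "vdef1 (Domain W)"
proof -
  have "vdef1 {a. \<exists>b. (a, b) \<in> W}"
    by (rule vdef1I) (intro def_intros pdef_mem2[OF assms])
  then show ?thesis by (simp add: Domain_unfold)
qed

lemma vfun_min_fun: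
  assumes W: "vdef2 W" and fin: "\<And>a. finite (W `` {a})" shows "vfun (min_fun W)"
proof -
  have "pdef M (\<lambda>E. ((\<exists>z. (v (E 0), z) \<in> W) \<and> (v (E 0), v (E 1)) \<in> W \<and>
        (\<forall>z. (v (E 0), z) \<in> W \<longrightarrow> v (E 1) \<le> z)) \<or> (\<not> (\<exists>z. (v (E 0), z) \<in> W) \<and> v (E 1) = 0))"
    by (intro def_intros pdef_mem2[OF W])
  moreover have "((\<exists>z. (a, z) \<in> W) \<and> (a, b) \<in> W \<and> (\<forall>z. (a, z) \<in> W \<longrightarrow> b \<le> z)) \<or>
      (\<not> (\<exists>z. (a, z) \<in> W) \<and> b = 0) \<longleftrightarrow> b = min_fun W a" for a b
    using Min_eq_iff[OF fin[of a], of b] unfolding min_fun_def by auto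
  ultimately show ?thesis by (simp add: vfun_def)
qed

lemma min_fun_in: "finite (W `` {a}) \<Longrightarrow> a \<in> Domain W \<Longrightarrow> (a, min_fun W a) \<in> W"
  using Min_in[of "W `` {a}"] by (auto simp: min_fun_def)

lemma vdef2_peel:
  assumes W: "vdef2 W" and fin: "\<And>a. finite (W `` {a})" shows "vdef2 (peel W)"
proof -
  have "pdef M (\<lambda>E. (v (E 1), v (E 0)) \<in> W \<and> v (E 0) \<noteq> min_fun W (v (E 1)))"
    by (intro def_intros pdef_mem2[OF W] gdef_app[OF vfun_min_fun[OF assms]])
  moreover have "(a, b) \<in> peel W \<longleftrightarrow> (a, b) \<in> W \<and> b \<noteq> min_fun W a" for a b
    by (auto simp: peel_def)
  ultimately show ?thesis by (simp add: vdef2_def)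
qed

text \<open>Truncated subtraction covers the empty fibres.\<close>

lemma card_peel:
  assumes "finite (W `` {a})" shows "card (peel W `` {a}) = card (W `` {a}) - 1"
proof -
  have eq: "peel W `` {a} = W `` {a} - {min_fun W a}" by (auto simp: peel_def)
  show ?thesis
  proof (cases "a \<in> Domain W")
    case True
    then show ?thesis using min_fun_in[OF assms True] assms by (simp add: eq card_Diff_singleton)
  next
    case False
    then have "W `` {a} = {}" by auto
    then show ?thesis by (simp add: eq)
  qed
qed

text \<open>Each round of \<open>peel\<close> splits off the graph of one definable function and
  shortens all non-empty fibres by one. The process stops by saturation: if no round emptied the
  relation, some fibre would survive every round, although it is finite.\<close>

lemma graph_decomposition:
  assumes W: "vdef2 W" and fin: "\<And>a. finite (W `` {a})"
  shows "pieces (\<lambda>G. \<exists>I f. open_interval I \<and> vfun f \<and> G = graph f I) W"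
proof -
  define V where "V n = (peel ^^ n) W" for n
  have V_Suc: "V (Suc n) = peel (V n)" for n by (simp add: V_def)
  have V: "vdef2 (V n) \<and> (\<forall>a. finite (V n `` {a}) \<and> card (V n `` {a}) = card (W `` {a}) - n)" for n
  proof (induction n)
    case 0
    then show ?case using W fin by (simp add: V_def)
  next
    case (Suc n)
    have "V (Suc n) `` {a} \<subseteq> V n `` {a}" for a by (auto simp: V_Suc peel_def)
    then have "finite (V (Suc n) `` {a})" for a using Suc finite_subset by metis
    then show ?case using Suc vdef2_peel[of "V n"] card_peel[of "V n"] by (simp add: V_Suc)
  qed
  have dec: "V m \<subseteq> V n" if "n \<le> m" for n m
    using that by (rule lift_Suc_antimono_le[rotated]) (auto simp: V_Suc peel_def)
  have "\<exists>N. V N = {}"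
  proof (rule ccontr)
    assume "\<not> (\<exists>N. V N = {})"
    then have ne: "V n \<noteq> {}" for n by blast
    have "\<exists>x. \<forall>n. v x \<in> Domain (V n)"
    proof (rule countable_saturation[OF monster])
      fix n
      show "pdef M (\<lambda>E. v (E 0) \<in> Domain (V n))"
        using vdef1_Domain V by (auto simp: vdef1_def)
      obtain a b where ab: "(a, b) \<in> V n" using ne[of n] by auto
      obtain x where "v x = a" using v_surj by blast
      then show "\<exists>x. \<forall>m<n. v x \<in> Domain (V m)"
        using ab dec by (intro exI[of _ x]) (auto dest: less_imp_le)
    qed
    then obtain x where x: "\<And>n. v x \<in> Domain (V n)" by blast
    let ?n = "card (W `` {v x})"
    have "card (V ?n `` {v x}) = 0" using V by simp
    then have "V ?n `` {v x} = {}" using V by (metis card_0_eq)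
    then show False using x[of ?n] by auto
  qed
  then obtain N where N: "V N = {}" by blast
  have split: "V n = graph (min_fun (V n)) (Domain (V n)) \<union> V (Suc n)" for n
    using min_fun_in[of "V n"] V[of n] by (auto simp: V_Suc peel_def)
  let ?Q = "\<lambda>G. \<exists>I f. open_interval I \<and> vfun f \<and> G = graph f I"
  have piece: "pieces ?Q (graph f U)" if f: "vfun f" and U: "vdef1 U" for f U
  proof -
    obtain P \<J> where *: "finite P" "finite \<J>" "\<forall>J\<in>\<J>. open_interval J" "U = P \<union> \<Union>\<J>"
      using tame_decomposition[OF vdef1_tame[OF U]] by blast
    have eq: "graph f U = graph f P \<union> \<Union>(graph f ` \<J>)" unfolding *(4) by auto
    show ?thesis unfolding pieces_def
    proof (intro exI conjI)
      show "graph f U = graph f P \<union> \<Union>(graph f ` \<J>)" by (fact eq)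
    qed (use * f in auto)
  qed
  have "pieces ?Q (V (N - k))" for k
  proof (induction k)
    case 0
    then show ?case by (simp add: N pieces_finite)
  next
    case (Suc k)
    show ?case
    proof (cases "N - k = 0")
      case False
      then have Suc': "N - k = Suc (N - Suc k)" by simp
      have "pieces ?Q (graph (min_fun (V (N - Suc k))) (Domain (V (N - Suc k))))"
        using V by (intro piece vfun_min_fun vdef1_Domain) auto
      from pieces_Un[OF this Suc] show ?thesis using split[of "N - Suc k"] Suc' by simp
    qed (use Suc in simp)
  qed
  from this[of N] show ?thesis by (simp add: V_def)
qed

lemma graph_refine:
  assumes "open_interval I" "finite {x \<in> I. \<not> good x}"
  shows "pieces (\<lambda>G. \<exists>J. open_interval J \<and> (\<forall>x\<in>J. good x) \<and> G = graph f J) (graph f I)"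
proof -
  let ?E = "{x \<in> I. \<not> good x}"
  obtain \<J> where \<J>: "finite \<J>" "\<forall>J\<in>\<J>. open_interval J" "I - ?E = \<Union>\<J>"
    using open_interval_diff_finite[OF assms(2,1)] by blast
  have good: "good x" if "x \<in> J" "J \<in> \<J>" for x J
  proof -
    have "x \<in> I - ?E" using that \<J>(3) by blast
    then show ?thesis by simp
  qed
  have "graph f I = graph f ?E \<union> graph f (I - ?E)" by auto
  also have "\<dots> = graph f ?E \<union> \<Union>(graph f ` \<J>)" by (simp only: \<J>(3)) auto
  finally have eq: "graph f I = graph f ?E \<union> \<Union>(graph f ` \<J>)" .
  show ?thesis unfolding pieces_def
  proof (intro exI conjI)
    show "graph f I = graph f ?E \<union> \<Union>(graph f ` \<J>)" by (fact eq)
    show "\<forall>G\<in>graph f ` \<J>. \<exists>J. open_interval J \<and> (\<forall>x\<in>J. good x) \<and> G = graph f J"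
      using \<J>(2) good by blast
  qed (use \<J>(1) assms(2) in auto)
qed

subsection \<open>Linearity\<close>

text \<open>The increment over a step depends on the step alone. With \<open>0 \<le> e\<close>, four
  inequalities keep all four points in (p, q).\<close>

definition linear_at :: "('g \<Rightarrow> 'g) \<Rightarrow> 'g \<Rightarrow> bool" where
  "linear_at f x \<longleftrightarrow> (\<exists>p q. p < x \<and> x < q \<and>
     (\<forall>y z e. 0 \<le> e \<and> p < y \<and> p < z \<and> y + e < q \<and> z + e < q \<longrightarrow>
        f (y + e) - f y = f (z + e) - f z))"

text \<open>A substitute for equality of right derivatives: the increments at x and at y agree for
  all small positive steps.\<close>

definition same_germ :: "('g \<Rightarrow> 'g) \<Rightarrow> 'g \<Rightarrow> 'g \<Rightarrow> bool" where
  "same_germ f x y \<longleftrightarrow> (\<exists>\<delta>>0. \<forall>e. 0 < e \<and> e < \<delta> \<longrightarrow> f (x + e) - f x = f (y + e) - f y)"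

lemma same_germ_sym: "same_germ f x y \<Longrightarrow> same_germ f y x"
  unfolding same_germ_def by metis

lemma same_germ_trans:
  assumes "same_germ f x y" "same_germ f y z" shows "same_germ f x z"
proof -
  obtain \<delta> \<epsilon> where *: "0 < \<delta>" "0 < \<epsilon>"
    "\<And>e. 0 < e \<Longrightarrow> e < \<delta> \<Longrightarrow> f (x + e) - f x = f (y + e) - f y"
    "\<And>e. 0 < e \<Longrightarrow> e < \<epsilon> \<Longrightarrow> f (y + e) - f y = f (z + e) - f z"
    using assms unfolding same_germ_def by blast
  have "f (x + e) - f x = f (z + e) - f z" if "0 < e" "e < min \<delta> \<epsilon>" for e
    using *(3)[of e] *(4)[of e] that by simp
  moreover have "0 < min \<delta> \<epsilon>" using *(1,2) by simp
  ultimately show ?thesis unfolding same_germ_def by blast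
qed

lemma linear_at_same_germ:
  assumes "linear_at f x" shows "locally_at x (same_germ f x)"
proof -
  obtain p q where pq: "p < x" "x < q"
    "\<And>y z e. 0 \<le> e \<Longrightarrow> p < y \<Longrightarrow> p < z \<Longrightarrow> y + e < q \<Longrightarrow> z + e < q \<Longrightarrow>
      f (y + e) - f y = f (z + e) - f z"
    using assms unfolding linear_at_def by blast
  have "same_germ f x y" if y: "p < y" "y < q" for y
  proof -
    have "f (x + e) - f x = f (y + e) - f y" if "0 < e" "e < min (q - x) (q - y)" for e
      using pq(1) y(1) that by (intro pq(3)) (auto simp: less_diff_eq add.commute)
    moreover have "0 < min (q - x) (q - y)" using pq(2) y(2) by simp
    ultimately show ?thesis unfolding same_germ_def by blast
  qed
  then show ?thesis using pq(1,2) by (intro locally_atI)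
qed

text \<open>The points sharing the germ of x form a definable set that is relatively open and closed
  in J, so \<open>tame_clopen\<close> applies.\<close>

lemma locally_linear_imp_same_germ:
  assumes f: "vfun f" and J: "ord_convex J" "\<And>x. x \<in> J \<Longrightarrow> linear_at f x" and xy: "x \<in> J" "y \<in> J"
  shows "same_germ f x y"
proof -
  let ?T = "{z. same_germ f x z}"
  have "vdef1 ?T"
    unfolding same_germ_def
    by (rule vdef1I) (intro def_intros gdef_app[OF f])
  moreover have "locally_at z (\<lambda>w. w \<in> J \<longrightarrow> (w \<in> ?T \<longleftrightarrow> z \<in> ?T))" if "z \<in> J" for z
    using linear_at_same_germ[OF J(2)[OF that]]
    by (rule locally_at_mono) (auto intro: same_germ_trans same_germ_sym)
  ultimately have "x \<in> ?T \<longleftrightarrow> y \<in> ?T"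
    by (intro tame_clopen[OF vdef1_tame J(1) _ xy])
  moreover have "x \<in> ?T" unfolding same_germ_def using exists_pos by auto
  ultimately show ?thesis by simp
qed

text \<open>A step s may exceed every neighbourhood of linearity. Still, the germs at u and u + s
  agree, so a small move of u changes \<open>f (u + s)\<close> and \<open>f u\<close> equally. Hence
  the increment over s is locally constant in u, and constant by \<open>tame_clopen\<close>.\<close>

lemma locally_linear_imp_linear:
  assumes f: "vfun f" and J: "open_interval J" "\<And>x. x \<in> J \<Longrightarrow> linear_at f x"
  shows "linear_on_interval J f"
proof -
  note conv = open_interval_convex[OF J(1)]
  have const: "f (x + s) - f x = f (y + s) - f y"
    if mem: "x \<in> J" "x + s \<in> J" "y \<in> J" "y + s \<in> J" for x y s
  proof -
    let ?J = "{u. u \<in> J \<and> u + s \<in> J}"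
    let ?T = "{u. f (u + s) - f u = f (x + s) - f x}"
    have "vdef1 ?T" by (rule vdef1I) (intro def_intros gdef_app[OF f])
    moreover have "ord_convex ?J"
      using conv unfolding ord_convex_def by (auto; meson add_right_mono)
    moreover have "locally_at u (\<lambda>w. w \<in> ?J \<longrightarrow> (w \<in> ?T \<longleftrightarrow> u \<in> ?T))" if u: "u \<in> ?J" for u
    proof -
      obtain p q where pq: "p < u" "u < q"
        "\<And>y z e. 0 \<le> e \<Longrightarrow> p < y \<Longrightarrow> p < z \<Longrightarrow> y + e < q \<Longrightarrow> z + e < q \<Longrightarrow>
          f (y + e) - f y = f (z + e) - f z"
        using J(2)[of u] u unfolding linear_at_def by blast
      obtain p' q' where pq': "p' < u + s" "u + s < q'"
        "\<And>y z e. 0 \<le> e \<Longrightarrow> p' < y \<Longrightarrow> p' < z \<Longrightarrow> y + e < q' \<Longrightarrow> z + e < q' \<Longrightarrow>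
          f (y + e) - f y = f (z + e) - f z"
        using J(2)[of "u + s"] u unfolding linear_at_def by blast
      obtain \<delta> where \<delta>: "0 < \<delta>" "\<And>e. 0 < e \<Longrightarrow> e < \<delta> \<Longrightarrow> f (u + s + e) - f (u + s) = f (u + e) - f u"
        using locally_linear_imp_same_germ[OF f conv J(2), of "u + s" u] u
        unfolding same_germ_def by blast
      let ?A = "{\<delta>, u - p, q - u, u + s - p', q' - (u + s)}"
      have "\<exists>\<epsilon>>0. \<forall>a\<in>?A. \<epsilon> < a"
        by (rule finite_pos_bound) (use \<delta>(1) pq(1,2) pq'(1,2) in auto)
      then obtain \<epsilon> where \<epsilon>: "0 < \<epsilon>" "\<And>a. a \<in> ?A \<Longrightarrow> \<epsilon> < a" by blast
      have step: "f (u + e + s) - f (u + e) = f (u + s) - f u"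
        "f (u - e + s) - f (u - e) = f (u + s) - f u" if e: "0 < e" "e < \<epsilon>" for e
      proof -
        have "e < \<delta>" "e < u - p" "e < q - u" "e < u + s - p'" "e < q' - (u + s)"
          using \<epsilon>(2) e(2) by (auto intro: less_trans)
        then have b: "p < u - e" "u + e < q" "p' < u + s - e" "u + s + e < q'"
          by (simp_all add: less_diff_eq algebra_simps)
        have germ: "f (u + s + e) - f (u + s) = f (u + e) - f u" using \<delta>(2) e(1) \<open>e < \<delta>\<close> by blast
        then show "f (u + e + s) - f (u + e) = f (u + s) - f u"
          by (simp add: algebra_simps)
        \<comment> \<open>Germs see only steps to the right; local linearity at u and at u + s turns
          the step to the left into one to the right.\<close>
        have "f (u - e + e) - f (u - e) = f (u + e) - f u"
          using b(1,2) e(1) pq(1,2) by (intro pq(3)) auto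
        moreover have "f (u + s - e + e) - f (u + s - e) = f (u + s + e) - f (u + s)"
          using b(3,4) e(1) pq'(1,2) by (intro pq'(3)) auto
        ultimately have "f (u + s) - f (u + s - e) = f u - f (u - e)" using germ by simp
        then show "f (u - e + s) - f (u - e) = f (u + s) - f u" by (simp add: algebra_simps)
      qed
      have loc: "f (w + s) - f w = f (u + s) - f u" if w: "u - \<epsilon> < w" "w < u + \<epsilon>" for w
      proof -
        consider "w = u" | "u < w" | "w < u" by force
        then show ?thesis
        proof cases
          case 2
          then show ?thesis using step(1)[of "w - u"] w(2) by (simp add: diff_less_eq add.commute)
        next
          case 3
          then show ?thesis using step(2)[of "u - w"] w(1) by (simp add: diff_less_eq add.commute)
        qed simp
      qed
      show ?thesis
      proof (rule locally_atI[of "u - \<epsilon>" u "u + \<epsilon>"])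
        fix w assume "u - \<epsilon> < w" "w < u + \<epsilon>"
        from loc[OF this] show "w \<in> ?J \<longrightarrow> (w \<in> ?T \<longleftrightarrow> u \<in> ?T)" by simp
      qed (use \<epsilon>(1) in simp_all)
    qed
    ultimately have "x \<in> ?T \<longleftrightarrow> y \<in> ?T"
      by (intro tame_clopen[OF vdef1_tame, of _ ?J]) (use mem in auto)
    then show ?thesis by simp
  qed
  show ?thesis
    unfolding linear_on_interval_def
  proof (intro allI impI, elim conjE)
    fix a e1 e2
    assume "a \<in> J" "a + e1 \<in> J" "a + e2 \<in> J" "a + e1 + e2 \<in> J"
    then have "f (a + e1) - f a = f (a + e2 + e1) - f (a + e2)"
      by (intro const) (simp_all add: ac_simps)
    then show "f a + f (a + e1 + e2) = f (a + e1) + f (a + e2)"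
      by (simp add: algebra_simps)
  qed
qed

text \<open>If the increments of \<open>f\<close> are locally constant off finitely many points for each step \<open>e\<close>,
  then \<open>f\<close> is locally linear off finitely many points: otherwise the exceptional sets would meet
  infinitely many disjoint intervals for all small \<open>e\<close>, so by saturation one of them would be
  infinite.\<close>

lemma finite_not_linear_at:
  assumes f: "vfun f" and I: "open_interval I"
    and incr: "\<And>e. finite {x. (x \<in> I \<and> x + e \<in> I) \<and>
      \<not> locally_at x (\<lambda>y. (y \<in> I \<and> y + e \<in> I) \<and> f (y + e) - f y = f (x + e) - f x)}"
  shows "finite {x \<in> I. \<not> linear_at f x}"
proof (rule ccontr)
  assume inf: "infinite {x \<in> I. \<not> linear_at f x}"
  have defI: "vdef1 I" by (rule vdef1_open_interval[OF I])
  have "vdef1 {x. x \<in> I \<and> \<not> linear_at f x}"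
    unfolding linear_at_def
    by (rule vdef1I) (intro def_intros gdef_app[OF f] pdef_mem1[OF defI])
  then obtain c d where cd: "c < d" "{c<..<d} \<subseteq> {x \<in> I. \<not> linear_at f x}"
    using tame_infinite_interval[OF vdef1_tame inf] by blast
  define bad where "bad e x \<longleftrightarrow> (x \<in> I \<and> x + e \<in> I) \<and>
      \<not> locally_at x (\<lambda>y. (y \<in> I \<and> y + e \<in> I) \<and> f (y + e) - f y = f (x + e) - f x)" for e x
  have fin_bad: "finite {x. bad e x}" for e using incr unfolding bad_def .
  define U where "U p q = {e. 0 < e \<and> (\<exists>x. p < x \<and> x < q \<and> bad e x)}" for p q
  have defU: "vdef1 (U p q)" for p q
    unfolding U_def bad_def
    by (rule vdef1I) (intro def_intros gdef_app[OF f] pdef_mem1[OF defI] pdef_locally_at)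
  \<comment> \<open>By tameness, either all small positive steps are bad somewhere in (p, q) or none
    is. The second alternative would make f linear at a point of the interval.\<close>
  have germ: "\<exists>\<delta>>0. {0<..<\<delta>} \<subseteq> U p q" if pq: "c < p" "p < q" "q < d" for p q
  proof (rule ccontr)
    assume not: "\<not> (\<exists>\<delta>>0. {0<..<\<delta>} \<subseteq> U p q)"
    obtain \<delta> where \<delta>: "0 < \<delta>" "{0<..<\<delta>} \<inter> U p q = {}"
      using tame_right_germ[OF vdef1_tame[OF defU], of 0 p q] not by blast
    \<comment> \<open>Half of \<open>\<delta>\<close>: steps between two points at distance less
      than \<open>\<eta>\<close> from x are shorter than \<open>\<delta>\<close>.\<close>
    obtain \<eta> where \<eta>: "\<eta> + \<eta> = \<delta>" using exists_half by blast
    have "0 < \<eta>"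
    proof (rule ccontr)
      assume "\<not> 0 < \<eta>"
      then have "\<eta> + \<eta> \<le> 0" by (intro add_nonpos_nonpos) auto
      then show False using \<eta> \<delta>(1) by simp
    qed
    obtain x where x: "p < x" "x < q" using val_dense pq by blast
    define p' q' where "p' = max p (x - \<eta>)" "q' = min q (x + \<eta>)"
    then have bounds: "p \<le> p'" "x - \<eta> \<le> p'" "q' \<le> q" "q' \<le> x + \<eta>" by auto
    have inI: "u \<in> I" if "p' < u" "u < q'" for u
    proof -
      have "c < u" "u < d" using that bounds pq by order+
      then show ?thesis using cd(2) by auto
    qed
    have "f (y + e) - f y = f (z + e) - f z"
      if yz: "0 \<le> e" "p' < y" "p' < z" "y + e < q'" "z + e < q'" for y z e
    proof (cases "e = 0")
      case False
      then have e: "0 < e" using yz(1) by simp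
      have "x - \<eta> < y" "y + e < x + \<eta>" using yz bounds by order+
      then have "x - \<eta> + (y + e) < y + (x + \<eta>)" by (rule add_strict_mono)
      then have "e < \<delta>" by (simp add: \<eta>[symmetric] algebra_simps)
      then have nb: "\<not> bad e u" if "p < u" "u < q" for u
        using \<delta>(2) e that unfolding U_def by auto
      let ?J = "{u. p' < u \<and> u + e < q'}"
      let ?T = "{u. f (u + e) - f u = f (y + e) - f y}"
      have "vdef1 ?T" by (rule vdef1I) (intro def_intros gdef_app[OF f])
      moreover have "ord_convex ?J"
        unfolding ord_convex_def by (auto; meson add_right_mono le_less_trans less_le_trans)
      moreover have "locally_at u (\<lambda>w. w \<in> ?J \<longrightarrow> (w \<in> ?T \<longleftrightarrow> u \<in> ?T))" if u: "u \<in> ?J" for u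
      proof -
        have "u < u + e" using e by simp
        moreover have "p' < u" "u + e < q'" using u by auto
        ultimately have "u < q'" "p' < u + e" by order+
        then have "u \<in> I" "u + e \<in> I" "p < u" "u < q" using u inI bounds by auto
        then have "locally_at u (\<lambda>w. (w \<in> I \<and> w + e \<in> I) \<and> f (w + e) - f w = f (u + e) - f u)"
          using nb unfolding bad_def by blast
        then show ?thesis by (rule locally_at_mono) auto
      qed
      ultimately have "y \<in> ?T \<longleftrightarrow> z \<in> ?T"
        by (intro tame_clopen[OF vdef1_tame, of _ ?J]) (use yz in auto)
      then show ?thesis by simp
    qed simp
    moreover have "p' < x" "x < q'" using x \<open>0 < \<eta>\<close> unfolding p'_q'_def by auto
    ultimately have "linear_at f x" unfolding linear_at_def by blast
    moreover have "x \<in> {c<..<d}" using x pq by auto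
    ultimately show False using cd(2) by blast
  qed
  \<comment> \<open>The intervals between consecutive terms are disjoint, so a step that is bad in
    all of them has infinitely many bad points.\<close>
  have "\<exists>p. \<forall>n. (c < p n \<and> p n < d) \<and> p n < p (Suc n)"
    by (rule dependent_nat_choice) (use val_dense cd(1) in \<open>blast intro: less_trans\<close>)+
  then obtain p where p: "\<And>n. c < p n" "\<And>n. p n < d" "\<And>n. p n < p (Suc n)" by blast
  have "\<exists>x. \<forall>n. v x \<in> U (p n) (p (Suc n))"
  proof (rule countable_saturation[OF monster])
    fix n :: nat
    show "pdef M (\<lambda>E. v (E 0) \<in> U (p n) (p (Suc n)))"
      using defU by (simp add: vdef1_def)
    have "\<forall>m. \<exists>\<delta>>0. {0<..<\<delta>} \<subseteq> U (p m) (p (Suc m))"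
      using germ p by blast
    then obtain \<delta> where \<delta>: "\<And>m. 0 < \<delta> m" "\<And>m. {0<..<\<delta> m} \<subseteq> U (p m) (p (Suc m))"
      by metis
    obtain e where e: "0 < e" "\<forall>a\<in>\<delta> ` {..<n}. e < a"
      using finite_pos_bound[of "\<delta> ` {..<n}"] \<delta>(1) by auto
    obtain x where "v x = e" using v_surj by blast
    then show "\<exists>x. \<forall>m<n. v x \<in> U (p m) (p (Suc m))"
      using e \<delta>(2) by (intro exI[of _ x]) force
  qed
  then obtain e where "\<And>n. e \<in> U (p n) (p (Suc n))" by blast
  then have "\<forall>n. \<exists>x. p n < x \<and> x < p (Suc n) \<and> bad e x" unfolding U_def by blast
  then obtain x where x: "\<And>n. p n < x n" "\<And>n. x n < p (Suc n)" "\<And>n. bad e (x n)" by metis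
  have "x n < x (Suc n)" for n using x(2)[of n] x(1)[of "Suc n"] by order
  then have "strict_mono x" by (simp add: strict_mono_Suc_iff)
  then have "infinite (range x)" by (simp add: range_inj_infinite strict_mono_imp_inj_on)
  moreover have "range x \<subseteq> {x. bad e x}" using x(3) by auto
  ultimately show False using finite_subset[OF _ fin_bad[of e]] by simp
qed

lemma finite_rv_quotients:
  assumes "finite (rv v ` A)" "finite (rv v ` B)" "0 \<notin> A" "0 \<notin> B"
  shows "finite (rv v ` {x / y |x y. x \<in> A \<and> y \<in> B})"
proof -
  obtain A' where A': "A' \<subseteq> A" "finite A'" "rv v ` A = rv v ` A'"
    using finite_subset_image[OF assms(1) subset_refl] by auto
  obtain B' where B': "B' \<subseteq> B" "finite B'" "rv v ` B = rv v ` B'"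
    using finite_subset_image[OF assms(2) subset_refl] by auto
  have "rv v (x / y) \<in> (\<lambda>(x, y). rv v (x / y)) ` (A' \<times> B')" if xy: "x \<in> A" "y \<in> B" for x y
  proof -
    have "rv v x \<in> rv v ` A'" "rv v y \<in> rv v ` B'"
      using xy unfolding A'(3)[symmetric] B'(3)[symmetric] by simp_all
    then obtain x' y' where x'y': "x' \<in> A'" "rv v x = rv v x'" "y' \<in> B'" "rv v y = rv v y'" by auto
    then have "x \<noteq> 0" "y \<noteq> 0" "x' \<noteq> 0" "y' \<noteq> 0" using xy assms(3,4) A'(1) B'(1) by auto
    then have "rv v (x / y) = rv v (x' / y')" using x'y' by (intro rv_divide_cong)
    then show ?thesis using x'y' by force
  qed
  then have "rv v ` {x / y |x y. x \<in> A \<and> y \<in> B} \<subseteq> (\<lambda>(x, y). rv v (x / y)) ` (A' \<times> B')" by auto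
  then show ?thesis by (rule finite_subset) (simp add: A'(2) B'(2))
qed

subsection \<open>Families of finite-to-one relations on \<open>RV\<close>\<close>

text \<open>\<open>R\<close> is the pullback to \<open>K\<^sup>2\<close> of a relation on \<open>RV\<close>, which over each point of \<open>W\<close> has
  non-empty finite fibres.\<close>

context
  fixes W :: "('g \<times> 'g) set" and R :: "'a \<Rightarrow> 'a \<Rightarrow> bool"
  assumes W: "vdef2 W" and R: "pdef M (\<lambda>E. R (E 1) (E 0))"
    and ne: "\<And>x b. x \<noteq> 0 \<Longrightarrow> (v x, b) \<in> W \<Longrightarrow> \<exists>y. y \<noteq> 0 \<and> v y = b \<and> R x y"
    and fin: "\<And>x b. x \<noteq> 0 \<Longrightarrow> (v x, b) \<in> W \<Longrightarrow> finite (rv v ` {y. y \<noteq> 0 \<and> v y = b \<and> R x y})"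
begin

lemma pdef_R: "tdef M s \<Longrightarrow> tdef M t \<Longrightarrow> pdef M (\<lambda>E. R (s E) (t E))"
  by (rule pdef_rel2[OF R])

text \<open>With x of value a fixed, the classes related to x lie finitely over each b in the fibre
  of W. The principle applies to the identity function, which is nowhere locally constant because
  \<open>\<Gamma>\<close> is dense.\<close>

lemma finite_fibres: "finite (W `` {a})"
proof -
  obtain x where x: "x \<noteq> 0" "v x = a" by (rule v_surj)
  have "vdef1 {b. (a, b) \<in> W}"
    by (rule vdef1I) (intro def_intros pdef_mem2[OF W])
  moreover have "{b. (a, b) \<in> W} = W `` {a}" by auto
  ultimately have defU: "vdef1 (W `` {a})" by simp
  have id: "vfun (\<lambda>b. b)" unfolding vfun_def by (intro def_intros)
  have "finite {b \<in> W `` {a}. \<not> locally_at b (\<lambda>y. y \<in> W `` {a} \<and> y = b)}"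
  proof (rule finite_not_locally_constant[OF defU id, where Z = "\<lambda>b w. w \<noteq> 0 \<and> v w = b \<and> R x w"])
    show "pdef M (\<lambda>E. E 0 \<noteq> 0 \<and> v (E 0) = v (E 1) \<and> R x (E 0))"
      by (intro def_intros pdef_R)
  qed (use ne[of x] fin[of x] x in auto)
  moreover have "\<not> locally_at b (\<lambda>y. y \<in> W `` {a} \<and> y = b)" for b
  proof
    assume "locally_at b (\<lambda>y. y \<in> W `` {a} \<and> y = b)"
    then obtain p q where pq: "p < b" "b < q" "\<And>y. p < y \<Longrightarrow> y < q \<Longrightarrow> y = b"
      unfolding locally_at_def by blast
    obtain y where "b < y" "y < q" using val_dense[OF pq(2)] by blast
    then show False using pq(1) pq(3)[of y] by (auto dest: less_trans)
  qed
  then have "W `` {a} \<subseteq> {b \<in> W `` {a}. \<not> locally_at b (\<lambda>y. y \<in> W `` {a} \<and> y = b)}" by blast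
  ultimately show ?thesis by (meson finite_subset)
qed

lemma relation_decomposition: "pieces (\<lambda>G. \<exists>I f. open_interval I \<and> vfun f \<and> G = graph f I) W"
  by (rule graph_decomposition[OF W finite_fibres])

text \<open>The factor d depends on c alone and not on the point of W: the next lemma applies it
  over two points at once.\<close>

context
  assumes units: "\<And>c. c \<noteq> 0 \<Longrightarrow> v c = 0 \<Longrightarrow> \<exists>d. d \<noteq> 0 \<and> v d = 0 \<and>
    (\<forall>x y. x \<noteq> 0 \<and> y \<noteq> 0 \<and> (v x, v y) \<in> W \<and> R x y \<longrightarrow> R (c * x) (d * y))"
begin

text \<open>The quotient of two members of the family is a relation of the same kind, because the first
  coordinates can be normalised by \<open>units\<close>.\<close>

lemma finite_increment_not_constant:
  assumes f: "vfun f" and g: "vfun g" and U: "vdef1 U" and V: "vdef1 V"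
    and fW: "\<And>x. x \<in> U \<Longrightarrow> (x, f x) \<in> W" and gW: "\<And>x. x \<in> V \<Longrightarrow> (x, g x) \<in> W"
  shows "finite {x. (x \<in> U \<and> x + e \<in> V) \<and>
    \<not> locally_at x (\<lambda>y. (y \<in> U \<and> y + e \<in> V) \<and> g (y + e) - f y = g (x + e) - f x)}"
proof -
  obtain u where u: "u \<noteq> 0" "v u = e" by (rule v_surj)
  \<comment> \<open>Multiplication by u leads from value x to value x + e. The relation collects all
    quotients w of an element related to \<open>u * x2\<close> by an element y2 related to x2, for
    every x2 of value x.\<close>
  let ?Z = "\<lambda>x w. w \<noteq> 0 \<and> (\<exists>x2 y2. x2 \<noteq> 0 \<and> y2 \<noteq> 0 \<and> v x2 = x \<and> v y2 = f x \<and>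
      v (w * y2) = g (x + e) \<and> R x2 y2 \<and> R (u * x2) (w * y2))"
  have defU: "vdef1 {x. x \<in> U \<and> x + e \<in> V}"
    by (rule vdef1I) (intro def_intros pdef_mem1[OF U] pdef_mem1[OF V])
  have defh: "vfun (\<lambda>x. g (x + e) - f x)"
    unfolding vfun_def by (intro def_intros gdef_app[OF f] gdef_app[OF g])
  have "finite {x \<in> {x. x \<in> U \<and> x + e \<in> V}. \<not> locally_at x
      (\<lambda>y. y \<in> {x. x \<in> U \<and> x + e \<in> V} \<and> g (y + e) - f y = g (x + e) - f x)}"
  proof (rule finite_not_locally_constant[OF defU defh, where Z = ?Z])
    show "pdef M (\<lambda>E. ?Z (v (E 1)) (E 0))"
      by (intro def_intros pdef_R gdef_app[OF f] gdef_app[OF g])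
  next
    fix x assume x: "x \<in> {x. x \<in> U \<and> x + e \<in> V}"
    obtain x2 where x2: "x2 \<noteq> 0" "v x2 = x" by (rule v_surj)
    have ux2: "u * x2 \<noteq> 0" "v (u * x2) = x + e" using u x2 by (auto simp: v_mult add.commute)
    have W2: "(v x2, f x) \<in> W" "(v (u * x2), g (x + e)) \<in> W" using x x2 ux2 fW gW by auto
    obtain y1 y2 where y: "y2 \<noteq> 0" "v y2 = f x" "R x2 y2"
      "y1 \<noteq> 0" "v y1 = g (x + e)" "R (u * x2) y1"
      using ne[OF x2(1) W2(1)] ne[OF ux2(1) W2(2)] by blast
    then have "?Z x (y1 / y2)" using x2 by (intro conjI exI[of _ x2] exI[of _ y2]) simp_all
    then show "\<exists>w. ?Z x w" by blast
    let ?A = "{y. y \<noteq> 0 \<and> v y = g (x + e) \<and> R (u * x2) y}"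
    let ?B = "{y. y \<noteq> 0 \<and> v y = f x \<and> R x2 y}"
    have "finite (rv v ` {y / y' |y y'. y \<in> ?A \<and> y' \<in> ?B})"
      using fin[OF x2(1) W2(1)] fin[OF ux2(1) W2(2)] by (intro finite_rv_quotients) auto
    moreover have "{w. ?Z x w} \<subseteq> {y / y' |y y'. y \<in> ?A \<and> y' \<in> ?B}"
    proof (rule subsetI, elim CollectE conjE exE)
      fix w x3 y3
      assume w: "w \<noteq> 0" "x3 \<noteq> 0" "y3 \<noteq> 0" "v x3 = x" "v y3 = f x" "v (w * y3) = g (x + e)"
        "R x3 y3" "R (u * x3) (w * y3)"
      have ux3: "u * x3 \<noteq> 0" "v (u * x3) = x + e" using u w by (auto simp: v_mult add.commute)
      \<comment> \<open>Any other representative x3 is scaled to the fixed x2. The factor d then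
        multiplies numerator and denominator of w alike and cancels.\<close>
      have "x2 / x3 \<noteq> 0" "v (x2 / x3) = 0" using x2 w by (auto simp: v_divide)
      from units[OF this] obtain d where d: "d \<noteq> 0" "v d = 0"
        "\<And>x y. x \<noteq> 0 \<Longrightarrow> y \<noteq> 0 \<Longrightarrow> (v x, v y) \<in> W \<Longrightarrow> R x y \<Longrightarrow> R (x2 / x3 * x) (d * y)"
        by blast
      have "R (x2 / x3 * x3) (d * y3)" using w fW x by (intro d(3)) auto
      then have "d * y3 \<in> ?B" using w d(1,2) by (simp add: v_mult)
      moreover have "R (x2 / x3 * (u * x3)) (d * (w * y3))"
        using w ux3 gW x by (intro d(3)) auto
      then have "d * (w * y3) \<in> ?A" using w d(1,2) v_mult[of d "w * y3"] by (simp add: mult.commute)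
      moreover have "w = d * (w * y3) / (d * y3)" using w d(1) by simp
      ultimately show "w \<in> {y / y' |y y'. y \<in> ?A \<and> y' \<in> ?B}" by blast
    qed
    ultimately show "finite (rv v ` {w. ?Z x w})"
      by (meson finite_subset image_mono)
  next
    fix x w assume "?Z x w"
    then obtain y2 where "w \<noteq> 0" "y2 \<noteq> 0" "v y2 = f x" "v (w * y2) = g (x + e)" by blast
    then show "w \<noteq> 0 \<and> v w = g (x + e) - f x" by (simp add: v_mult algebra_simps)
  qed
  then show ?thesis by simp
qed

lemma linear_decomposition:
  "pieces (\<lambda>G. \<exists>I f. open_interval I \<and> vfun f \<and> G = graph f I \<and> linear_on_interval I f \<and> G \<subseteq> W) W"
proof (rule pieces_refine[OF relation_decomposition], elim exE conjE)
  fix G I f assume I: "open_interval I" and f: "vfun f" and G: "G = graph f I" and sub: "G \<subseteq> W"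
  have fW: "(x, f x) \<in> W" if "x \<in> I" for x using that G sub by auto
  have "finite {x \<in> I. \<not> linear_at f x}"
    using f I fW by (intro finite_not_linear_at finite_increment_not_constant vdef1_open_interval)
  from graph_refine[OF I this]
  have "pieces (\<lambda>G. \<exists>J. open_interval J \<and> (\<forall>x\<in>J. linear_at f x) \<and> G = graph f J) G"
    unfolding G .
  then show "pieces (\<lambda>G. \<exists>I f. open_interval I \<and> vfun f \<and> G = graph f I \<and>
      linear_on_interval I f \<and> G \<subseteq> W) G"
  proof (rule pieces_mono, elim exE conjE)
    fix H J assume "open_interval J" "\<forall>x\<in>J. linear_at f x" "H = graph f J" "H \<subseteq> G"
    then show "\<exists>I f. open_interval I \<and> vfun f \<and> H = graph f I \<and> linear_on_interval I f \<and> H \<subseteq> W"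
      using f sub locally_linear_imp_linear[OF f, of J] by (intro exI[of _ J] exI[of _ f]) auto
  qed
qed

text \<open>The shift e moves a point of I to a point of J, so I and J - e overlap in an interval.
  There the difference \<open>g (w + e) - f w\<close> is locally constant off a finite set; where it
  equals c, translation by (e, c) carries a piece of one graph into the other.\<close>

lemma same_slope_graphs:
  assumes I: "open_interval I" "vfun f" "graph f I \<subseteq> W" and J: "open_interval J" "vfun g" "graph g J \<subseteq> W"
  shows "same_slope (graph g J) (graph f I)"
proof -
  obtain x y where xy: "x \<in> I" "y \<in> J" using I(1) J(1) by (auto simp: open_interval_def)
  define e where "e = y - x"
  let ?U = "{u. u \<in> I \<and> u + e \<in> J}"
  have fW: "(u, f u) \<in> W" if "u \<in> I" for u using that I(3) by auto
  have gW: "(u, g u) \<in> W" if "u \<in> J" for u using that J(3) by auto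
  have bad: "finite {u. (u \<in> I \<and> u + e \<in> J) \<and> \<not> locally_at u
      (\<lambda>w. (w \<in> I \<and> w + e \<in> J) \<and> g (w + e) - f w = g (u + e) - f u)}" (is "finite ?bad")
    by (intro finite_increment_not_constant vdef1_open_interval I J fW gW)
  obtain p q where pq: "p < x" "x < q" "\<And>u. p < u \<Longrightarrow> u < q \<Longrightarrow> u \<in> I"
    using open_interval_nbhd[OF I(1) xy(1)] unfolding locally_at_def by blast
  obtain p' q' where pq': "p' < y" "y < q'" "\<And>u. p' < u \<Longrightarrow> u < q' \<Longrightarrow> u \<in> J"
    using open_interval_nbhd[OF J(1) xy(2)] unfolding locally_at_def by blast
  have "{x<..<min q (q' - e)} \<subseteq> ?U"
  proof
    fix u assume "u \<in> {x<..<min q (q' - e)}"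
    then have u: "x < u" "u < q" "u < q' - e" by auto
    then have "y < u + e" "u + e < q'" by (auto simp: e_def algebra_simps)
    then show "u \<in> ?U" using u pq pq' by (auto intro: less_trans)
  qed
  moreover have "x < min q (q' - e)" using pq pq' by (auto simp: e_def algebra_simps)
  ultimately have "infinite ?U" using infinite_greaterThanLessThan by (meson finite_subset)
  then have "\<not> ?U \<subseteq> ?bad" using finite_subset[OF _ bad] by (rule contrapos_nn)
  then obtain u where "locally_at u (\<lambda>w. (w \<in> I \<and> w + e \<in> J) \<and> g (w + e) - f w = g (u + e) - f u)"
    by blast
  then obtain r s where rs: "r < u" "u < s"
    "\<And>w. r < w \<Longrightarrow> w < s \<Longrightarrow> w \<in> I \<and> w + e \<in> J \<and> g (w + e) - f w = g (u + e) - f u"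
    unfolding locally_at_def by blast
  define c where "c = g (u + e) - f u"
  have "(w + e, g (w + e)) \<in> graph g J \<inter> (\<lambda>(a, b). (a + e, b + c)) ` graph f I" if "w \<in> {u<..<s}" for w
  proof -
    have w: "w \<in> I" "w + e \<in> J" "g (w + e) - f w = c"
      using rs(3)[of w] rs(1) that by (auto simp: c_def)
    then have "g (w + e) = f w + c" by (metis add.commute diff_add_cancel)
    then have "(w + e, g (w + e)) = (\<lambda>(a, b). (a + e, b + c)) (w, f w)" by simp
    then have "(w + e, g (w + e)) \<in> (\<lambda>(a, b). (a + e, b + c)) ` graph f I"
      using w(1) by blast
    then show ?thesis using w(2) by blast
  qed
  then have "(\<lambda>w. (w + e, g (w + e))) ` {u<..<s} \<subseteq> graph g J \<inter> (\<lambda>(a, b). (a + e, b + c)) ` graph f I"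
    by blast
  moreover have "infinite ((\<lambda>w. (w + e, g (w + e))) ` {u<..<s})"
    using infinite_greaterThanLessThan[OF rs(2)] by (subst finite_image_iff) (auto simp: inj_on_def)
  ultimately show ?thesis unfolding same_slope_def by (meson finite_subset)
qed

end

text \<open>By \<open>prod\<close> the fibre over x depends on \<open>v x\<close> only. The fibres
  themselves, without passing to quotients, are thus a definable family of finite sets over the
  values of f.\<close>

lemma constant_decomposition:
  assumes prod: "\<And>x x' y. x \<noteq> 0 \<Longrightarrow> x' \<noteq> 0 \<Longrightarrow> y \<noteq> 0 \<Longrightarrow> v x = v x' \<Longrightarrow> (v x, v y) \<in> W \<Longrightarrow>
    R x y \<Longrightarrow> R x' y"
  shows "pieces (\<lambda>G. \<exists>I b. open_interval I \<and> G = I \<times> {b}) W"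
proof (rule pieces_refine[OF relation_decomposition], elim exE conjE)
  fix G I f assume I: "open_interval I" and f: "vfun f" and G: "G = graph f I" and sub: "G \<subseteq> W"
  have fW: "(x, f x) \<in> W" if "x \<in> I" for x using that G sub by auto
  let ?Z = "\<lambda>x w. w \<noteq> 0 \<and> v w = f x \<and> (\<exists>z. z \<noteq> 0 \<and> v z = x \<and> R z w)"
  have "finite {x \<in> I. \<not> locally_at x (\<lambda>y. y \<in> I \<and> f y = f x)}"
  proof (rule finite_not_locally_constant[OF vdef1_open_interval[OF I] f, where Z = ?Z])
    show "pdef M (\<lambda>E. ?Z (v (E 1)) (E 0))"
      by (intro def_intros pdef_R gdef_app[OF f])
  next
    fix x assume x: "x \<in> I"
    obtain z where z: "z \<noteq> 0" "v z = x" by (rule v_surj)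
    have zW: "(v z, f x) \<in> W" using fW[OF x] z(2) by simp
    show "\<exists>w. ?Z x w" using ne[OF z(1) zW] z by blast
    have "{w. ?Z x w} \<subseteq> {w. w \<noteq> 0 \<and> v w = f x \<and> R z w}"
      using prod[OF _ z(1)] z zW by auto
    then show "finite (rv v ` {w. ?Z x w})"
      using fin[OF z(1) zW] by (meson finite_subset image_mono)
  qed auto
  from graph_refine[OF I this]
  have "pieces (\<lambda>G. \<exists>J. open_interval J \<and> (\<forall>x\<in>J. locally_at x (\<lambda>y. y \<in> I \<and> f y = f x)) \<and> G = graph f J) G"
    unfolding G .
  then show "pieces (\<lambda>G. \<exists>I b. open_interval I \<and> G = I \<times> {b}) G"
  proof (rule pieces_mono, elim exE conjE)
    fix H J assume J: "open_interval J" "\<forall>x\<in>J. locally_at x (\<lambda>y. y \<in> I \<and> f y = f x)" "H = graph f J"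
    obtain a where a: "a \<in> J" using J(1) by (auto simp: open_interval_def)
    let ?T = "{x. f x = f a}"
    have T: "vdef1 ?T" by (rule vdef1I) (intro def_intros gdef_app[OF f])
    have "locally_at x (\<lambda>y. y \<in> J \<longrightarrow> (y \<in> ?T \<longleftrightarrow> x \<in> ?T))" if "x \<in> J" for x
      using bspec[OF J(2) that] by (rule locally_at_mono) auto
    then have "x \<in> ?T \<longleftrightarrow> a \<in> ?T" if "x \<in> J" for x
      using that a by (intro tame_clopen[OF vdef1_tame[OF T] open_interval_convex[OF J(1)]])
    then have "H = J \<times> {f a}" unfolding J(3) by auto
    then show "\<exists>I b. open_interval I \<and> H = I \<times> {b}" using J(1) by blast
  qed
qed

end

end

section \<open>Definable sets in \<open>RV\<^sup>2\<close>\<close>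

context acvf
begin

section \<open>The group RV and its definable relations on representatives\<close>

lemma carrier_RV: "carrier (RV v) = rv v ` (- {0})"
  by (auto simp: RV_def carrier_FactGroup rv_def mult_group_def)

lemma rv_in_carrier: "x \<noteq> 0 \<Longrightarrow> rv v x \<in> carrier (RV v)"
  by (auto simp: carrier_RV)

lemma carrier_RVE: "\<rho> \<in> carrier (RV v) \<Longrightarrow> (\<And>x. x \<noteq> 0 \<Longrightarrow> \<rho> = rv v x \<Longrightarrow> thesis) \<Longrightarrow> thesis"
  by (auto simp: carrier_RV)

lemma rv_memD:
  assumes "x \<noteq> 0" "y \<in> rv v x" shows "y \<noteq> 0" "v y = v x" "rv v y = rv v x"
proof -
  have y: "y \<in> open_ball v x (v x)" using assms by (simp add: rv_eq_open_ball)
  show "y \<noteq> 0" "v y = v x" "rv v y = rv v x"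
    using open_ball_valD[OF assms(1) y] rv_eqI[OF assms(1) y] by simp_all
qed

lemma mult_RV:
  assumes "x \<noteq> 0" "y \<noteq> 0" shows "rv v x \<otimes>\<^bsub>RV v\<^esub> rv v y = rv v (x * y)"
proof -
  have eq: "rv v x \<otimes>\<^bsub>RV v\<^esub> rv v y = {a * b |a b. a \<in> rv v x \<and> b \<in> rv v y}"
    by (auto simp: RV_def set_mult_def mult_group_def)
  have "a * b \<in> rv v (x * y)" if "a \<in> rv v x" "b \<in> rv v y" for a b
  proof -
    note a = rv_memD[OF assms(1) that(1)] and b = rv_memD[OF assms(2) that(2)]
    have "rv v (a * b) = rv v (x * y)" using a b by (intro rv_mult_cong)
    then show ?thesis using rv_self[of "a * b"] a b by simp
  qed
  moreover have "\<exists>a b. z = a * b \<and> a \<in> rv v x \<and> b \<in> rv v y" if "z \<in> rv v (x * y)" for z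
    using that rv_self[OF assms(1)] unfolding rv_mult_image[of x y] by blast
  ultimately show ?thesis unfolding eq by blast
qed

lemma one_RV: "\<one>\<^bsub>RV v\<^esub> = rv v 1"
  by (auto simp: RV_def rv_def r_coset_def mult_group_def)

lemma group_RV: "group (RV v)"
proof (rule groupI)
  fix x assume "x \<in> carrier (RV v)"
  then obtain a where a: "a \<noteq> 0" "x = rv v a" by (rule carrier_RVE)
  then have "rv v (1 / a) \<otimes>\<^bsub>RV v\<^esub> x = \<one>\<^bsub>RV v\<^esub>" using mult_RV[of "1 / a" a] by (simp add: one_RV)
  then show "\<exists>y\<in>carrier (RV v). y \<otimes>\<^bsub>RV v\<^esub> x = \<one>\<^bsub>RV v\<^esub>"
    using a(1) rv_in_carrier[of "1 / a"] by auto
qed (auto elim!: carrier_RVE simp: mult_RV one_RV rv_in_carrier mult.assoc)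

lemma inv_RV2:
  assumes "x \<noteq> 0" "y \<noteq> 0"
  shows "inv\<^bsub>RV2 v\<^esub> (rv v x, rv v y) = (rv v (1 / x), rv v (1 / y))"
proof -
  have "inv\<^bsub>RV v\<^esub> (rv v z) = rv v (1 / z)" if "z \<noteq> 0" for z
    by (rule group.inv_equality[OF group_RV])
      (use that in \<open>simp_all add: mult_RV one_RV rv_in_carrier\<close>)
  then show ?thesis using assms group_RV by (simp add: inv_DirProd rv_in_carrier)
qed

lemma mem_translate:
  assumes "X \<subseteq> carrier (RV2 v)" "g \<noteq> 0" "h \<noteq> 0" "x \<noteq> 0" "y \<noteq> 0"
  shows "(rv v x, rv v y) \<in> (rv v g, rv v h) <#\<^bsub>RV2 v\<^esub> X \<longleftrightarrow> (rv v (x / g), rv v (y / h)) \<in> X"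
proof
  assume "(rv v x, rv v y) \<in> (rv v g, rv v h) <#\<^bsub>RV2 v\<^esub> X"
  then obtain \<rho> \<sigma> where *: "(\<rho>, \<sigma>) \<in> X" "(rv v x, rv v y) = (rv v g, rv v h) \<otimes>\<^bsub>RV2 v\<^esub> (\<rho>, \<sigma>)"
    by (auto simp: l_coset_def)
  then have "\<rho> \<in> carrier (RV v)" "\<sigma> \<in> carrier (RV v)" using assms(1) by auto
  then obtain a b where ab: "a \<noteq> 0" "\<rho> = rv v a" "b \<noteq> 0" "\<sigma> = rv v b"
    by (auto elim!: carrier_RVE)
  then have "rv v x = rv v (g * a)" "rv v y = rv v (h * b)" using * assms by (auto simp: mult_RV)
  then have "rv v (x / g) = rv v a" "rv v (y / h) = rv v b"
    using assms rv_mult_cancel[of g "x / g" a] rv_mult_cancel[of h "y / h" b] by auto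
  then show "(rv v (x / g), rv v (y / h)) \<in> X" using * ab by simp
next
  assume *: "(rv v (x / g), rv v (y / h)) \<in> X"
  have "(rv v x, rv v y) = (rv v g, rv v h) \<otimes>\<^bsub>RV2 v\<^esub> (rv v (x / g), rv v (y / h))"
    using assms by (simp add: mult_RV)
  then show "(rv v x, rv v y) \<in> (rv v g, rv v h) <#\<^bsub>RV2 v\<^esub> X" using * unfolding l_coset_def by blast
qed

lemma translate_subset_carrier:
  assumes "X \<subseteq> carrier (RV2 v)" "g \<noteq> 0" "h \<noteq> 0"
  shows "(rv v g, rv v h) <#\<^bsub>RV2 v\<^esub> X \<subseteq> carrier (RV2 v)"
proof -
  have "group (RV2 v)" by (intro DirProd_group group_RV)
  then show ?thesis using assms
    by (intro group.l_coset_subset_G) (auto simp: rv_in_carrier)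
qed

lemma mem_RV_fiber: "x \<noteq> 0 \<Longrightarrow> rv v x \<in> RV_fiber v \<gamma> \<longleftrightarrow> v x = \<gamma>"
proof -
  assume x: "x \<noteq> 0"
  have "v ` rv v x \<subseteq> {v x}" using rv_memD(2)[OF x] by blast
  moreover have "v x \<in> v ` rv v x" using rv_self[OF x] by (rule imageI)
  ultimately have "v ` rv v x = {v x}" by blast
  then show ?thesis using x by (simp add: RV_fiber_def rv_in_carrier)
qed

lemma RV_fiberE:
  assumes "\<rho> \<in> RV_fiber v \<gamma>"
  obtains x where "x \<noteq> 0" "\<rho> = rv v x" "v x = \<gamma>"
proof -
  have "\<rho> \<in> carrier (RV v)" using assms by (simp add: RV_fiber_def)
  then obtain x where x: "x \<noteq> 0" "\<rho> = rv v x" by (rule carrier_RVE)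
  then show ?thesis using that assms mem_RV_fiber[OF x(1)] by simp
qed

definition rvrel :: "('a set \<times> 'a set) set \<Rightarrow> 'a \<Rightarrow> 'a \<Rightarrow> bool" where
  "rvrel X x y \<longleftrightarrow> x \<noteq> 0 \<and> y \<noteq> 0 \<and> (rv v x, rv v y) \<in> X"

lemma definable_pairs_rv_iff:
  "definable_pairs M (rv v) X \<longleftrightarrow> X \<subseteq> carrier (RV2 v) \<and> pdef M (\<lambda>E. rvrel X (E 1) (E 0))"
proof -
  have eq: "{xs. length xs = 2 \<and> rvrel X (xs ! 0) (xs ! 1)} =
      {[x, y] |x y. x \<noteq> 0 \<and> y \<noteq> 0 \<and> (rv v x, rv v y) \<in> X}"
    by (auto simp: length_Suc_conv numeral_2_eq_2 rvrel_def)
  have "definable M 2 {xs. length xs = 2 \<and> rvrel X (xs ! 0) (xs ! 1)} \<longleftrightarrow>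
      pdef M (\<lambda>E. rvrel X (E 1) (E 0))"
  proof
    assume "definable M 2 {xs. length xs = 2 \<and> rvrel X (xs ! 0) (xs ! 1)}"
    from pdef_definable[OF this] have "pdef M (\<lambda>E. rvrel X (E 0) (E 1))"
      by (simp add: upt_conv_Cons numeral_2_eq_2)
    then show "pdef M (\<lambda>E. rvrel X (E 1) (E 0))" by (rule pdef_swap)
  next
    assume "pdef M (\<lambda>E. rvrel X (E 1) (E 0))"
    then have "pdef M (\<lambda>E. rvrel X (E 0) (E 1))" by (rule pdef_rel2) (rule tdef_var)+
    from definable_pdef[OF this, of 2] show "definable M 2 {xs. length xs = 2 \<and> rvrel X (xs ! 0) (xs ! 1)}"
      by simp
  qed
  then show ?thesis unfolding definable_pairs_def eq by (simp add: carrier_RV)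
qed

section \<open>Morley rank, subgroups of the units, stabilizers\<close>

lemma morley_rank_ge_1:
  assumes "infinite S" "S \<subseteq> carrier (RV2 v)"
  shows "morley_rank_ge (definable_pairs M (rv v)) 1 S"
proof -
  obtain p :: "nat \<Rightarrow> 'a set \<times> 'a set" where p: "inj p" "range p \<subseteq> S"
    using infinite_countable_subset[OF assms(1)] by blast
  have "definable_pairs M (rv v) {p i}" for i
  proof -
    obtain a b where ab: "a \<noteq> 0" "b \<noteq> 0" "p i = (rv v a, rv v b)"
    proof -
      have "p i \<in> carrier (RV v) \<times> carrier (RV v)" using p(2) assms(2) by auto
      then show ?thesis using that by (auto elim!: carrier_RVE)
    qed
    have "pdef M (\<lambda>E. (E 1 \<noteq> 0 \<and> a \<noteq> 0 \<and> rv v (E 1) = rv v a) \<and> (E 0 \<noteq> 0 \<and> b \<noteq> 0 \<and> rv v (E 0) = rv v b))"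
      by (intro pdef_conj[OF pdef_rv_eq pdef_rv_eq] tdef_var tdef_const)
    moreover have "(\<lambda>E::nat \<Rightarrow> 'a. (E 1 \<noteq> 0 \<and> a \<noteq> 0 \<and> rv v (E 1) = rv v a) \<and>
        (E 0 \<noteq> 0 \<and> b \<noteq> 0 \<and> rv v (E 0) = rv v b)) = (\<lambda>E. rvrel {p i} (E 1) (E 0))"
      using ab by (auto simp: rvrel_def)
    ultimately show ?thesis unfolding definable_pairs_rv_iff using ab by (simp add: rv_in_carrier)
  qed
  then show ?thesis
    using p by (auto simp: inj_eq intro!: exI[of _ "\<lambda>i. {p i}"])
qed

text \<open>The vertical slices over infinitely many classes of C are disjoint, definable and
  infinite, so each has rank at least 1.\<close>

lemma morley_rank_ge_2:
  assumes X: "definable_pairs M (rv v) X" and gh: "g \<noteq> 0" "h \<noteq> 0"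
    and C: "infinite (rv v ` C)" "0 \<notin> C" and inf: "\<And>c. c \<in> C \<Longrightarrow> infinite (rv v ` {y. rvrel X c y})"
  shows "morley_rank_ge (definable_pairs M (rv v)) 2 (inv\<^bsub>RV2 v\<^esub> (rv v g, rv v h) <#\<^bsub>RV2 v\<^esub> X)"
proof -
  have XR: "X \<subseteq> carrier (RV2 v)" "pdef M (\<lambda>E. rvrel X (E 1) (E 0))"
    using X by (auto simp: definable_pairs_rv_iff)
  let ?T = "inv\<^bsub>RV2 v\<^esub> (rv v g, rv v h) <#\<^bsub>RV2 v\<^esub> X"
  have T: "(rv v x, rv v y) \<in> ?T \<longleftrightarrow> (rv v (x * g), rv v (y * h)) \<in> X" if "x \<noteq> 0" "y \<noteq> 0" for x y
    using mem_translate[OF XR(1), of "1 / g" "1 / h" x y] gh that by (simp add: inv_RV2)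
  have Tsub: "?T \<subseteq> carrier (RV2 v)"
    using translate_subset_carrier[OF XR(1), of "1 / g" "1 / h"] gh by (simp add: inv_RV2)
  obtain q :: "nat \<Rightarrow> 'a set" where q: "inj q" "range q \<subseteq> rv v ` C"
    using infinite_countable_subset[OF C(1)] by blast
  then have "\<forall>i. \<exists>c. c \<in> C \<and> q i = rv v c" by blast
  then obtain c where c: "\<And>i. c i \<in> C" "\<And>i. q i = rv v (c i)" by metis
  have c0: "c i \<noteq> 0" for i using c(1)[of i] C(2) by auto
  define Y where "Y i = {\<rho> \<in> ?T. fst \<rho> = rv v (c i / g)}" for i
  have "definable_pairs M (rv v) (Y i)" for i
  proof -
    have "pdef M (\<lambda>E. (E 1 \<noteq> 0 \<and> c i / g \<noteq> 0 \<and> rv v (E 1) = rv v (c i / g)) \<and> rvrel X (E 1 * g) (E 0 * h))"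
      by (intro pdef_conj[OF pdef_rv_eq pdef_rel2[OF XR(2)]] def_intros)
    moreover have "(\<lambda>E::nat \<Rightarrow> 'a. (E 1 \<noteq> 0 \<and> c i / g \<noteq> 0 \<and> rv v (E 1) = rv v (c i / g)) \<and>
        rvrel X (E 1 * g) (E 0 * h)) = (\<lambda>E. rvrel (Y i) (E 1) (E 0))"
      using T c0[of i] gh by (auto simp: rvrel_def Y_def fun_eq_iff)
    ultimately show ?thesis unfolding definable_pairs_rv_iff using Tsub by (auto simp: Y_def)
  qed
  moreover have "morley_rank_ge (definable_pairs M (rv v)) 1 (Y i)" for i
  proof (rule morley_rank_ge_1)
    show "Y i \<subseteq> carrier (RV2 v)" using Tsub by (auto simp: Y_def)
    have "(\<lambda>y. (rv v (c i / g), rv v (y / h))) ` {y. rvrel X (c i) y} \<subseteq> Y i"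
      using T c0[of i] gh by (auto simp: rvrel_def Y_def)
    moreover have "infinite ((\<lambda>y. (rv v (c i / g), rv v (y / h))) ` {y. rvrel X (c i) y})"
    proof
      assume "finite ((\<lambda>y. (rv v (c i / g), rv v (y / h))) ` {y. rvrel X (c i) y})"
      then have "finite ((\<lambda>p. (*) h ` snd p) ` (\<lambda>y. (rv v (c i / g), rv v (y / h))) ` {y. rvrel X (c i) y})"
        by (rule finite_imageI)
      moreover have "(\<lambda>p. (*) h ` snd p) ` (\<lambda>y. (rv v (c i / g), rv v (y / h))) ` {y. rvrel X (c i) y} =
          rv v ` {y. rvrel X (c i) y}"
        using gh by (simp add: image_image rv_mult_image[symmetric])
      ultimately show False using inf[OF c(1)[of i]] by simp
    qed
    ultimately show "infinite (Y i)" by (meson finite_subset)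
  qed
  moreover have "Y i \<inter> Y j = {}" if "i \<noteq> j" for i j
  proof -
    have "rv v (c i) \<noteq> rv v (c j)" using q(1) c(2) that by (metis injD)
    then have "rv v (c i / g) \<noteq> rv v (c j / g)"
      using rv_mult_cancel[of "1 / g" "c i" "c j"] gh by simp
    then show ?thesis by (auto simp: Y_def)
  qed
  moreover have "Y i \<subseteq> ?T" for i by (auto simp: Y_def)
  ultimately have "morley_rank_ge (definable_pairs M (rv v)) (Suc 1) ?T"
    unfolding morley_rank_ge.simps(2) by (intro exI[of _ Y]) blast
  then show ?thesis by (simp only: Suc_1)
qed

text \<open>An infinite definable subgroup of \<open>k\<^sup>\<times>\<close> is cofinite by strong minimality, so it meets all of
  its cosets.\<close>

lemma units_subgroup:
  assumes H: "pdef M (\<lambda>E. E 0 \<in> H)" and units: "\<And>d. d \<in> H \<Longrightarrow> d \<noteq> 0 \<and> v d = 0"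
    and div: "\<And>d e. d \<in> H \<Longrightarrow> e \<in> H \<Longrightarrow> d / e \<in> H" and inf: "infinite (rv v ` H)"
    and u: "u \<noteq> 0" "v u = 0"
  shows "u \<in> H"
proof -
  have "{d. d \<in> H} \<in> ball_combinations v" using H by (rule pdef_ball_combination)
  then have "H \<in> ball_combinations v" by simp
  from ball_combination_fiber[OF this, of 0] obtain F s where F: "finite F"
    "\<forall>x. x \<noteq> 0 \<and> v x = 0 \<and> rv v x \<notin> F \<longrightarrow> (x \<in> H \<longleftrightarrow> s)" by (elim exE conjE)
  have "\<not> rv v ` H \<subseteq> F" using inf F(1) by (meson finite_subset)
  then obtain d where d: "d \<in> H" "rv v d \<notin> F" by blast
  have s: s using mp[OF spec[OF F(2), of d]] units[OF d(1)] d by simp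
  \<comment> \<open>The products u * d with d in H have infinitely many classes, so one of them
    avoids F and lies in H; then u = (u * d) / d.\<close>
  have "\<not> (\<lambda>d. rv v (u * d)) ` H \<subseteq> F"
  proof
    assume "(\<lambda>d. rv v (u * d)) ` H \<subseteq> F"
    then have "finite ((\<lambda>d. rv v (u * d)) ` H)" using F(1) by (rule finite_subset)
    then have "finite ((`) ((*) (1 / u)) ` (\<lambda>d. rv v (u * d)) ` H)" by (rule finite_imageI)
    moreover have "(*) (1 / u) ` rv v (u * d) = rv v d" for d
      using rv_mult_image[of "1 / u" "u * d"] u(1) by simp
    ultimately show False using inf by (simp only: image_image)
  qed
  then obtain d where d: "d \<in> H" "rv v (u * d) \<notin> F" by blast
  then have "u * d \<in> H" using mp[OF spec[OF F(2), of "u * d"]] s u units[OF d(1)] by (simp add: v_mult)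
  from div[OF this d(1)] show ?thesis using units[OF d(1)] by simp
qed

lemma Stab_iff:
  assumes X: "X \<subseteq> carrier (RV2 v)" and cd: "c \<noteq> 0" "d \<noteq> 0"
  shows "(rv v c, rv v d) \<in> Stab v X \<longleftrightarrow> (\<forall>x y. x \<noteq> 0 \<and> y \<noteq> 0 \<longrightarrow> rvrel X (c * x) (d * y) = rvrel X x y)"
proof -
  have "(rv v c, rv v d) \<in> Stab v X \<longleftrightarrow> (rv v c, rv v d) <#\<^bsub>RV2 v\<^esub> X = X"
    using cd by (simp add: Stab_def rv_in_carrier)
  also have "\<dots> \<longleftrightarrow> (\<forall>\<rho> \<in> carrier (RV2 v). \<rho> \<in> (rv v c, rv v d) <#\<^bsub>RV2 v\<^esub> X \<longleftrightarrow> \<rho> \<in> X)"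
    using X translate_subset_carrier[OF X cd] by blast
  also have "\<dots> \<longleftrightarrow> (\<forall>x y. x \<noteq> 0 \<and> y \<noteq> 0 \<longrightarrow> ((rv v x, rv v y) \<in> (rv v c, rv v d) <#\<^bsub>RV2 v\<^esub> X \<longleftrightarrow> (rv v x, rv v y) \<in> X))"
    by (auto simp: carrier_RV)
  also have "\<dots> \<longleftrightarrow> (\<forall>x y. x \<noteq> 0 \<and> y \<noteq> 0 \<longrightarrow> (rvrel X (x / c) (y / d) \<longleftrightarrow> rvrel X x y))"
    using mem_translate[OF X cd] cd by (auto simp: rvrel_def)
  also have "\<dots> \<longleftrightarrow> (\<forall>x y. x \<noteq> 0 \<and> y \<noteq> 0 \<longrightarrow> rvrel X (c * x) (d * y) = rvrel X x y)" (is "?L = ?R")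
  proof
    assume L: ?L
    show ?R
    proof (intro allI impI, elim conjE)
      fix x y :: 'a assume "x \<noteq> 0" "y \<noteq> 0"
      then show "rvrel X (c * x) (d * y) = rvrel X x y"
        using spec[OF spec[OF L, of "c * x"], of "d * y"] cd by simp
    qed
  next
    assume R: ?R
    show ?L
    proof (intro allI impI, elim conjE)
      fix x y :: 'a assume "x \<noteq> 0" "y \<noteq> 0"
      then show "rvrel X (x / c) (y / d) = rvrel X x y"
        using spec[OF spec[OF R, of "x / c"], of "y / d"] cd by simp
    qed
  qed
  finally show ?thesis .
qed

end

section \<open>Fragments with infinite stabilizer\<close>

context acvf
begin

context
  fixes D X :: "('a set \<times> 'a set) set"
  assumes D: "definable_pairs M (rv v) D" and frag: "fragment M v X" and inf: "infinite (Stab v X)"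
begin

lemma X_carrier: "X \<subseteq> carrier (RV2 v)"
  and pdef_X: "tdef M s \<Longrightarrow> tdef M t \<Longrightarrow> pdef M (\<lambda>E. rvrel X (s E) (t E))"
  and pdef_D: "tdef M s \<Longrightarrow> tdef M t \<Longrightarrow> pdef M (\<lambda>E. rvrel D (s E) (t E))"
  using frag D by (auto simp: fragment_def definable_pairs_rv_iff intro: pdef_rel2[of M "rvrel _"])

lemma fragment_point: obtains x y where "rvrel X x y"
proof -
  obtain \<rho> where \<rho>: "\<rho> \<in> X" using frag by (auto simp: fragment_def)
  then have "\<rho> \<in> carrier (RV v) \<times> carrier (RV v)" using X_carrier by auto
  then show ?thesis using \<rho> that by (auto simp: rvrel_def elim!: carrier_RVE)
qed

lemma fragment_val: obtains a b where "\<forall>x y. rvrel X x y \<longrightarrow> v x = a \<and> v y = b"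
proof -
  obtain a b where "X \<subseteq> RV_fiber v a \<times> RV_fiber v b" using frag by (auto simp: fragment_def)
  then show ?thesis using that[of a b] mem_RV_fiber by (auto simp: rvrel_def)
qed

lemma fragment_small:
  assumes "infinite (rv v ` C)" "0 \<notin> C" "\<And>c. c \<in> C \<Longrightarrow> infinite (rv v ` {y. rvrel X c y})"
  shows False
proof -
  obtain a b \<rho> where \<rho>: "\<rho> \<in> RV_fiber v a \<times> RV_fiber v b"
    "\<not> morley_rank_ge (definable_pairs M (rv v)) 2 (inv\<^bsub>RV2 v\<^esub> \<rho> <#\<^bsub>RV2 v\<^esub> X)"
    using frag by (auto simp: fragment_def)
  obtain g h where "g \<noteq> 0" "h \<noteq> 0" "\<rho> = (rv v g, rv v h)"
    using \<rho>(1) by (auto elim!: RV_fiberE)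
  then show False
    using morley_rank_ge_2[OF _ _ _ assms, where g = g and h = h] \<rho>(2) frag by (simp add: fragment_def)
qed

text \<open>The stabilizer pulled back to field elements, where the closure rules for
  \<open>pdef\<close> apply; \<open>Stab_eq\<close> is the link.\<close>

definition stab :: "'a \<Rightarrow> 'a \<Rightarrow> bool" where
  "stab c d \<longleftrightarrow> c \<noteq> 0 \<and> d \<noteq> 0 \<and> (\<forall>x y. x \<noteq> 0 \<and> y \<noteq> 0 \<longrightarrow> rvrel X (c * x) (d * y) = rvrel X x y)"

text \<open>X is non-empty and lies over a single pair of values, which its stabilizer must
  therefore preserve.\<close>

lemma stab_val:
  assumes "stab c d" shows "c \<noteq> 0" "d \<noteq> 0" "v c = 0" "v d = 0"
proof -
  obtain x y where xy: "rvrel X x y" by (rule fragment_point)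
  obtain a b where ab: "\<forall>x y. rvrel X x y \<longrightarrow> v x = a \<and> v y = b" by (rule fragment_val)
  show c: "c \<noteq> 0" "d \<noteq> 0" using assms by (auto simp: stab_def)
  have nz: "x \<noteq> 0" "y \<noteq> 0" using xy by (auto simp: rvrel_def)
  then have "rvrel X (c * x) (d * y)" using assms xy by (auto simp: stab_def)
  then have "v (c * x) = v x" "v (d * y) = v y" using ab xy by auto
  then show "v c = 0" "v d = 0" using c nz by (auto simp: v_mult)
qed

lemma stab_rvrel: "stab c d \<Longrightarrow> x \<noteq> 0 \<Longrightarrow> y \<noteq> 0 \<Longrightarrow> rvrel X (c * x) (d * y) = rvrel X x y"
  unfolding stab_def by blast

lemma stab_apply: "stab c d \<Longrightarrow> rvrel X x y \<Longrightarrow> rvrel X (c * x) (d * y)"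
  by (auto simp: stab_def rvrel_def)

lemma stab_divide:
  assumes "stab c d" "stab c' d'" shows "stab (c / c') (d / d')"
proof -
  have nz: "c \<noteq> 0" "d \<noteq> 0" "c' \<noteq> 0" "d' \<noteq> 0" using assms by (auto simp: stab_def)
  have "rvrel X (c / c' * x) (d / d' * y) = rvrel X x y" if "x \<noteq> 0" "y \<noteq> 0" for x y
  proof -
    have "rvrel X (c * (x / c')) (d * (y / d')) = rvrel X (x / c') (y / d')"
      using that nz by (intro stab_rvrel assms(1)) auto
    moreover have "rvrel X (c' * (x / c')) (d' * (y / d')) = rvrel X (x / c') (y / d')"
      using that nz by (intro stab_rvrel assms(2)) auto
    ultimately show ?thesis using nz by simp
  qed
  then show ?thesis using nz by (simp add: stab_def)
qed

lemma pdef_stab: "tdef M s \<Longrightarrow> tdef M t \<Longrightarrow> pdef M (\<lambda>E. stab (s E) (t E))"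
proof (rule pdef_rel2[where R = stab])
  show "pdef M (\<lambda>E. stab (E 1) (E 0))"
    unfolding stab_def by (intro def_intros pdef_X)
qed

lemma Stab_eq: "Stab v X = {(rv v c, rv v d) |c d. stab c d}"
proof -
  have "Stab v X \<subseteq> carrier (RV v) \<times> carrier (RV v)" by (auto simp: Stab_def)
  then have "Stab v X = {(rv v c, rv v d) |c d. c \<noteq> 0 \<and> d \<noteq> 0 \<and> (rv v c, rv v d) \<in> Stab v X}"
    by (auto 0 4 elim!: carrier_RVE)
  moreover have "(c \<noteq> 0 \<and> d \<noteq> 0 \<and> (rv v c, rv v d) \<in> Stab v X) \<longleftrightarrow> stab c d" for c d
    using Stab_iff[OF X_carrier] unfolding stab_def by blast
  ultimately show ?thesis by (simp only:)
qed

text \<open>If both the kernel and the image of the projection to the first factor had finitely many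
  classes, finitely many cosets of the kernel would cover the stabilizer. The infinite one of the
  two is all of \<open>k\<^sup>\<times>\<close> by \<open>units_subgroup\<close>.\<close>

lemma vertical_or_onto:
  "(\<forall>d. d \<noteq> 0 \<and> v d = 0 \<longrightarrow> stab 1 d) \<or> (\<forall>c. c \<noteq> 0 \<and> v c = 0 \<longrightarrow> (\<exists>d. stab c d))"
proof -
  let ?T = "{d. stab 1 d}" and ?S = "{c. \<exists>d. stab c d}"
  have "infinite (rv v ` ?T) \<or> infinite (rv v ` ?S)"
  proof (rule ccontr)
    assume "\<not> (infinite (rv v ` ?T) \<or> infinite (rv v ` ?S))"
    then have fin: "finite (rv v ` ?T)" "finite (rv v ` ?S)" by auto
    obtain A where A: "A \<subseteq> ?S" "finite A" "rv v ` ?S = rv v ` A"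
      using finite_subset_image[OF fin(2) subset_refl] by auto
    have "\<forall>c\<in>A. \<exists>d. stab c d" using A(1) by blast
    then obtain d where d: "\<And>c. c \<in> A \<Longrightarrow> stab c (d c)" by metis
    have "Stab v X \<subseteq> (\<Union>c\<in>A. {rv v c} \<times> image ((*) (d c)) ` rv v ` ?T)"
    proof
      fix \<rho> assume "\<rho> \<in> Stab v X"
      then obtain c e where ce: "\<rho> = (rv v c, rv v e)" "stab c e" by (auto simp: Stab_eq)
      then have "rv v c \<in> rv v ` ?S" by blast
      then obtain c' where c': "c' \<in> A" "rv v c = rv v c'" unfolding A(3) by blast
      have nz: "c \<noteq> 0" "e \<noteq> 0" "c' \<noteq> 0" using ce(2) d[OF c'(1)] by (auto simp: stab_def)
      \<comment> \<open>By \<open>Stab_iff\<close>, \<open>stab\<close> depends on the classes only,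
        so c may be replaced by its representative in A.\<close>
      have "stab c' e" using ce(2) nz c'(2) Stab_iff[OF X_carrier nz(1,2)] Stab_iff[OF X_carrier nz(3,2)]
        by (simp add: stab_def)
      then have "stab 1 (e / d c')" using stab_divide[OF _ d[OF c'(1)], of c' e] nz(3) by simp
      moreover have "rv v e = (*) (d c') ` rv v (e / d c')"
        using d[OF c'(1)] by (simp add: rv_mult_image[symmetric] stab_def)
      ultimately have "rv v e \<in> image ((*) (d c')) ` rv v ` ?T" by blast
      then show "\<rho> \<in> (\<Union>c\<in>A. {rv v c} \<times> image ((*) (d c)) ` rv v ` ?T)"
        using ce(1) c' by blast
    qed
    moreover have "finite (\<Union>c\<in>A. {rv v c} \<times> image ((*) (d c)) ` rv v ` ?T)"
    proof (intro finite_UN_I A(2))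
      fix c show "finite ({rv v c} \<times> image ((*) (d c)) ` rv v ` ?T)"
        by (rule finite_cartesian_product[OF _ finite_imageI[OF fin(1)]]) simp
    qed
    ultimately show False using inf by (meson finite_subset)
  qed
  then show ?thesis
  proof
    assume T: "infinite (rv v ` ?T)"
    have "d \<in> ?T" if "d \<noteq> 0" "v d = 0" for d
    proof (rule units_subgroup[OF _ _ _ T that])
      have "pdef M (\<lambda>E. stab 1 (E 0))" by (intro pdef_stab def_intros)
      then show "pdef M (\<lambda>E. E 0 \<in> ?T)" by simp
    qed (use stab_val stab_divide[of 1 _ 1] in auto)
    then show ?thesis by blast
  next
    assume S: "infinite (rv v ` ?S)"
    have "c \<in> ?S" if "c \<noteq> 0" "v c = 0" for c
    proof (rule units_subgroup[OF _ _ _ S that])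
      have "pdef M (\<lambda>E. \<exists>d. stab (E 0) d)" by (intro def_intros pdef_stab)
      then show "pdef M (\<lambda>E. E 0 \<in> ?S)" by simp
    qed (use stab_val stab_divide in blast)+
    then show ?thesis by blast
  qed
qed

section \<open>Definability of the locus and the fibres of X\<close>

abbreviation W :: "('g \<times> 'g) set" where "W \<equiv> translate_locus v D X"

text \<open>Replaces an equality of subsets of \<open>RV\<^sup>2\<close> by a first-order condition
  on representatives, which makes the locus definable. The values of g and h are forced, since X
  lies over (a0, b0).\<close>

lemma W_iff:
  assumes "\<forall>x y. rvrel X x y \<longrightarrow> v x = a0 \<and> v y = b0"
  shows "(a, b) \<in> W \<longleftrightarrow> (\<exists>g h. g \<noteq> 0 \<and> h \<noteq> 0 \<and> a = v g + a0 \<and> b = v h + b0 \<and>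
    (\<forall>x y. x \<noteq> 0 \<and> y \<noteq> 0 \<and> v x = a \<and> v y = b \<longrightarrow> (rvrel D x y \<longleftrightarrow> rvrel X (x / g) (y / h))))"
proof
  note val = assms[rule_format]
  assume "(a, b) \<in> W"
  then obtain \<rho> where \<rho>: "\<rho> \<in> carrier (RV2 v)"
    "D \<inter> (RV_fiber v a \<times> RV_fiber v b) = \<rho> <#\<^bsub>RV2 v\<^esub> X"
    by (auto simp: translate_locus_def)
  obtain g h where gh: "g \<noteq> 0" "h \<noteq> 0" "\<rho> = (rv v g, rv v h)"
    using \<rho>(1) by (auto elim!: carrier_RVE)
  have mem: "(rvrel D x y \<and> v x = a \<and> v y = b) \<longleftrightarrow> rvrel X (x / g) (y / h)"
    if "x \<noteq> 0" "y \<noteq> 0" for x y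
  proof -
    have "(rv v x, rv v y) \<in> D \<inter> (RV_fiber v a \<times> RV_fiber v b) \<longleftrightarrow> (rv v (x / g), rv v (y / h)) \<in> X"
      unfolding \<rho>(2) gh(3) by (rule mem_translate[OF X_carrier gh(1,2) that])
    then show ?thesis using that gh by (auto simp: rvrel_def mem_RV_fiber)
  qed
  obtain x0 y0 where xy: "rvrel X x0 y0" by (rule fragment_point)
  then have nz: "x0 \<noteq> 0" "y0 \<noteq> 0" by (auto simp: rvrel_def)
  then have "v (g * x0) = a" "v (h * y0) = b" using mem[of "g * x0" "h * y0"] gh xy by auto
  then have "a = v g + a0" "b = v h + b0" using gh nz val[OF xy] by (auto simp: v_mult)
  then show "\<exists>g h. g \<noteq> 0 \<and> h \<noteq> 0 \<and> a = v g + a0 \<and> b = v h + b0 \<and>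
    (\<forall>x y. x \<noteq> 0 \<and> y \<noteq> 0 \<and> v x = a \<and> v y = b \<longrightarrow> (rvrel D x y \<longleftrightarrow> rvrel X (x / g) (y / h)))"
    using gh mem by blast
next
  note val = assms[rule_format]
  assume "\<exists>g h. g \<noteq> 0 \<and> h \<noteq> 0 \<and> a = v g + a0 \<and> b = v h + b0 \<and>
    (\<forall>x y. x \<noteq> 0 \<and> y \<noteq> 0 \<and> v x = a \<and> v y = b \<longrightarrow> (rvrel D x y \<longleftrightarrow> rvrel X (x / g) (y / h)))"
  then obtain g h where gh: "g \<noteq> 0" "h \<noteq> 0" "a = v g + a0" "b = v h + b0"
    and eq: "\<And>x y. x \<noteq> 0 \<Longrightarrow> y \<noteq> 0 \<Longrightarrow> v x = a \<Longrightarrow> v y = b \<Longrightarrow> (rvrel D x y \<longleftrightarrow> rvrel X (x / g) (y / h))"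
    by blast
  let ?L = "D \<inter> (RV_fiber v a \<times> RV_fiber v b)" and ?R = "(rv v g, rv v h) <#\<^bsub>RV2 v\<^esub> X"
  have sub: "?L \<subseteq> carrier (RV2 v)" "?R \<subseteq> carrier (RV2 v)"
    using translate_subset_carrier[OF X_carrier gh(1,2)] by (auto simp: RV_fiber_def)
  have iff: "(rv v x, rv v y) \<in> ?L \<longleftrightarrow> (rv v x, rv v y) \<in> ?R" if nz: "x \<noteq> 0" "y \<noteq> 0" for x y
  proof -
    have "(rv v x, rv v y) \<in> ?L \<longleftrightarrow> rvrel D x y \<and> v x = a \<and> v y = b"
      using nz by (auto simp: rvrel_def mem_RV_fiber)
    also have "\<dots> \<longleftrightarrow> rvrel X (x / g) (y / h)"
    proof
      assume R: "rvrel X (x / g) (y / h)"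
      have "v x = a" "v y = b" using val[OF R] nz gh by (auto simp: v_divide algebra_simps)
      then show "rvrel D x y \<and> v x = a \<and> v y = b" using eq nz R by blast
    qed (use eq nz in blast)
    also have "\<dots> \<longleftrightarrow> (rv v x, rv v y) \<in> ?R"
      using mem_translate[OF X_carrier gh(1,2) nz] nz gh by (simp add: rvrel_def)
    finally show ?thesis .
  qed
  have "\<rho> \<in> ?L \<longleftrightarrow> \<rho> \<in> ?R" if \<rho>: "\<rho> \<in> carrier (RV2 v)" for \<rho>
  proof -
    have "\<rho> \<in> carrier (RV v) \<times> carrier (RV v)" using \<rho> by simp
    then obtain x y where "x \<noteq> 0" "y \<noteq> 0" "\<rho> = (rv v x, rv v y)" by (auto elim!: carrier_RVE)
    then show ?thesis using iff by blast
  qed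
  then have "?L = ?R" using sub by blast
  moreover have "(rv v g, rv v h) \<in> carrier (RV2 v)" using gh by (simp add: rv_in_carrier)
  ultimately show "(a, b) \<in> W" unfolding translate_locus_def by blast
qed

lemma vdef2_W: "vdef2 W"
proof -
  obtain a0 b0 where "\<forall>x y. rvrel X x y \<longrightarrow> v x = a0 \<and> v y = b0" by (rule fragment_val)
  note iff = W_iff[OF this]
  show ?thesis unfolding vdef2_def iff by (intro def_intros pdef_X pdef_D)
qed

lemma vdef2_converse_W: "vdef2 (W\<inverse>)"
  unfolding vdef2_def converse_iff by (intro pdef_mem2[OF vdef2_W] def_intros)

lemma W_translate:
  assumes "(a, b) \<in> W"
  shows "\<exists>g h. g \<noteq> 0 \<and> h \<noteq> 0 \<and> (\<forall>x y. rvrel X x y \<longrightarrow> v (g * x) = a \<and> v (h * y) = b) \<and>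
    (\<forall>x y. x \<noteq> 0 \<longrightarrow> y \<noteq> 0 \<longrightarrow> v x = a \<longrightarrow> v y = b \<longrightarrow>
      (rvrel D x y \<longleftrightarrow> rvrel X (x / g) (y / h)))"
proof -
  obtain a0 b0 where val: "\<forall>x y. rvrel X x y \<longrightarrow> v x = a0 \<and> v y = b0" by (rule fragment_val)
  from iffD1[OF W_iff[OF val] assms] obtain g h
    where gh: "g \<noteq> 0" "h \<noteq> 0" "a = v g + a0" "b = v h + b0"
    and eq: "\<forall>x y. x \<noteq> 0 \<and> y \<noteq> 0 \<and> v x = a \<and> v y = b \<longrightarrow> (rvrel D x y \<longleftrightarrow> rvrel X (x / g) (y / h))"
    by (elim exE conjE)
  have "v (g * x) = a \<and> v (h * y) = b" if xy: "rvrel X x y" for x y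
  proof -
    have "x \<noteq> 0" "y \<noteq> 0" using xy by (auto simp: rvrel_def)
    then show ?thesis using val[rule_format, OF xy] gh(1,2) by (simp add: v_mult gh(3,4))
  qed
  moreover have "rvrel D x y \<longleftrightarrow> rvrel X (x / g) (y / h)"
    if "x \<noteq> 0" "y \<noteq> 0" "v x = a" "v y = b" for x y
    using spec[OF spec[OF eq, of x], of y] that by simp
  ultimately show ?thesis using gh(1,2) by blast
qed

text \<open>The stabilizer carries the fibre over x to the fibre over every class of the same value.
  One infinite fibre would make them all infinite, and X would have rank 2.\<close>

lemma onto_fibres:
  assumes onto: "\<And>c. c \<noteq> 0 \<Longrightarrow> v c = 0 \<Longrightarrow> \<exists>d. stab c d" and x: "x \<noteq> 0"
  shows "finite (rv v ` {y. rvrel X x y})"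
proof (rule ccontr)
  assume inf: "infinite (rv v ` {y. rvrel X x y})"
  let ?C = "(*) x ` {c. c \<noteq> 0 \<and> v c = 0}"
  show False
  proof (rule fragment_small)
    have "rv v ` ?C = rv v ` {z. z \<noteq> 0 \<and> v z = v x}"
    proof -
      have "?C = {z. z \<noteq> 0 \<and> v z = v x}"
      proof (intro equalityI subsetI)
        fix z assume "z \<in> {z. z \<noteq> 0 \<and> v z = v x}"
        then have "z / x \<in> {c. c \<noteq> 0 \<and> v c = 0}" "z = x * (z / x)" using x by (auto simp: v_divide)
        then show "z \<in> ?C" by (metis imageI)
      qed (use x in \<open>auto simp: v_mult\<close>)
      then show ?thesis by simp
    qed
    then show "infinite (rv v ` ?C)" using infinite_fiber by simp
    show "0 \<notin> ?C" using x by auto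
    fix z assume "z \<in> ?C"
    then obtain c where c: "c \<noteq> 0" "v c = 0" "z = x * c" by blast
    from onto[OF c(1,2)] obtain d where d: "stab c d" by blast
    have "(*) d ` {y. rvrel X x y} \<subseteq> {y. rvrel X z y}"
      using stab_apply[OF d] by (auto simp: c(3) mult.commute[of x c])
    then have "rv v ` (*) d ` {y. rvrel X x y} \<subseteq> rv v ` {y. rvrel X z y}" by (rule image_mono)
    moreover have "infinite (rv v ` (*) d ` {y. rvrel X x y})"
    proof
      assume "finite (rv v ` (*) d ` {y. rvrel X x y})"
      then have "finite (image ((*) (1 / d)) ` rv v ` (*) d ` {y. rvrel X x y})"
        by (rule finite_imageI)
      moreover have "(*) (1 / d) ` rv v (d * y) = rv v y" for y
        using rv_mult_image[of "1 / d" "d * y"] stab_val[OF d] by simp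
      ultimately show False using inf by (simp only: image_image)
    qed
    ultimately show "infinite (rv v ` {y. rvrel X z y})" by (meson finite_subset)
  qed
qed

text \<open>A non-empty fibre is invariant under all units, hence infinite; infinitely many such
  fibres would give X rank 2.\<close>

lemma vertical_fibres:
  assumes vert: "\<And>d. d \<noteq> 0 \<Longrightarrow> v d = 0 \<Longrightarrow> stab 1 d"
  shows "finite (rv v ` {x. \<exists>y. rvrel X x y})"
proof (rule ccontr)
  assume inf: "infinite (rv v ` {x. \<exists>y. rvrel X x y})"
  show False
  proof (rule fragment_small[OF inf])
    show "0 \<notin> {x. \<exists>y. rvrel X x y}" by (auto simp: rvrel_def)
    fix x assume "x \<in> {x. \<exists>y. rvrel X x y}"
    then obtain y where y: "rvrel X x y" by blast
    then have "y \<noteq> 0" by (auto simp: rvrel_def)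
    have "z \<in> {y. rvrel X x y}" if z: "z \<noteq> 0" "v z = v y" for z
    proof -
      have "stab 1 (z / y)" using z \<open>y \<noteq> 0\<close> by (intro vert) (auto simp: v_divide)
      from stab_apply[OF this y] show ?thesis using \<open>y \<noteq> 0\<close> by simp
    qed
    then have "{z. z \<noteq> 0 \<and> v z = v y} \<subseteq> {y. rvrel X x y}" by blast
    then have "rv v ` {z. z \<noteq> 0 \<and> v z = v y} \<subseteq> rv v ` {y. rvrel X x y}" by (rule image_mono)
    then show "infinite (rv v ` {y. rvrel X x y})" using infinite_fiber[of "v y"] by (meson finite_subset)
  qed
qed

section \<open>The two cases for the stabilizer\<close>

lemma finite_rv_scale:
  assumes "finite (rv v ` A)" shows "finite (rv v ` {y. y / h \<in> A \<and> h \<noteq> 0})"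
proof -
  have "rv v y \<in> image ((*) h) ` rv v ` A" if "y / h \<in> A" "h \<noteq> 0" for y
    using rv_mult_image[of h "y / h"] that by simp
  then have "rv v ` {y. y / h \<in> A \<and> h \<noteq> 0} \<subseteq> image ((*) h) ` rv v ` A" by blast
  then show ?thesis using assms by (meson finite_subset finite_imageI)
qed

lemma onto_case:
  assumes onto: "\<And>c. c \<noteq> 0 \<Longrightarrow> v c = 0 \<Longrightarrow> \<exists>d. stab c d"
  shows "\<exists>P \<S>. finite P \<and> finite \<S> \<and> (\<forall>A \<in> \<S>. line_segment M v A) \<and>
    (\<forall>A \<in> \<S>. \<forall>B \<in> \<S>. same_slope A B) \<and> W = P \<union> \<Union>\<S>"
proof -
  have R: "pdef M (\<lambda>E. rvrel D (E 1) (E 0))" by (intro pdef_D def_intros)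
  have ne: "\<exists>y. y \<noteq> 0 \<and> v y = b \<and> rvrel D x y" if x: "x \<noteq> 0" and W: "(v x, b) \<in> W" for x b
  proof -
    from W_translate[OF W] obtain g h where gh': "g \<noteq> 0" "h \<noteq> 0"
      "\<forall>x' y. rvrel X x' y \<longrightarrow> v (g * x') = v x \<and> v (h * y) = b"
      "\<forall>x' y. x' \<noteq> 0 \<longrightarrow> y \<noteq> 0 \<longrightarrow> v x' = v x \<longrightarrow> v y = b \<longrightarrow> (rvrel D x' y \<longleftrightarrow> rvrel X (x' / g) (y / h))"
      by (elim exE conjE)
    note gh = gh'(1,2) gh'(3,4)[rule_format]
    obtain x0 y0 where xy: "rvrel X x0 y0" by (rule fragment_point)
    then have nz: "x0 \<noteq> 0" "y0 \<noteq> 0" by (auto simp: rvrel_def)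
    \<comment> \<open>x / g and x0 have the same value, so an element of the stabilizer moves the
      point (x0, y0) of X to the fibre over x / g.\<close>
    have "v (x / g / x0) = 0" using gh(3)[OF xy] gh(1) nz x by (simp add: v_divide v_mult algebra_simps)
    then obtain d where d: "stab (x / g / x0) d" using onto[of "x / g / x0"] gh(1) nz x by auto
    have X: "rvrel X (x / g) (d * y0)" using stab_apply[OF d xy] nz by simp
    have "d \<noteq> 0" using d by (auto simp: stab_def)
    moreover have "v (h * (d * y0)) = b" using gh(3)[OF X] by simp
    ultimately show ?thesis using X gh(4)[of x "h * (d * y0)"] x gh(2) nz
      by (intro exI[of _ "h * (d * y0)"]) simp
  qed
  have fin: "finite (rv v ` {y. y \<noteq> 0 \<and> v y = b \<and> rvrel D x y})" if x: "x \<noteq> 0" and W: "(v x, b) \<in> W" for x b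
  proof -
    from W_translate[OF W] obtain g h where gh': "g \<noteq> 0" "h \<noteq> 0"
      "\<forall>x' y. rvrel X x' y \<longrightarrow> v (g * x') = v x \<and> v (h * y) = b"
      "\<forall>x' y. x' \<noteq> 0 \<longrightarrow> y \<noteq> 0 \<longrightarrow> v x' = v x \<longrightarrow> v y = b \<longrightarrow> (rvrel D x' y \<longleftrightarrow> rvrel X (x' / g) (y / h))"
      by (elim exE conjE)
    note gh = gh'(1,2) gh'(3,4)[rule_format]
    have "{y. y \<noteq> 0 \<and> v y = b \<and> rvrel D x y} \<subseteq> {y. y / h \<in> {y. rvrel X (x / g) y} \<and> h \<noteq> 0}"
      using gh(2,4) x by auto
    moreover have "finite (rv v ` {y. y / h \<in> {y. rvrel X (x / g) y} \<and> h \<noteq> 0})"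
      using onto x gh(1) by (intro finite_rv_scale onto_fibres) auto
    ultimately show ?thesis by (meson finite_subset image_mono)
  qed
  \<comment> \<open>Scaling commutes with translation by (g, h), so one pair (c, d) from the
    stabilizer of X preserves D over every point of W.\<close>
  have units: "\<exists>d. d \<noteq> 0 \<and> v d = 0 \<and>
      (\<forall>x y. x \<noteq> 0 \<and> y \<noteq> 0 \<and> (v x, v y) \<in> W \<and> rvrel D x y \<longrightarrow> rvrel D (c * x) (d * y))"
    if c: "c \<noteq> 0" "v c = 0" for c
  proof -
    obtain d where d: "stab c d" using onto[OF c] by blast
    note dv = stab_val[OF d]
    have "rvrel D (c * x) (d * y)"
      if xy: "x \<noteq> 0" "y \<noteq> 0" "(v x, v y) \<in> W" "rvrel D x y" for x y
    proof -
      from W_translate[OF xy(3)] obtain g h where gh': "g \<noteq> 0" "h \<noteq> 0"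
        "\<forall>x' y'. rvrel X x' y' \<longrightarrow> v (g * x') = v x \<and> v (h * y') = v y"
        "\<forall>x' y'. x' \<noteq> 0 \<longrightarrow> y' \<noteq> 0 \<longrightarrow> v x' = v x \<longrightarrow> v y' = v y \<longrightarrow> (rvrel D x' y' \<longleftrightarrow> rvrel X (x' / g) (y' / h))"
        by (elim exE conjE)
      note gh = gh'(1,2) gh'(3,4)[rule_format]
      have "rvrel X (x / g) (y / h)" using gh(4)[of x y] xy by simp
      from stab_apply[OF d this] have "rvrel X (c * x / g) (d * y / h)" by simp
      then show ?thesis using gh(4)[of "c * x" "d * y"] xy dv by (simp add: v_mult)
    qed
    then show ?thesis using dv by blast
  qed
  have "pieces (\<lambda>G. \<exists>I f. open_interval I \<and> vfun f \<and> G = graph f I \<and> linear_on_interval I f \<and> G \<subseteq> W) W"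
    by (rule linear_decomposition[OF vdef2_W R ne fin units])
  then obtain P \<S> where *: "finite P" "finite \<S>" "W = P \<union> \<Union>\<S>"
    "\<forall>G\<in>\<S>. \<exists>I f. open_interval I \<and> vfun f \<and> G = graph f I \<and> linear_on_interval I f \<and> G \<subseteq> W"
    unfolding pieces_def by (elim exE conjE)
  have "line_segment M v A" if "A \<in> \<S>" for A
  proof -
    from bspec[OF *(4) that] obtain I f
      where If: "open_interval I" "vfun f" "A = graph f I" "linear_on_interval I f" "A \<subseteq> W"
      by (elim exE conjE)
    have "definable_pairs M v A"
      unfolding If(3) definable_pairs_iff_vdef2 by (intro vdef2_graph vdef1_open_interval If(1,2))
    then show ?thesis unfolding line_segment_def using If(1,3,4) by blast
  qed
  moreover have "same_slope A B" if "A \<in> \<S>" "B \<in> \<S>" for A B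
  proof -
    from bspec[OF *(4) that(1)] obtain I f
      where If: "open_interval I" "vfun f" "A = graph f I" "linear_on_interval I f" "A \<subseteq> W"
      by (elim exE conjE)
    from bspec[OF *(4) that(2)] obtain J g
      where Jg: "open_interval J" "vfun g" "B = graph g J" "linear_on_interval J g" "B \<subseteq> W"
      by (elim exE conjE)
    have sub: "graph f I \<subseteq> W" "graph g J \<subseteq> W" using If(5) Jg(5) unfolding If(3) Jg(3) by this+
    show ?thesis unfolding If(3) Jg(3)
      by (rule same_slope_graphs[OF vdef2_W R ne fin units Jg(1,2) sub(2) If(1,2) sub(1)])
  qed
  ultimately show ?thesis by (intro exI[of _ P] exI[of _ \<S>] conjI ballI *(1-3))
qed

lemma vertical_case:
  assumes vert: "\<And>d. d \<noteq> 0 \<Longrightarrow> v d = 0 \<Longrightarrow> stab 1 d"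
  shows "\<exists>P \<S>. finite P \<and> finite \<S> \<and> (\<forall>A \<in> \<S>. line_segment M v A) \<and>
    (\<forall>A \<in> \<S>. \<forall>B \<in> \<S>. same_slope A B) \<and> W = P \<union> \<Union>\<S>"
proof -
  \<comment> \<open>With the coordinates exchanged the fibres become finite: they lie in a translate
    of the first projection of X, which has finitely many classes by
    \<open>vertical_fibres\<close>.\<close>
  let ?R = "\<lambda>x y. rvrel D y x"
  have R: "pdef M (\<lambda>E. ?R (E 1) (E 0))" by (intro pdef_D def_intros)
  have ne: "\<exists>y. y \<noteq> 0 \<and> v y = b \<and> ?R x y" if x: "x \<noteq> 0" and W: "(v x, b) \<in> W\<inverse>" for x b
  proof -
    from W_translate[OF W[unfolded converse_iff]] obtain g h where gh': "g \<noteq> 0" "h \<noteq> 0"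
      "\<forall>y x'. rvrel X y x' \<longrightarrow> v (g * y) = b \<and> v (h * x') = v x"
      "\<forall>y x'. y \<noteq> 0 \<longrightarrow> x' \<noteq> 0 \<longrightarrow> v y = b \<longrightarrow> v x' = v x \<longrightarrow> (rvrel D y x' \<longleftrightarrow> rvrel X (y / g) (x' / h))"
      by (elim exE conjE)
    note gh = gh'(1,2) gh'(3,4)[rule_format]
    obtain y0 x0 where xy: "rvrel X y0 x0" by (rule fragment_point)
    then have nz: "x0 \<noteq> 0" "y0 \<noteq> 0" by (auto simp: rvrel_def)
    have "v (x / h / x0) = 0" using gh(3)[OF xy] gh(2) nz x by (simp add: v_divide v_mult algebra_simps)
    then have d: "stab 1 (x / h / x0)" using gh(2) nz x by (intro vert) auto
    have X: "rvrel X y0 (x / h)" using stab_apply[OF d xy] nz by simp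
    then show ?thesis using gh(4)[of "g * y0" x] gh(3)[OF X] x gh(1) nz
      by (intro exI[of _ "g * y0"]) simp
  qed
  have fin: "finite (rv v ` {y. y \<noteq> 0 \<and> v y = b \<and> ?R x y})" if x: "x \<noteq> 0" and W: "(v x, b) \<in> W\<inverse>" for x b
  proof -
    from W_translate[OF W[unfolded converse_iff]] obtain g h where gh': "g \<noteq> 0" "h \<noteq> 0"
      "\<forall>y x'. rvrel X y x' \<longrightarrow> v (g * y) = b \<and> v (h * x') = v x"
      "\<forall>y x'. y \<noteq> 0 \<longrightarrow> x' \<noteq> 0 \<longrightarrow> v y = b \<longrightarrow> v x' = v x \<longrightarrow> (rvrel D y x' \<longleftrightarrow> rvrel X (y / g) (x' / h))"
      by (elim exE conjE)
    note gh = gh'(1,2) gh'(3,4)[rule_format]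
    have "{y. y \<noteq> 0 \<and> v y = b \<and> ?R x y} \<subseteq> {y. y / g \<in> {y. \<exists>x. rvrel X y x} \<and> g \<noteq> 0}"
      using gh(1,4) x by auto
    moreover have "finite (rv v ` {y. y / g \<in> {y. \<exists>x. rvrel X y x} \<and> g \<noteq> 0})"
      using vert by (intro finite_rv_scale vertical_fibres) auto
    ultimately show ?thesis by (meson finite_subset image_mono)
  qed
  \<comment> \<open>The unit x' / x acts on the second coordinate through the stabilizer, so D over
    W sees only its value.\<close>
  have prod: "?R x' y" if xy: "x \<noteq> 0" "x' \<noteq> 0" "y \<noteq> 0" "v x = v x'" "(v x, v y) \<in> W\<inverse>" "?R x y"
    for x x' y
  proof -
    from W_translate[OF xy(5)[unfolded converse_iff]] obtain g h where gh': "g \<noteq> 0" "h \<noteq> 0"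
      "\<forall>y' x'. rvrel X y' x' \<longrightarrow> v (g * y') = v y \<and> v (h * x') = v x"
      "\<forall>y' x'. y' \<noteq> 0 \<longrightarrow> x' \<noteq> 0 \<longrightarrow> v y' = v y \<longrightarrow> v x' = v x \<longrightarrow> (rvrel D y' x' \<longleftrightarrow> rvrel X (y' / g) (x' / h))"
      by (elim exE conjE)
    note gh = gh'(1,2) gh'(3,4)[rule_format]
    have X: "rvrel X (y / g) (x / h)" using gh(4)[of y x] xy by simp
    have "stab 1 (x' / x)" using xy by (intro vert) (auto simp: v_divide)
    from stab_apply[OF this X] have "rvrel X (y / g) (x' / h)" using xy(1) by simp
    then show ?thesis using gh(4)[of y x'] xy by simp
  qed
  have dec: "pieces (\<lambda>G. \<exists>I b. open_interval I \<and> G = I \<times> {b}) (W\<inverse>)"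
    by (rule constant_decomposition[OF vdef2_converse_W R ne fin prod])
  have swap: "prod.swap ` (W\<inverse>) = W"
  proof (intro equalityI subsetI)
    fix p assume "p \<in> W"
    then show "p \<in> prod.swap ` (W\<inverse>)" by (intro image_eqI[of _ _ "prod.swap p"]) (cases p, auto)+
  qed auto
  have "pieces (\<lambda>H. \<exists>G. (\<exists>I b. open_interval I \<and> G = I \<times> {b}) \<and> G \<subseteq> W\<inverse> \<and> H = prod.swap ` G) W"
    using pieces_image[OF dec, of prod.swap] unfolding swap .
  then have "pieces (\<lambda>H. \<exists>I b. open_interval I \<and> H = {b} \<times> I) W"
  proof (rule pieces_mono, elim exE conjE)
    fix H G I b assume "open_interval I" "G = I \<times> {b}" "H = prod.swap ` G"
    then show "\<exists>I b. open_interval I \<and> H = {b} \<times> I"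
      by (intro exI[of _ I] exI[of _ b]) (simp add: product_swap)
  qed
  then obtain P \<S> where *: "finite P" "finite \<S>" "W = P \<union> \<Union>\<S>"
    and seg': "\<forall>A\<in>\<S>. \<exists>I b. open_interval I \<and> A = {b} \<times> I"
    unfolding pieces_def by (elim exE conjE)
  note seg = bspec[OF seg']
  have "line_segment M v A" if "A \<in> \<S>" for A
    using seg[OF that] unfolding line_segment_def by blast
  moreover have "same_slope A B" if "A \<in> \<S>" "B \<in> \<S>" for A B
  proof -
    from seg[OF that(1)] obtain I a where Ia: "open_interval I" "A = {a} \<times> I" by blast
    from seg[OF that(2)] obtain J b where Jb: "open_interval J" "B = {b} \<times> J" by blast
    obtain x y where xy: "x \<in> I" "y \<in> J" using Ia(1) Jb(1) by (auto simp: open_interval_def)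
    obtain p q where pq: "p < x" "x < q" "\<And>u. p < u \<Longrightarrow> u < q \<Longrightarrow> u \<in> I"
      using open_interval_nbhd[OF Ia(1) xy(1)] unfolding locally_at_def by blast
    obtain p' q' where pq': "p' < y" "y < q'" "\<And>u. p' < u \<Longrightarrow> u < q' \<Longrightarrow> u \<in> J"
      using open_interval_nbhd[OF Jb(1) xy(2)] unfolding locally_at_def by blast
    \<comment> \<open>This shift moves y to x, so that I and the shifted J share an interval to the
      right of x.\<close>
    define e where "e = x - y"
    have mem: "(a, u) \<in> A \<inter> (\<lambda>(r, s). (r + (a - b), s + e)) ` B" if u: "x < u" "u < min q (q' + e)" for u
    proof -
      have "y < u - e" "u - e < q'" using u by (auto simp: e_def algebra_simps)
      then have "u - e \<in> J" using pq' by (auto intro: less_trans)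
      then have "(a, u) \<in> (\<lambda>(r, s). (r + (a - b), s + e)) ` B"
        unfolding Jb(2) by (intro image_eqI[of _ _ "(b, u - e)"]) auto
      moreover have "u \<in> I" using u pq by (auto intro: less_trans)
      ultimately show ?thesis unfolding Ia(2) by simp
    qed
    then have "Pair a ` {x<..<min q (q' + e)} \<subseteq> A \<inter> (\<lambda>(r, s). (r + (a - b), s + e)) ` B" by auto
    moreover have "x < min q (q' + e)" using pq pq' by (auto simp: e_def algebra_simps)
    then have "infinite (Pair a ` {x<..<min q (q' + e)})"
      using infinite_greaterThanLessThan by (simp add: finite_image_iff inj_on_def)
    ultimately show ?thesis unfolding same_slope_def by (meson finite_subset)
  qed
  ultimately show ?thesis by (intro exI[of _ P] exI[of _ \<S>] conjI ballI *(1-3))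
qed

lemma translate_locus_segments:
  "\<exists>P \<S>. finite P \<and> finite \<S> \<and> (\<forall>A \<in> \<S>. line_segment M v A) \<and>
    (\<forall>A \<in> \<S>. \<forall>B \<in> \<S>. same_slope A B) \<and> W = P \<union> \<Union>\<S>"
  using vertical_or_onto vertical_case onto_case by blast

end

end

theorem theorem4p17:
  fixes M :: "('f vf_fun, 'r vf_rel, 'a::alg_closed_field) fo_struct"
    and v :: "'a \<Rightarrow> 'g::linordered_ab_group_add"
    and D X :: "('a set \<times> 'a set) set"
  assumes "C_minimal_ACVF_monster M v"
    and "definable_pairs M (rv v) D"
    and "fragment M v X"
    and "infinite (Stab v X)"
  shows "\<exists>P \<S>. finite P \<and> finite \<S> \<and>
           (\<forall>A \<in> \<S>. line_segment M v A) \<and>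
           (\<forall>A \<in> \<S>. \<forall>B \<in> \<S>. same_slope A B) \<and>
           translate_locus v D X = P \<union> \<Union>\<S>"
  by (rule acvf.translate_locus_segments[OF acvf.intro]) (fact assms)+

end
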